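(* Let $U\cong\mathbb{R}^d$, $\Lambda\subseteq U$ a lattice, and $X\subseteq\Lambda$ a finite list spanning $U$. There exists a (canonical) linear isomorphism $L:\mathcal{P}^{\mathrm{per}}_{\mathbb{C}}(X)\to\mathbb{C}[\Lambda]/\mathcal{J}^\nabla_{\mathbb{C}}(X)$ such that $$\langle p,f\rangle_\nabla=\langle L(p),f\rangle$$ for all $p\in\mathcal{P}^{\mathrm{per}}_{\mathbb{C}}(X)$ and $f\in\mathcal{D}\mathcal{M}_{\mathbb{C}}(X)$.
   Context: **Basic setup.** Lists may contain repetitions. $V=U^*$. Via a basis of $\Lambda$, $\mathrm{Sym}(U_{\mathbb{C}})=\mathbb{C}[s_1,\dots,s_d]$ and $\mathrm{Sym}(V_{\mathbb{C}})=\mathbb{C}[t_1,\dots,t_d]$. $q(D)$ is the differential operator obtained by $s_i\mapsto\partial/\partial t_i$. $p_u$ is the linear form of $u\in U$, and $p_Y=\prod_{y\in Y}p_y$. The standard pairing is $\langle q,f\rangle=(q(D)f)(0)$. **Continuous spaces.** For $Y$ spanning $U$: - $\mathcal{P}_{\mathbb{C}}(Y)=\operatorname{span}\{p_Z:Y\setminus Z\text{ spans }U\}$. - Cocircuits of $Y$ are minimal sublists $C$ with $Y\setminus C$ not spanning $U$, and $\mathcal{J}(Y)$ is the ideal generated by the $p_C$. - $\mathcal{D}_{\mathbb{C}}(Y)=\{f:q(D)f=0\ \forall q\in\mathcal{J}(Y)\}$. **Periodic space.** $T(\Lambda)=\mathrm{Hom}(\Lambda,S^1)$, $\mathcal{V}(X)=\{e_\phi:e_\phi(b)=1\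 \forall b\in B$ for some basis $B\subseteq X$ of $U\}$, and $X_\phi=(x\in X:e_\phi(x)=1)$. $$\mathcal{P}^{\mathrm{per}}_{\mathbb{C}}(X)=\bigoplus_{e_\phi\in\mathcal{V}(X)}e_\phi\,p_{X\setminus X_\phi}\mathcal{P}_{\mathbb{C}}(X_\phi).$$ **Discrete space.** $\mathbb{C}[\Lambda]$ acts on functions $\Lambda\to\mathbb{C}$ by translations $\tau_\lambda f=f(\cdot-\lambda)$. $\mathcal{J}^\nabla_{\mathbb{C}}(X)\subseteq\mathbb{C}[\Lambda]$ is generated by $\prod_{x\in C}(1-x)$ for cocircuits $C$ of $X$, and $\mathcal{D}\mathcal{M}_{\mathbb{C}}(X)=\{f:\Lambda\to\mathbb{C}:qf=0\ \forall q\in\mathcal{J}^\nabla_{\mathbb{C}}(X)\}$. It is known that $\mathcal{D}\mathcal{M}_{\mathbb{C}}(X)=\bigoplus_\phi e_\phi\mathcal{D}_{\mathbb{C}}(X_\phi)|_\Lambda$, with each $f_\phi\in\mathcal{D}_{\mathbb{C}}(X_\phi)|_\Lambda$ identified with a unique polynomial in $\mathcal{D}_{\mathbb{C}}(X_\phi)$. **Pairings.** For $p=\sum_\phi e_\phi p_{X\setminus X_\phi}q_\phi$ ($q_\phi\in\mathcal{P}_{\mathbb{C}}(X_\phi)$) and $f=\sum_\phi e_\phi f_\phi$, set $\langle p,f\rangle_\nabla=\sum_\phi\langle q_\phi,f_\phi\rangle$. The pairing $\mathbb{C}[\Lambda]/\mathcal{J}^\nabla_{\mathbb{C}}(X)\times\mathcal{D}\mathcal{M}_{\mathbb{C}}(X)\to\mathbb{C}$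 is given by $\langle\sum_\lambda c_\lambda\lambda,f\rangle=\sum_\lambda c_\lambda f(\lambda)$. *)

theory Defs
  imports
    "HOL-Analysis.Analysis"
    "HOL-Library.FuncSet"
    "HOL-Library.Poly_Mapping"
    "HOL-Algebra.QuotRing"
begin

text \<open>
  The real vector space $U$ is the whole type \<^typ>\<open>'u\<close> (a \<^class>\<open>real_vector\<close>). Finite lists are
  Isabelle lists, so repetitions are allowed; a sublist of \<open>Y\<close> is \<^term>\<open>nths Y I\<close> for a set
  \<open>I \<subseteq> {..<length Y}\<close> of positions, and \<open>Y \<setminus> Z\<close> is then \<^term>\<open>nths Y (- I)\<close>.

  The type \<^typ>\<open>'a \<Rightarrow>\<^sub>0 complex\<close> carries the convolution product. It serves both as the polynomial
  ring (\<open>'a = nat \<Rightarrow>\<^sub>0 nat\<close>, exponent vectors) and as the group algebra (\<open>'a = 'u\<close>). Subrings are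
  turned into rings of HOL-Algebra by \<open>ring_on\<close>.
\<close>

abbreviation "keys \<equiv> Poly_Mapping.keys"
abbreviation "lookup \<equiv> Poly_Mapping.lookup"
abbreviation "single \<equiv> Poly_Mapping.single"

definition ring_on :: "'a::comm_ring_1 set \<Rightarrow> 'a ring"
  where "ring_on S = \<lparr>carrier = S, monoid.mult = (*), one = 1, zero = 0, add = (+)\<rparr>"

definition cscale :: "complex \<Rightarrow> ('a::comm_monoid_add \<Rightarrow>\<^sub>0 complex) \<Rightarrow> ('a \<Rightarrow>\<^sub>0 complex)"
  where "cscale c p = single 0 c * p"

global_interpretation cpm: vector_space "cscale :: complex \<Rightarrow> ('a::comm_monoid_add \<Rightarrow>\<^sub>0 complex) \<Rightarrow> _"
proof
  show "cscale 1 x = x" for x :: "'a \<Rightarrow>\<^sub>0 complex"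
    by (simp add: cscale_def)
qed (simp_all add: cscale_def algebra_simps mult_single single_add)


subsection \<open>Polynomials and differential operators\<close>

text \<open>
  Variables with index at least the rank \<open>d\<close> exist in the type, so \<open>\<complex>[s\<^sub>1,\<dots>,s\<^sub>d]\<close> is a subset of it.
  The same polynomial type is used for \<open>Sym(U\<^sub>\<complex>)\<close> (variables \<open>s\<^sub>i\<close>) and for \<open>Sym(V\<^sub>\<complex>)\<close>
  (variables \<open>t\<^sub>i\<close>).
\<close>

type_synonym mpoly = "(nat \<Rightarrow>\<^sub>0 nat) \<Rightarrow>\<^sub>0 complex"

definition polys :: "nat \<Rightarrow> mpoly set"
  where "polys d = {f. \<forall>m\<in>keys f. keys m \<subseteq> {..<d}}"

definition Var :: "nat \<Rightarrow> mpoly"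
  where "Var i = single (single i 1) 1"

definition poly_eval :: "mpoly \<Rightarrow> (nat \<Rightarrow> complex) \<Rightarrow> complex"
  where "poly_eval f x = (\<Sum>m\<in>keys f. lookup f m * (\<Prod>i\<in>keys m. x i ^ lookup m i))"

text \<open>
  The truncated subtraction of exponent vectors in \<open>partial\<close> only occurs with coefficient 0. The
  order of composition in \<open>diff_op\<close> is immaterial, since partial derivatives commute.
\<close>

definition partial :: "nat \<Rightarrow> mpoly \<Rightarrow> mpoly"
  where "partial i f =
    (\<Sum>m\<in>keys f. single (m - single i 1) (of_nat (lookup m i) * lookup f m))"

definition diff_op :: "mpoly \<Rightarrow> mpoly \<Rightarrow> mpoly"
  where "diff_op q f =
    (\<Sum>m\<in>keys q. cscale (lookup q m)
       (fold (\<lambda>i. partial i ^^ lookup m i) (sorted_list_of_set (keys m)) f))"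

definition pairing :: "mpoly \<Rightarrow> mpoly \<Rightarrow> complex"
  where "pairing q f = poly_eval (diff_op q f) (\<lambda>_. 0)"


subsection \<open>Lattices\<close>

definition lattice_basis :: "'u::real_vector set \<Rightarrow> 'u list \<Rightarrow> bool"
  where "lattice_basis \<Lambda> bs \<longleftrightarrow>
    distinct bs \<and> independent (set bs) \<and> span (set bs) = UNIV \<and>
    \<Lambda> = {\<Sum>i<length bs. of_int (k i) *\<^sub>R bs ! i | k. True}"

definition coord :: "'u::real_vector list \<Rightarrow> 'u \<Rightarrow> nat \<Rightarrow> real"
  where "coord bs u i = representation (set bs) u (bs ! i)"

definition lin_form :: "'u::real_vector list \<Rightarrow> 'u \<Rightarrow> mpoly"
  where "lin_form bs u = (\<Sum>i<length bs. cscale (of_real (coord bs u i)) (Var i))"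

definition form_prod :: "'u::real_vector list \<Rightarrow> 'u list \<Rightarrow> mpoly"
  where "form_prod bs Y = prod_list (map (lin_form bs) Y)"

text \<open>The value of a polynomial in \<open>Sym(V\<^sub>\<complex>)\<close> at a point of $U$; \<open>t\<^sub>i\<close> is the \<open>i\<close>-th coordinate.\<close>

definition eval_at :: "'u::real_vector list \<Rightarrow> mpoly \<Rightarrow> 'u \<Rightarrow> complex"
  where "eval_at bs f u = poly_eval f (\<lambda>i. of_real (coord bs u i))"


subsection \<open>Continuous spaces\<close>

definition cocircuit :: "'u::real_vector list \<Rightarrow> nat set \<Rightarrow> bool"
  where "cocircuit Y C \<longleftrightarrow>
    C \<subseteq> {..<length Y} \<and> span (set (nths Y (- C))) \<noteq> UNIV \<and>
    (\<forall>C'. C' \<subset> C \<longrightarrow> span (set (nths Y (- C'))) = UNIV)"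

definition P_space :: "'u::real_vector list \<Rightarrow> 'u list \<Rightarrow> mpoly set"
  where "P_space bs Y =
    cpm.span {form_prod bs (nths Y I) | I. I \<subseteq> {..<length Y} \<and> span (set (nths Y (- I))) = UNIV}"

definition J_ideal :: "'u::real_vector list \<Rightarrow> 'u list \<Rightarrow> mpoly set"
  where "J_ideal bs Y =
    Idl\<^bsub>ring_on (polys (length bs))\<^esub> {form_prod bs (nths Y C) | C. cocircuit Y C}"

definition D_space :: "'u::real_vector list \<Rightarrow> 'u list \<Rightarrow> mpoly set"
  where "D_space bs Y = {f \<in> polys (length bs). \<forall>q\<in>J_ideal bs Y. diff_op q f = 0}"


subsection \<open>Periodic space\<close>

text \<open>Characters and functions on \<open>\<Lambda>\<close> are extensional functions on \<^typ>\<open>'u\<close>.\<close>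

type_synonym 'u character = "'u \<Rightarrow> complex"

definition torus :: "'u::real_vector set \<Rightarrow> 'u character set"
  where "torus \<Lambda> = {e \<in> \<Lambda> \<rightarrow>\<^sub>E sphere 0 1. \<forall>x\<in>\<Lambda>. \<forall>y\<in>\<Lambda>. e (x + y) = e x * e y}"

text \<open>This set is finite when \<open>\<Lambda>\<close> is a lattice.\<close>

definition vertices :: "'u::real_vector set \<Rightarrow> 'u list \<Rightarrow> 'u character set"
  where "vertices \<Lambda> X =
    {e \<in> torus \<Lambda>. \<exists>B\<subseteq>set X. independent B \<and> span B = UNIV \<and> (\<forall>b\<in>B. e b = 1)}"

definition fixed_part :: "'u list \<Rightarrow> 'u character \<Rightarrow> 'u list"
  where "fixed_part X e = filter (\<lambda>x. e x = 1) X"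

definition moved_part :: "'u list \<Rightarrow> 'u character \<Rightarrow> 'u list"
  where "moved_part X e = filter (\<lambda>x. e x \<noteq> 1) X"

text \<open>
  The (external) direct sum of the copies \<open>e Sym(U\<^sub>\<complex>)\<close> over all characters \<open>e\<close> is the type
  \<^typ>\<open>'u character \<Rightarrow>\<^sub>0 mpoly\<close>: the sum of the \<open>e p\<^sub>e\<close> is the finitely supported family of the \<open>p\<^sub>e\<close>.
\<close>

definition P_per :: "'u::real_vector set \<Rightarrow> 'u list \<Rightarrow> 'u list \<Rightarrow> ('u character \<Rightarrow>\<^sub>0 mpoly) set"
  where "P_per \<Lambda> bs X =
    {p. keys p \<subseteq> vertices \<Lambda> X \<and>
        (\<forall>e\<in>vertices \<Lambda> X.
           lookup p e \<in> {form_prod bs (moved_part X e) * q | q. q \<in> P_space bs (fixed_part X e)})}"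

definition per_scale :: "complex \<Rightarrow> ('u character \<Rightarrow>\<^sub>0 mpoly) \<Rightarrow> ('u character \<Rightarrow>\<^sub>0 mpoly)"
  where "per_scale c p = Poly_Mapping.map (cscale c) p"


subsection \<open>Discrete space\<close>

definition group_alg :: "'u::real_vector set \<Rightarrow> ('u \<Rightarrow>\<^sub>0 complex) set"
  where "group_alg \<Lambda> = {g. keys g \<subseteq> \<Lambda>}"

definition J_nabla :: "'u::real_vector set \<Rightarrow> 'u list \<Rightarrow> ('u \<Rightarrow>\<^sub>0 complex) set"
  where "J_nabla \<Lambda> X =
    Idl\<^bsub>ring_on (group_alg \<Lambda>)\<^esub>
      {prod_list (map (\<lambda>x. 1 - single x 1) (nths X C)) | C. cocircuit X C}"

definition translate :: "'u::real_vector \<Rightarrow> ('u \<Rightarrow> complex) \<Rightarrow> 'u \<Rightarrow> complex"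
  where "translate a f = (\<lambda>u. f (u - a))"

definition act :: "('u::real_vector \<Rightarrow>\<^sub>0 complex) \<Rightarrow> ('u \<Rightarrow> complex) \<Rightarrow> 'u \<Rightarrow> complex"
  where "act g f = (\<lambda>u. \<Sum>a\<in>keys g. lookup g a * translate a f u)"

definition DM_space :: "'u::real_vector set \<Rightarrow> 'u list \<Rightarrow> ('u \<Rightarrow> complex) set"
  where "DM_space \<Lambda> X = {f \<in> \<Lambda> \<rightarrow>\<^sub>E UNIV. \<forall>g\<in>J_nabla \<Lambda> X. \<forall>u\<in>\<Lambda>. act g f u = 0}"


subsection \<open>Pairings\<close>

definition per_component :: "'u::real_vector list \<Rightarrow> 'u list \<Rightarrow> ('u character \<Rightarrow>\<^sub>0 mpoly) \<Rightarrow> 'u character \<Rightarrow> mpoly"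
  where "per_component bs X p e =
    (THE q. q \<in> P_space bs (fixed_part X e) \<and> lookup p e = form_prod bs (moved_part X e) * q)"

text \<open>
  The family of polynomials \<open>f\<^sub>e\<close> in the decomposition of \<open>f\<close> as the sum of the \<open>e f\<^sub>e\<close> on \<open>\<Lambda>\<close>.
\<close>

definition DM_components ::
    "'u::real_vector set \<Rightarrow> 'u list \<Rightarrow> 'u list \<Rightarrow> ('u \<Rightarrow> complex) \<Rightarrow> ('u character \<Rightarrow>\<^sub>0 mpoly)"
  where "DM_components \<Lambda> bs X f =
    (THE h. keys h \<subseteq> vertices \<Lambda> X \<and>
            (\<forall>e\<in>vertices \<Lambda> X. lookup h e \<in> D_space bs (fixed_part X e)) \<and>
            (\<forall>a\<in>\<Lambda>. f a = (\<Sum>e\<in>vertices \<Lambda> X. e a * eval_at bs (lookup h e) a)))"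

definition nabla_pairing ::
    "'u::real_vector set \<Rightarrow> 'u list \<Rightarrow> 'u list \<Rightarrow> ('u character \<Rightarrow>\<^sub>0 mpoly) \<Rightarrow> ('u \<Rightarrow> complex) \<Rightarrow> complex"
  where "nabla_pairing \<Lambda> bs X p f =
    (\<Sum>e\<in>vertices \<Lambda> X. pairing (per_component bs X p e) (lookup (DM_components \<Lambda> bs X f) e))"

text \<open>
  The pairing of a coset \<open>A\<close> of \<open>J_nabla\<close> with \<open>f\<close>: the common value on all representatives.
\<close>

definition quot_pairing :: "('u::real_vector \<Rightarrow>\<^sub>0 complex) set \<Rightarrow> ('u \<Rightarrow> complex) \<Rightarrow> complex"
  where "quot_pairing A f = the_elem ((\<lambda>g. \<Sum>a\<in>keys g. lookup g a * f a) ` A)"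


subsection \<open>The quotient of the group algebra as a complex vector space\<close>

abbreviation DM_quot :: "'u::real_vector set \<Rightarrow> 'u list \<Rightarrow> ('u \<Rightarrow>\<^sub>0 complex) set ring"
  where "DM_quot \<Lambda> X \<equiv> ring_on (group_alg \<Lambda>) Quot J_nabla \<Lambda> X"

text \<open>Scaling by \<open>c\<close> is multiplication by the class of the constant \<open>c\<close>.\<close>

definition quot_scale ::
    "'u::real_vector set \<Rightarrow> 'u list \<Rightarrow> complex \<Rightarrow> ('u \<Rightarrow>\<^sub>0 complex) set \<Rightarrow> ('u \<Rightarrow>\<^sub>0 complex) set"
  where "quot_scale \<Lambda> X c A =
    (J_nabla \<Lambda> X +>\<^bsub>ring_on (group_alg \<Lambda>)\<^esub> single 0 c) \<otimes>\<^bsub>DM_quot \<Lambda> X\<^esub> A"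

definition linear_iso_DM_quot ::
    "'u::real_vector set \<Rightarrow> 'u list \<Rightarrow> 'u list \<Rightarrow> (('u character \<Rightarrow>\<^sub>0 mpoly) \<Rightarrow> ('u \<Rightarrow>\<^sub>0 complex) set) \<Rightarrow> bool"
  where "linear_iso_DM_quot \<Lambda> bs X L \<longleftrightarrow>
    bij_betw L (P_per \<Lambda> bs X) (carrier (DM_quot \<Lambda> X)) \<and>
    (\<forall>p\<in>P_per \<Lambda> bs X. \<forall>p'\<in>P_per \<Lambda> bs X. L (p + p') = L p \<oplus>\<^bsub>DM_quot \<Lambda> X\<^esub> L p') \<and>
    (\<forall>c. \<forall>p\<in>P_per \<Lambda> bs X. L (per_scale c p) = quot_scale \<Lambda> X c (L p))"

end

theory Submission
  imports Defs "HOL-Computational_Algebra.Polynomial_Factorial"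
    "HOL-Computational_Algebra.Field_as_Ring"
    "HOL-Computational_Algebra.Fundamental_Theorem_Algebra"
begin

text \<open>
  Continuous case: the space \<open>P(Y)\<close> complements the cocircuit ideal \<open>J(Y)\<close> in the polynomial ring. That the
  two span everything is a deletion-contraction argument, which also works for the ideal generated
  by the affine products of \<open>p\<^sub>y - c\<^sub>y\<close>. For generic \<open>c\<close> these products vanish at the vertices of a simple
  hyperplane arrangement, while no nonzero element of \<open>P(Y)\<close> does; comparing top degrees shows that the
  sum is direct. Hence \<open>P(Y)\<close> and \<open>D(Y)\<close> are dual to each other.

  Discrete case: every basis vector of the lattice satisfies modulo the ideal a polynomial equation all
  of whose roots are roots of unity, so partial fractions split the quotient of the group algebra into
  local pieces at finitely many characters. At a character \<open>e\<close> the substitution \<open>a \<mapsto> e(a) exp(p\<^sub>a)\<close>,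
  truncated, identifies the local piece with the polynomials modulo \<open>J(X\<^sub>e)\<close>, since \<open>1 - e(x) exp(p\<^sub>x)\<close>
  is \<open>p\<^sub>x\<close> times a unit if \<open>e(x) = 1\<close> and a unit otherwise. As pairing with \<open>exp(p\<^sub>a)\<close> is evaluation at
  \<open>a\<close>, the inverse of this identification intertwines the pairings.
\<close>

text \<open>The isomorphism is forced: \<open>L p\<close> is the class of any \<open>g\<close> whose
  expansion at each vertex \<open>e\<close> agrees modulo the local ideal with the component
  \<open>q_e\<close>. It must be shown that the expansions at all vertices together identify the
  quotient with the product of the local quotients, and that the internal spaces represent the
  latter. No step counts dimensions: directness comes from interpolation, and the decomposition of
  functions in the discrete space, quoted as known, is derived from the same local data. Two
  obstacles shape the rest. Polynomials truncated at order \<open>N\<close> replace power series, so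
  expansion is multiplicative only modulo high order; this is harmless because everything of order
  above \<open>length X\<close> lies in the ideal of each vertex, a consequence of the continuous
  case. And characters take values on the unit circle, while the support of the quotient could a
  priori lie anywhere in the complex torus; hence the annihilating polynomials must have roots of
  modulus one only.\<close>

subsection \<open>Ideals in subrings\<close>

abbreviation idl :: "'a::comm_ring_1 set \<Rightarrow> 'a set \<Rightarrow> 'a set"
  where "idl R S \<equiv> Idl\<^bsub>ring_on R\<^esub> S"

text \<open>Polynomials in \<open>d\<close> variables and the group algebra of the lattice are given
  as subsets of their types; this locale treats both at once and hides the HOL-Algebra
  carriers.\<close>

locale comm_subring =
  fixes R :: "'a::comm_ring_1 set"
  assumes zero_in [simp, intro]: "0 \<in> R"
    and one_in [simp, intro]: "1 \<in> R"
    and add_in [intro]: "x \<in> R \<Longrightarrow> y \<in> R \<Longrightarrow> x + y \<in> R"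
    and mult_in [intro]: "x \<in> R \<Longrightarrow> y \<in> R \<Longrightarrow> x * y \<in> R"
    and uminus_in [intro]: "x \<in> R \<Longrightarrow> - x \<in> R"
begin

lemma diff_in [intro]: "x \<in> R \<Longrightarrow> y \<in> R \<Longrightarrow> x - y \<in> R"
  using add_in[of x "- y"] uminus_in by simp

lemma sum_in: "(\<And>i. i \<in> A \<Longrightarrow> f i \<in> R) \<Longrightarrow> sum f A \<in> R"
  by (induction A rule: infinite_finite_induct) auto

lemma prod_in: "(\<And>i. i \<in> A \<Longrightarrow> f i \<in> R) \<Longrightarrow> prod f A \<in> R"
  by (induction A rule: infinite_finite_induct) auto

lemma power_in: "x \<in> R \<Longrightarrow> x ^ n \<in> R"
  by (induction n) auto

lemma cring_ring_on: "cring (ring_on R)"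
proof (rule cringI)
  show "abelian_group (ring_on R)"
  proof (rule abelian_groupI)
    show "\<exists>y\<in>carrier (ring_on R). y \<oplus>\<^bsub>ring_on R\<^esub> x = \<zero>\<^bsub>ring_on R\<^esub>"
      if "x \<in> carrier (ring_on R)" for x
      using that by (auto simp: ring_on_def intro!: bexI[of _ "- x"])
  qed (auto simp: ring_on_def algebra_simps)
  show "Group.comm_monoid (ring_on R)"
    by (rule comm_monoidI) (auto simp: ring_on_def algebra_simps)
qed (auto simp: ring_on_def algebra_simps)

lemma ring_ring_on: "ring (ring_on R)"
  using cring_ring_on by (simp add: cring_def)

context
  fixes S assumes S: "S \<subseteq> R"
begin

lemma ideal_idl: "ideal (idl R S) (ring_on R)"
  using ring.genideal_ideal[OF ring_ring_on] S by (simp add: ring_on_def)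

lemma idl_gen: "x \<in> S \<Longrightarrow> x \<in> idl R S"
  using ring.genideal_self[OF ring_ring_on] S by (auto simp: ring_on_def)

lemma idl_in: "x \<in> idl R S \<Longrightarrow> x \<in> R"
  using ideal.Icarr[OF ideal_idl] by (simp add: ring_on_def)

lemma idl_zero: "0 \<in> idl R S"
  using additive_subgroup.zero_closed[OF ideal.axioms(1)[OF ideal_idl]] by (simp add: ring_on_def)

lemma idl_add: "x \<in> idl R S \<Longrightarrow> y \<in> idl R S \<Longrightarrow> x + y \<in> idl R S"
  using additive_subgroup.a_closed[OF ideal.axioms(1)[OF ideal_idl]] by (simp add: ring_on_def)

lemma idl_mult: "r \<in> R \<Longrightarrow> x \<in> idl R S \<Longrightarrow> r * x \<in> idl R S"
  using ideal.I_l_closed[OF ideal_idl] by (simp add: ring_on_def)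

lemma idl_uminus: "x \<in> idl R S \<Longrightarrow> - x \<in> idl R S"
  using idl_mult[of "- 1" x] by auto

lemma idl_diff: "x \<in> idl R S \<Longrightarrow> y \<in> idl R S \<Longrightarrow> x - y \<in> idl R S"
  using idl_add[of x "- y"] idl_uminus by simp

lemma idl_sum: "(\<And>i. i \<in> A \<Longrightarrow> f i \<in> idl R S) \<Longrightarrow> sum f A \<in> idl R S"
  by (induction A rule: infinite_finite_induct) (auto intro: idl_zero idl_add)

text \<open>The elements of \<open>R\<close> with property \<open>P\<close> form an ideal containing
  \<open>S\<close>, so they contain the smallest one. Additive inverses come from
  \<open>mult\<close> with the scalar -1.\<close>

lemma idl_induct:
  assumes x: "x \<in> idl R S"
    and zero: "P 0"
    and gen: "\<And>s. s \<in> S \<Longrightarrow> P s"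
    and add: "\<And>x y. x \<in> R \<Longrightarrow> y \<in> R \<Longrightarrow> P x \<Longrightarrow> P y \<Longrightarrow> P (x + y)"
    and mult: "\<And>r x. r \<in> R \<Longrightarrow> x \<in> R \<Longrightarrow> P x \<Longrightarrow> P (r * x)"
  shows "P x"
proof -
  let ?I = "{x \<in> R. P x}"
  have "ideal ?I (ring_on R)"
  proof (rule idealI[OF ring_ring_on])
    show "subgroup ?I (add_monoid (ring_on R))"
    proof (rule group.subgroupI)
      show "group (add_monoid (ring_on R))"
        using ring_ring_on abelian_group.a_group ring.is_abelian_group by blast
      show "inv\<^bsub>add_monoid (ring_on R)\<^esub> a \<in> ?I" if "a \<in> ?I" for a
      proof -
        have "inv\<^bsub>add_monoid (ring_on R)\<^esub> a = - a"
        proof (rule group.inv_equality)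
          show "group (add_monoid (ring_on R))"
            using ring_ring_on abelian_group.a_group ring.is_abelian_group by blast
        qed (use that in \<open>auto simp: ring_on_def\<close>)
        moreover have "P (- a)" using mult[of "- 1" a] that by auto
        ultimately show ?thesis using that by auto
      qed
    qed (use zero add in \<open>auto simp: ring_on_def\<close>)
  next
    fix a x assume "a \<in> ?I" "x \<in> carrier (ring_on R)"
    then show "x \<otimes>\<^bsub>ring_on R\<^esub> a \<in> ?I" "a \<otimes>\<^bsub>ring_on R\<^esub> x \<in> ?I"
      using mult[of x a] by (auto simp: ring_on_def mult.commute[of a x])
  qed
  then have "idl R S \<subseteq> ?I"
    by (rule ring.genideal_minimal[OF ring_ring_on]) (use gen S in auto)
  then show ?thesis using x by auto
qed

end

lemmas ideal_induct [consumes 2, case_names zero gen add mult] = idl_induct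

lemma idl_subset:
  assumes "S \<subseteq> R" "T \<subseteq> R" and ST: "\<And>s. s \<in> S \<Longrightarrow> s \<in> idl R T"
  shows "idl R S \<subseteq> idl R T"
proof
  fix x assume "x \<in> idl R S"
  with assms(1) show "x \<in> idl R T"
    by (rule idl_induct)
      (auto intro: idl_zero[OF assms(2)] ST idl_add[OF assms(2)] idl_mult[OF assms(2)])
qed

end


section \<open>Preliminaries on polynomials: grading, pairing, evaluation\<close>

subsection \<open>Linear extension\<close>

text \<open>\<open>h\<close> embeds the scalars into the target: the identity for complex-valued
  functionals, \<open>single 0\<close> for maps into a polynomial ring or group algebra. Pairing,
  evaluation, \<open>Phi\<close> and \<open>Psi\<close> are all instances.\<close>

definition lin :: "(complex \<Rightarrow> 'r::comm_ring_1) \<Rightarrow> ('a \<Rightarrow> 'r) \<Rightarrow> ('a \<Rightarrow>\<^sub>0 complex) \<Rightarrow> 'r"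
  where "lin h F g = (\<Sum>a\<in>keys g. h (lookup g a) * F a)"

definition scalar_hom :: "(complex \<Rightarrow> 'r::comm_ring_1) \<Rightarrow> bool"
  where "scalar_hom h \<longleftrightarrow> h 0 = 0 \<and> h 1 = 1 \<and> (\<forall>a b. h (a + b) = h a + h b) \<and> (\<forall>a b. h (a * b) = h a * h b)"

lemma scalar_hom_id [simp, intro]: "scalar_hom (\<lambda>c. c)"
  and scalar_hom_single [simp, intro]: "scalar_hom (single (0::'a::comm_monoid_add))"
  by (auto simp: scalar_hom_def single_add mult_single)

lemma scalar_homD:
  assumes "scalar_hom h"
  shows "h 0 = 0" "h 1 = 1" "h (a + b) = h a + h b" "h (a * b) = h a * h b"
  using assms by (auto simp: scalar_hom_def)

lemma pm_sum: "f = (\<Sum>a\<in>keys f. single a (lookup f a))"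
  by (rule poly_mapping_eqI)
    (auto simp: lookup_sum lookup_single when_def in_keys_iff sum.delta')

lemma mult_pm_sum:
  fixes f g :: "'a::comm_monoid_add \<Rightarrow>\<^sub>0 complex"
  shows "f * g = (\<Sum>a\<in>keys f. \<Sum>b\<in>keys g. single (a + b) (lookup f a * lookup g b))"
proof -
  have "f * g = (\<Sum>a\<in>keys f. single a (lookup f a)) * (\<Sum>b\<in>keys g. single b (lookup g b))"
    by (simp flip: pm_sum)
  then show ?thesis by (simp add: sum_product mult_single)
qed

lemma lookup_cscale [simp]: "lookup (cscale c f) m = c * lookup f m"
  by (simp add: cscale_def flip: mult_map_scale_conv_mult) (simp add: Poly_Mapping.map.rep_eq when_def)

lemma cscale_single [simp]: "cscale c (single m a) = single m (c * a)"
  by (simp add: cscale_def mult_single)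

lemma cscale_mult_left [simp]: "cscale c f * g = cscale c (f * g)"
  and cscale_mult_right [simp]: "g * cscale c f = cscale c (g * f)"
  by (simp_all add: cscale_def algebra_simps)

context
  fixes h :: "complex \<Rightarrow> 'r::comm_ring_1"
  assumes h: "scalar_hom h"
begin

lemmas scalar_hom_rules = scalar_homD[OF h]

lemma lin_superset: "finite A \<Longrightarrow> keys g \<subseteq> A \<Longrightarrow> lin h F g = (\<Sum>a\<in>A. h (lookup g a) * F a)"
  unfolding lin_def by (rule sum.mono_neutral_left) (auto simp: in_keys_iff scalar_hom_rules)

lemma lin_zero [simp]: "lin h F 0 = 0"
  by (simp add: lin_def)

lemma lin_single [simp]: "lin h F (single a c) = h c * F a"
  by (cases "c = 0") (auto simp: lin_def scalar_hom_rules)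

lemma lin_add: "lin h F (f + g) = lin h F f + lin h F g"
  by (subst (1 2 3) lin_superset[of "keys f \<union> keys g"])
    (use keys_add[of f g] in \<open>auto simp: lookup_add scalar_hom_rules algebra_simps sum.distrib\<close>)

lemma lin_cscale: "lin h F (cscale c f) = h c * lin h F f"
  by (subst lin_superset[of "keys f"])
    (auto simp: in_keys_iff lin_def scalar_hom_rules sum_distrib_left mult.assoc)

lemma lin_diff: "lin h F (f - g) = lin h F f - lin h F g"
  using lin_add[of F "f - g" g] by (simp add: algebra_simps)

lemma lin_sum: "lin h F (sum f A) = (\<Sum>i\<in>A. lin h F (f i))"
  by (induction A rule: infinite_finite_induct) (auto simp: lin_add)

lemma lin_mult_sum:
  fixes f g :: "'a::comm_monoid_add \<Rightarrow>\<^sub>0 complex"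
  shows "lin h F (f * g) = (\<Sum>a\<in>keys f. \<Sum>b\<in>keys g. h (lookup f a) * h (lookup g b) * F (a + b))"
  unfolding mult_pm_sum[of f g] by (simp add: lin_sum scalar_hom_rules)

text \<open>The set \<open>A\<close> is there for characters, which are multiplicative only on the
  lattice.\<close>

lemma lin_mult:
  fixes f g :: "'a::comm_monoid_add \<Rightarrow>\<^sub>0 complex"
  assumes "keys f \<subseteq> A" "keys g \<subseteq> A" "\<And>a b. a \<in> A \<Longrightarrow> b \<in> A \<Longrightarrow> F (a + b) = F a * F b"
  shows "lin h F (f * g) = lin h F f * lin h F g"
proof -
  have "lin h F (f * g) = (\<Sum>a\<in>keys f. \<Sum>b\<in>keys g. (h (lookup f a) * F a) * (h (lookup g b) * F b))"
    unfolding lin_mult_sum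
    by (intro sum.cong refl) (use assms in \<open>auto simp: subset_iff mult_ac\<close>)
  then show ?thesis by (simp add: lin_def sum_product)
qed

end


subsection \<open>Degrees\<close>

definition mdeg :: "(nat \<Rightarrow>\<^sub>0 nat) \<Rightarrow> nat"
  where "mdeg m = (\<Sum>i\<in>keys m. lookup m i)"

lemma mdeg_superset: "finite A \<Longrightarrow> keys m \<subseteq> A \<Longrightarrow> mdeg m = (\<Sum>i\<in>A. lookup m i)"
  unfolding mdeg_def by (rule sum.mono_neutral_left) (auto simp: in_keys_iff)

lemma mdeg_add: "mdeg (m + n) = mdeg m + mdeg n"
  by (subst (1 2 3) mdeg_superset[of "keys m \<union> keys n"])
    (use keys_add[of m n] in \<open>auto simp: lookup_add sum.distrib\<close>)

lemma mdeg_single [simp]: "mdeg (single i k) = k"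
  by (auto simp: mdeg_def)

lemma mdeg_zero [simp]: "mdeg 0 = 0"
  by (simp add: mdeg_def)

lemma mdeg_eq_0: "mdeg m = 0 \<longleftrightarrow> m = 0"
  by (auto simp: mdeg_def in_keys_iff intro!: poly_mapping_eqI)

text \<open>Powers of the maximal ideal at the origin; congruence modulo \<open>mN N\<close> stands
  for equality of power series up to order \<open>N\<close>.\<close>

definition mN :: "nat \<Rightarrow> mpoly set"
  where "mN N = {f. \<forall>m\<in>keys f. N \<le> mdeg m}"

text \<open>The strict bound leaves only 0 in \<open>degless d 0\<close>, so truncated differences
  such as \<open>k - card C\<close> are safe as bounds.\<close>

definition degless :: "nat \<Rightarrow> nat \<Rightarrow> mpoly set"
  where "degless d k = {f \<in> polys d. \<forall>m\<in>keys f. mdeg m < k}"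

lemma mN_iff: "f \<in> mN N \<longleftrightarrow> (\<forall>m. mdeg m < N \<longrightarrow> lookup f m = 0)"
  unfolding mN_def mem_Collect_eq Ball_def in_keys_iff using not_less by metis

lemma mN_zero [simp]: "0 \<in> mN N"
  and mN_add: "f \<in> mN N \<Longrightarrow> g \<in> mN N \<Longrightarrow> f + g \<in> mN N"
  and mN_diff: "f \<in> mN N \<Longrightarrow> g \<in> mN N \<Longrightarrow> f - g \<in> mN N"
  and mN_uminus: "f \<in> mN N \<Longrightarrow> - f \<in> mN N"
  and mN_cscale: "f \<in> mN N \<Longrightarrow> cscale c f \<in> mN N"
  and mN_mono: "f \<in> mN N \<Longrightarrow> M \<le> N \<Longrightarrow> f \<in> mN M"
  by (auto simp: mN_iff lookup_add lookup_minus)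

lemma mN_sum: "(\<And>i. i \<in> A \<Longrightarrow> f i \<in> mN N) \<Longrightarrow> sum f A \<in> mN N"
  by (induction A rule: infinite_finite_induct) (auto intro: mN_add)

lemma mN_0 [simp]: "f \<in> mN 0"
  by (simp add: mN_def)

lemma mN_mult: "f \<in> mN a \<Longrightarrow> g \<in> mN b \<Longrightarrow> f * g \<in> mN (a + b)"
proof -
  assume *: "f \<in> mN a" "g \<in> mN b"
  { fix m assume "m \<in> keys (f * g)"
    then obtain p q where "p \<in> keys f" "q \<in> keys g" "m = p + q"
      using keys_mult[of f g] by auto
    then have "a + b \<le> mdeg m" using * by (auto simp: mN_def mdeg_add intro!: add_mono) }
  then show ?thesis by (auto simp: mN_def)
qed

lemma mN_mult_right: "f \<in> mN N \<Longrightarrow> f * g \<in> mN N"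
  and mN_mult_left: "f \<in> mN N \<Longrightarrow> g * f \<in> mN N"
  using mN_mult[of f N g 0] mN_mult[of g 0 f N] by auto

lemma mN_power: "f \<in> mN 1 \<Longrightarrow> f ^ n \<in> mN n"
  by (induction n) (use mN_mult[of f 1] in auto)

lemma polys_iff: "f \<in> polys d \<longleftrightarrow> (\<forall>m. \<not> keys m \<subseteq> {..<d} \<longrightarrow> lookup f m = 0)"
  by (auto simp: polys_def in_keys_iff)

lemma polys_mult:
  assumes *: "x \<in> polys d" "y \<in> polys d"
  shows "x * y \<in> polys d"
  unfolding polys_def
  proof (safe)
    fix m i assume "m \<in> keys (x * y)" "i \<in> keys m"
    then obtain p q where "p \<in> keys x" "q \<in> keys y" "m = p + q"
      using keys_mult[of x y] by auto
    then show "i < d" using * keys_add[of p q] \<open>i \<in> keys m\<close> unfolding polys_def by blast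
  qed

global_interpretation polys: comm_subring "polys d" for d
proof (unfold_locales, goal_cases)
  case (4 x y)
  then show ?case by (rule polys_mult)
qed (auto simp: polys_iff lookup_add lookup_one when_def)


lemma polys_single: "keys m \<subseteq> {..<d} \<Longrightarrow> single m c \<in> polys d"
  by (auto simp: polys_def split: if_splits)

lemma polys_const [simp]: "single 0 c \<in> polys d"
  by (rule polys_single) simp

lemma polys_cscale: "f \<in> polys d \<Longrightarrow> cscale c f \<in> polys d"
  by (auto simp: polys_iff)

lemma polys_Var: "i < d \<Longrightarrow> Var i \<in> polys d"
  unfolding Var_def by (rule polys_single) auto

lemma mpoly_induct_span:
  assumes "f \<in> polys d" "P 0" "\<And>f g. P f \<Longrightarrow> P g \<Longrightarrow> P (f + g)"
    "\<And>m c. keys m \<subseteq> {..<d} \<Longrightarrow> m \<in> keys f \<Longrightarrow> P (single m c)"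
  shows "P f"
proof -
  have "P (\<Sum>a\<in>A. single a (lookup f a))" if "A \<subseteq> keys f" for A
    using finite_subset[OF that finite_keys] that
    by (induction A rule: finite_induct) (use assms in \<open>auto simp: polys_def\<close>)
  from this[OF subset_refl] show ?thesis by (simp flip: pm_sum)
qed

definition homog :: "nat \<Rightarrow> mpoly \<Rightarrow> bool"
  where "homog k f \<longleftrightarrow> (\<forall>m\<in>keys f. mdeg m = k)"

definition hpart :: "nat \<Rightarrow> mpoly \<Rightarrow> mpoly"
  where "hpart k = lin (single 0) (\<lambda>m. single m (if mdeg m = k then 1 else 0))"

lemma lookup_hpart: "lookup (hpart k f) m = (if mdeg m = k then lookup f m else 0)"
proof -
  have "lookup (hpart k f) m = (\<Sum>x\<in>keys f. if x = m then (if mdeg m = k then lookup f m else 0) else 0)"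
    unfolding hpart_def lin_def lookup_sum
    by (rule sum.cong) (auto simp: mult_single lookup_single when_def)
  then show ?thesis by (auto simp: in_keys_iff)
qed

lemma hpart_add: "hpart k (f + g) = hpart k f + hpart k g"
  and hpart_zero [simp]: "hpart k 0 = 0"
  and hpart_sum: "hpart k (sum F A) = (\<Sum>i\<in>A. hpart k (F i))"
  and hpart_cscale: "hpart k (cscale c f) = cscale c (hpart k f)"
  by (auto intro!: poly_mapping_eqI simp: lookup_hpart lookup_add lookup_sum)

lemma hpart_single: "hpart k (single m c) = (if mdeg m = k then single m c else 0)"
  by (auto intro!: poly_mapping_eqI simp: lookup_hpart lookup_single when_def)

lemma hpart_mult:
  assumes "homog n g"
  shows "hpart k (f * g) = (if n \<le> k then hpart (k - n) f * g else 0)"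
proof -
  have "hpart k (f * g) = (\<Sum>a\<in>keys f. \<Sum>b\<in>keys g. (if mdeg a + n = k then single (a + b) (lookup f a * lookup g b) else 0))"
    by (subst mult_pm_sum, unfold hpart_sum hpart_single, intro sum.cong refl)
      (use assms in \<open>auto simp: homog_def mdeg_add\<close>)
  also have "\<dots> = (\<Sum>a\<in>keys f. (if mdeg a + n = k then single a (lookup f a) else 0)) * (\<Sum>b\<in>keys g. single b (lookup g b))"
    unfolding sum_product by (intro sum.cong refl) (auto simp: mult_single)
  also have "(\<Sum>b\<in>keys g. single b (lookup g b)) = g" by (simp flip: pm_sum)
  also have "(\<Sum>a\<in>keys f. (if mdeg a + n = k then single a (lookup f a) else 0)) = (if n \<le> k then hpart (k - n) f else 0)"
  proof (rule poly_mapping_eqI)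
    fix m
    have "lookup (\<Sum>a\<in>keys f. if mdeg a + n = k then single a (lookup f a) else 0) m
        = (\<Sum>a\<in>keys f. if a = m then (if mdeg m + n = k then lookup f m else 0) else 0)"
      unfolding lookup_sum by (rule sum.cong) (auto simp: lookup_single when_def)
    also have "\<dots> = (if mdeg m + n = k then lookup f m else 0)"
      by (auto simp: in_keys_iff)
    finally show "lookup (\<Sum>a\<in>keys f. if mdeg a + n = k then single a (lookup f a) else 0) m =
        lookup (if n \<le> k then hpart (k - n) f else 0) m"
      by (auto simp: lookup_hpart)
  qed
  finally show ?thesis by auto
qed

lemma homog_mult: "homog a f \<Longrightarrow> homog b g \<Longrightarrow> homog (a + b) (f * g)"
  unfolding homog_def using keys_mult[of f g] by (force simp: mdeg_add)

lemma hpart_in_polys: "f \<in> polys d \<Longrightarrow> hpart k f \<in> polys d"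
  by (auto simp: polys_iff lookup_hpart)

lemma hpart_self: "homog k f \<Longrightarrow> hpart k f = f"
  by (auto simp: homog_def lookup_hpart in_keys_iff intro!: poly_mapping_eqI)

lemma hpart_other: "homog k f \<Longrightarrow> k \<noteq> l \<Longrightarrow> hpart l f = 0"
  by (auto simp: homog_def lookup_hpart in_keys_iff intro!: poly_mapping_eqI)

lemma homog_hpart: "homog k (hpart k f)"
  by (auto simp: homog_def in_keys_iff lookup_hpart split: if_splits)

lemma eq_zero_hparts: "(\<And>k. hpart k f = 0) \<Longrightarrow> f = 0"
  using lookup_hpart[of _ f] by (intro poly_mapping_eqI) (metis (full_types) lookup_zero)

lemma hpart_degless: "f \<in> degless d k \<Longrightarrow> homog k f \<Longrightarrow> f = 0"
  by (rule poly_mapping_eqI) (auto simp: degless_def homog_def in_keys_iff)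


subsection \<open>The pairing of polynomials\<close>

definition mfact :: "(nat \<Rightarrow>\<^sub>0 nat) \<Rightarrow> complex"
  where "mfact m = (\<Prod>i\<in>keys m. fact (lookup m i))"

text \<open>The derivative of \<open>f\<close> at 0 with multi-index \<open>m\<close>. In this
  normalisation differentiation is a shift of the index, and the pairing is a plain sum of
  products.\<close>

definition ncoef :: "mpoly \<Rightarrow> (nat \<Rightarrow>\<^sub>0 nat) \<Rightarrow> complex"
  where "ncoef f m = mfact m * lookup f m"

lemma mfact_superset: "finite A \<Longrightarrow> keys m \<subseteq> A \<Longrightarrow> mfact m = (\<Prod>i\<in>A. fact (lookup m i))"
  unfolding mfact_def by (rule prod.mono_neutral_left) (auto simp: in_keys_iff)

lemma mfact_nonzero [simp]: "mfact m \<noteq> 0"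
  by (simp add: mfact_def)

lemma mfact_add_single: "mfact (m + single i 1) = of_nat (Suc (lookup m i)) * mfact m"
proof -
  let ?A = "insert i (keys m)"
  have "mfact (m + single i 1) = (\<Prod>j\<in>?A. fact (lookup (m + single i 1) j))"
    by (rule mfact_superset) (use keys_add[of m "single i 1"] in auto)
  also have "\<dots> = (\<Prod>j\<in>?A. (if j = i then of_nat (Suc (lookup m i)) else 1) * fact (lookup m j))"
    by (rule prod.cong) (auto simp: lookup_add lookup_single when_def)
  also have "\<dots> = of_nat (Suc (lookup m i)) * (\<Prod>j\<in>?A. fact (lookup m j))"
    by (subst prod.distrib) (simp add: prod.delta)
  also have "(\<Prod>j\<in>?A. fact (lookup m j)) = mfact m"
    by (rule mfact_superset[symmetric]) auto
  finally show ?thesis .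
qed

lemma lookup_partial: "lookup (partial i f) n = of_nat (Suc (lookup n i)) * lookup f (n + single i 1)"
proof -
  have "lookup (partial i f) n = (\<Sum>m\<in>keys f. (of_nat (lookup m i) * lookup f m when m - single i 1 = n))"
    by (simp add: partial_def lookup_sum lookup_single)
  also have "\<dots> = (\<Sum>m\<in>keys f. if m = n + single i 1 then of_nat (lookup m i) * lookup f m else 0)"
  proof (rule sum.cong[OF refl])
    fix m :: "nat \<Rightarrow>\<^sub>0 nat"
    \<comment> \<open>Truncated subtraction can be undone only if the exponent at \<open>i\<close>
      is positive; otherwise the factor \<open>lookup m i\<close> kills the term.\<close>
    have "m = n + single i 1" if "m - single i 1 = n" "lookup m i \<noteq> 0"
    proof (rule poly_mapping_eqI)
      fix j show "lookup m j = lookup (n + single i 1) j"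
        using that(2) unfolding that(1)[symmetric] lookup_add minus_poly_mapping.rep_eq lookup_single
        by (cases "i = j") (simp_all add: when_def)
    qed
    then have "lookup m i = 0 \<or> (m - single i 1 = n \<longleftrightarrow> m = n + single i 1)"
      by (metis add_diff_cancel_right')
    then show "(of_nat (lookup m i) * lookup f m when m - single i 1 = n) =
        (if m = n + single i 1 then of_nat (lookup m i) * lookup f m else 0)"
      unfolding when_def by (elim disjE) simp_all
  qed
  also have "\<dots> = of_nat (Suc (lookup n i)) * lookup f (n + single i 1)"
    by (auto simp: in_keys_iff lookup_add)
  finally show ?thesis .
qed

lemma ncoef_partial: "ncoef (partial i f) n = ncoef f (n + single i 1)"
  by (simp only: ncoef_def lookup_partial mfact_add_single mult_ac)

lemma ncoef_partial_pow: "ncoef ((partial i ^^ k) f) n = ncoef f (n + single i k)"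
proof (induction k arbitrary: n)
  case (Suc k)
  have "ncoef ((partial i ^^ Suc k) f) n = ncoef f (n + single i 1 + single i k)"
    by (simp add: ncoef_partial Suc)
  also have "n + single i 1 + single i k = n + single i (Suc k)"
    by (simp add: add.assoc flip: single_add)
  finally show ?case .
qed simp

lemma ncoef_fold:
  "ncoef (fold (\<lambda>i. partial i ^^ lookup m i) is f) n = ncoef f (n + (\<Sum>i\<leftarrow>is. single i (lookup m i)))"
  by (induction "is" arbitrary: f) (simp_all add: ncoef_partial_pow algebra_simps)

lemma sum_list_single: "(\<Sum>i\<leftarrow>sorted_list_of_set (keys m). single i (lookup m i)) = (m :: nat \<Rightarrow>\<^sub>0 nat)"
proof -
  have "(\<Sum>i\<leftarrow>sorted_list_of_set (keys m). single i (lookup m i)) = (\<Sum>i\<in>keys m. single i (lookup m i))"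
    by (subst sum_list_distinct_conv_sum_set) auto
  also have "\<dots> = m"
    by (rule poly_mapping_eqI) (auto simp: lookup_sum lookup_single when_def in_keys_iff sum.delta')
  finally show ?thesis .
qed

lemma ncoef_diff_op: "ncoef (diff_op q f) n = (\<Sum>m\<in>keys q. lookup q m * ncoef f (n + m))"
proof -
  have "ncoef (diff_op q f) n = (\<Sum>m\<in>keys q. lookup q m *
     ncoef (fold (\<lambda>i. partial i ^^ lookup m i) (sorted_list_of_set (keys m)) f) n)"
    by (simp add: ncoef_def diff_op_def lookup_sum sum_distrib_left mult_ac)
  then show ?thesis by (simp add: ncoef_fold sum_list_single)
qed

lemma poly_eval_zero: "poly_eval f (\<lambda>_. 0) = lookup f 0"
proof -
  have "poly_eval f (\<lambda>_. 0) = (\<Sum>m\<in>keys f. if m = 0 then lookup f m else 0)"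
    unfolding poly_eval_def by (rule sum.cong)
      (auto simp: in_keys_iff zero_power power_0_left intro!: poly_mapping_eqI)
  also have "\<dots> = lookup f 0" by (auto simp: in_keys_iff)
  finally show ?thesis .
qed

lemma pairing_lin: "pairing q f = lin (\<lambda>c. c) (ncoef f) q"
  using ncoef_diff_op[of q f 0] by (simp add: pairing_def poly_eval_zero lin_def ncoef_def mfact_def)

lemma pairing_add: "pairing (p + q) f = pairing p f + pairing q f"
  and pairing_cscale: "pairing (cscale c p) f = c * pairing p f"
  and pairing_diff: "pairing (p - q) f = pairing p f - pairing q f"
  and pairing_sum: "pairing (sum F A) f = (\<Sum>i\<in>A. pairing (F i) f)"
  and pairing_zero_left [simp]: "pairing 0 f = 0"
  and pairing_single: "pairing (single m c) f = c * ncoef f m"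
  by (simp_all add: pairing_lin lin_add lin_cscale lin_diff lin_sum)

text \<open>Multiplication by a monomial is adjoint to differentiation.\<close>

lemma ncoef_diff_op_pairing: "ncoef (diff_op q f) n = pairing (single n 1 * q) f"
proof -
  have "single n 1 * q = (\<Sum>m\<in>keys q. single (n + m) (lookup q m))"
    unfolding mult_pm_sum by simp
  then show ?thesis by (simp add: pairing_sum pairing_single ncoef_diff_op)
qed

lemma polys_pairing_eqI:
  assumes "f \<in> polys d" "g \<in> polys d" "\<And>m. keys m \<subseteq> {..<d} \<Longrightarrow> pairing (single m 1) f = pairing (single m 1) g"
  shows "f = g"
proof (rule poly_mapping_eqI)
  fix m show "lookup f m = lookup g m"
  proof (cases "keys m \<subseteq> {..<d}")
    case True
    then show ?thesis using assms(3)[of m] by (simp add: pairing_single ncoef_def)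
  next
    case False
    then show ?thesis using assms(1,2) by (auto simp: polys_iff)
  qed
qed

lemma diff_op_eq_0_iff:
  assumes f: "f \<in> polys d"
  shows "diff_op q f = 0 \<longleftrightarrow> (\<forall>m. keys m \<subseteq> {..<d} \<longrightarrow> pairing (single m 1 * q) f = 0)"
proof
  assume "diff_op q f = 0"
  then show "\<forall>m. keys m \<subseteq> {..<d} \<longrightarrow> pairing (single m 1 * q) f = 0"
    by (simp add: ncoef_def flip: ncoef_diff_op_pairing)
next
  assume R: "\<forall>m. keys m \<subseteq> {..<d} \<longrightarrow> pairing (single m 1 * q) f = 0"
  show "diff_op q f = 0"
  proof (rule poly_mapping_eqI)
    fix n
    have "ncoef (diff_op q f) n = 0"
    proof (cases "keys n \<subseteq> {..<d}")
      case True then show ?thesis using R by (simp add: ncoef_diff_op_pairing)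
    next
      case False
      have "ncoef f (n + m) = 0" for m
      proof -
        have "keys n \<subseteq> keys (n + m)" by (auto simp: in_keys_iff lookup_add)
        then show ?thesis using False f by (auto simp: ncoef_def polys_iff)
      qed
      then show ?thesis by (simp add: ncoef_diff_op)
    qed
    then show "lookup (diff_op q f) n = lookup 0 n" by (simp add: ncoef_def)
  qed
qed

text \<open>An ideal is closed under multiplication by monomials, so its pairings with
  \<open>f\<close> control every coefficient of \<open>diff_op q f\<close>, not only the constant
  one. This turns \<open>D_space\<close> into the annihilator of the ideal.\<close>

lemma D_space_iff:
  assumes J: "S \<subseteq> polys d" and f: "f \<in> polys d"
  shows "(\<forall>q\<in>idl (polys d) S. diff_op q f = 0) \<longleftrightarrow> (\<forall>q\<in>idl (polys d) S. pairing q f = 0)"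
proof
  assume "\<forall>q\<in>idl (polys d) S. diff_op q f = 0"
  then show "\<forall>q\<in>idl (polys d) S. pairing q f = 0"
    by (simp add: pairing_def poly_eval_zero)
next
  assume R: "\<forall>q\<in>idl (polys d) S. pairing q f = 0"
  show "\<forall>q\<in>idl (polys d) S. diff_op q f = 0"
    unfolding diff_op_eq_0_iff[OF f] using R polys.idl_mult[OF J polys_single] by simp
qed

subsection \<open>Evaluation of polynomials\<close>

definition mon :: "(nat \<Rightarrow> 'r::comm_ring_1) \<Rightarrow> (nat \<Rightarrow>\<^sub>0 nat) \<Rightarrow> 'r"
  where "mon x m = (\<Prod>i\<in>keys m. x i ^ lookup m i)"

lemma mon_superset: "finite A \<Longrightarrow> keys m \<subseteq> A \<Longrightarrow> mon x m = (\<Prod>i\<in>A. x i ^ lookup m i)"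
  unfolding mon_def by (rule prod.mono_neutral_left) (auto simp: in_keys_iff)

lemma mon_add: "mon x (m + n) = mon x m * mon x n"
  by (subst (1 2 3) mon_superset[of "keys m \<union> keys n"])
    (use keys_add[of m n] in \<open>auto simp: lookup_add power_add prod.distrib\<close>)

lemma mon_zero [simp]: "mon x 0 = 1"
  by (simp add: mon_def)

lemma mon_single [simp]: "mon x (single i k) = x i ^ k"
  by (simp add: mon_def)

lemma lin_mon_mult:
  assumes "scalar_hom h"
  shows "lin h (mon x) (f * g) = lin h (mon x) f * lin h (mon x) g"
  by (rule lin_mult[OF assms, of _ UNIV]) (auto simp: mon_add)

lemma poly_eval_lin: "poly_eval f x = lin (\<lambda>c. c) (mon x) f"
  by (simp add: poly_eval_def lin_def mon_def)

lemma poly_eval_add: "poly_eval (f + g) x = poly_eval f x + poly_eval g x"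
  and poly_eval_diff: "poly_eval (f - g) x = poly_eval f x - poly_eval g x"
  and poly_eval_mult: "poly_eval (f * g) x = poly_eval f x * poly_eval g x"
  and poly_eval_cscale: "poly_eval (cscale c f) x = c * poly_eval f x"
  and poly_eval_sum: "poly_eval (sum F A) x = (\<Sum>i\<in>A. poly_eval (F i) x)"
  and poly_eval_single: "poly_eval (single m c) x = c * mon x m"
  by (simp_all add: poly_eval_lin lin_add lin_diff lin_cscale lin_sum lin_mon_mult)

lemma poly_eval_0 [simp]: "poly_eval 0 x = 0"
  by (simp add: poly_eval_lin)

lemma poly_eval_one [simp]: "poly_eval 1 x = 1"
  using poly_eval_single[of 0 1 x] by simp

lemma poly_eval_prod: "poly_eval (prod F A) x = (\<Prod>i\<in>A. poly_eval (F i) x)"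
  by (induction A rule: infinite_finite_induct) (auto simp: poly_eval_mult)

lemma infinite_real_roots:
  fixes q :: "complex poly"
  assumes "\<And>t::real. poly q (of_real t) = 0"
  shows "q = 0"
proof (rule ccontr)
  assume "q \<noteq> 0"
  then have "finite {x. poly q x = 0}" by (rule poly_roots_finite)
  moreover have "range complex_of_real \<subseteq> {x. poly q x = 0}" using assms by auto
  ultimately have "finite (range complex_of_real)" by (rule rev_finite_subset)
  then have "finite (UNIV :: real set)" by (rule finite_imageD) (simp add: inj_def)
  then show False using infinite_UNIV_char_0 by blast
qed

text \<open>Freezing all variables but the last gives a univariate polynomial that vanishes at all
  reals; each of its coefficients is a sum over a slice of \<open>K\<close>, on which the remaining
  exponents still separate the monomials. The points are real because they will come from real
  linear functionals on \<open>U\<close>.\<close>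

lemma monomials_independent:
  fixes a :: "(nat \<Rightarrow>\<^sub>0 nat) \<Rightarrow> complex"
  assumes "finite K" "\<And>m m'. m \<in> K \<Longrightarrow> m' \<in> K \<Longrightarrow> (\<And>i. i < d \<Longrightarrow> lookup m i = lookup m' i) \<Longrightarrow> m = m'"
    "\<And>x::nat \<Rightarrow> real. (\<Sum>m\<in>K. a m * (\<Prod>i<d. of_real (x i) ^ lookup m i)) = 0" "m \<in> K"
  shows "a m = 0"
  using assms
proof (induction d arbitrary: K m)
  case 0
  then have "K = {m}" by auto
  then show ?case using 0(3) by simp
next
  case (Suc d)
  let ?K = "{m' \<in> K. lookup m' d = lookup m d}"
  show ?case
  proof (rule Suc.IH[of ?K])
    fix x :: "nat \<Rightarrow> real"
    define q where "q = (\<Sum>m\<in>K. monom (a m * (\<Prod>i<d. of_real (x i) ^ lookup m i)) (lookup m d))"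
    have "poly q (of_real t) = 0" for t :: real
    proof -
      have "poly q (of_real t) = (\<Sum>m\<in>K. a m * (\<Prod>i<Suc d. of_real ((x(d := t)) i) ^ lookup m i))"
        unfolding q_def poly_sum by (intro sum.cong refl) (simp add: poly_monom)
      also have "\<dots> = 0" by (rule Suc.prems(3))
      finally show ?thesis .
    qed
    then have "q = 0" by (rule infinite_real_roots)
    then have "0 = coeff q (lookup m d)" by simp
    also have "\<dots> = (\<Sum>m'\<in>K. if lookup m' d = lookup m d then a m' * (\<Prod>i<d. of_real (x i) ^ lookup m' i) else 0)"
      by (simp add: q_def coeff_sum)
    also have "\<dots> = (\<Sum>m'\<in>?K. a m' * (\<Prod>i<d. of_real (x i) ^ lookup m' i))"
      using Suc.prems(1) by (simp add: sum.inter_filter)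
    finally show "(\<Sum>m'\<in>?K. a m' * (\<Prod>i<d. of_real (x i) ^ lookup m' i)) = 0" by simp
  next
    fix p q assume "p \<in> ?K" "q \<in> ?K" "\<And>i. i < d \<Longrightarrow> lookup p i = lookup q i"
    then show "p = q" using Suc.prems(2)[of p q] by (simp add: less_Suc_eq) metis
  qed (use Suc.prems in auto)
qed

lemma poly_eval_eq_0:
  assumes "f \<in> polys d" "\<And>x::nat \<Rightarrow> real. poly_eval f (\<lambda>i. of_real (x i)) = 0"
  shows "f = 0"
proof -
  have sub: "keys m \<subseteq> {..<d}" if "m \<in> keys f" for m
    using that assms(1) by (auto simp: polys_def)
  have "lookup f m = 0" if "m \<in> keys f" for m
  proof (rule monomials_independent[of "keys f" d])
    fix m m' assume m: "m \<in> keys f" "m' \<in> keys f" "\<And>i. i < d \<Longrightarrow> lookup m i = lookup m' i"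
    show "m = m'"
    proof (rule poly_mapping_eqI)
      fix i show "lookup m i = lookup m' i"
        using m(3)[of i] sub[OF m(1)] sub[OF m(2)] by (metis in_keys_iff lessThan_iff subsetD)
    qed
  next
    fix x :: "nat \<Rightarrow> real"
    have "poly_eval f (\<lambda>i. of_real (x i)) = (\<Sum>m\<in>keys f. lookup f m * (\<Prod>i<d. of_real (x i) ^ lookup m i))"
      unfolding poly_eval_lin lin_def by (intro sum.cong refl arg_cong2[of _ _ _ _ "(*)"] mon_superset) (use sub in auto)
    then show "(\<Sum>m\<in>keys f. lookup f m * (\<Prod>i<d. of_real (x i) ^ lookup m i)) = 0" using assms(2) by simp
  qed (use that in auto)
  then show ?thesis by (intro poly_mapping_eqI) (metis in_keys_iff lookup_zero)
qed


subsection \<open>Coordinates\<close>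

lemma single_one_eq_iff [simp]: "single i (Suc 0) = single j (Suc 0) \<longleftrightarrow> i = j"
proof
  assume "single i (Suc 0) = single j (Suc 0)"
  then have "keys (single i (Suc 0)) = keys (single j (Suc 0))" by simp
  then show "i = j" by simp
qed simp

locale lattice =
  fixes \<Lambda> :: "'u::real_vector set" and bs :: "'u list"
  assumes basis: "lattice_basis \<Lambda> bs"
begin

abbreviation d :: nat where "d \<equiv> length bs"
abbreviation lf :: "'u \<Rightarrow> mpoly" where "lf \<equiv> lin_form bs"

lemma distinct_bs: "distinct bs" and independent_bs: "independent (set bs)"
  and span_bs: "span (set bs) = UNIV"
  and \<Lambda>_eq: "\<Lambda> = {\<Sum>i<d. of_int (k i) *\<^sub>R bs ! i | k. True}"
  using basis by (auto simp: lattice_basis_def)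

lemma coord_add: "coord bs (u + w) i = coord bs u i + coord bs w i"
  and coord_scale: "coord bs (r *\<^sub>R u) i = r * coord bs u i"
  using representation_add[OF independent_bs] representation_scale[OF independent_bs] span_bs
  by (auto simp: coord_def)

lemma coord_zero [simp]: "coord bs 0 i = 0"
  by (simp add: coord_def representation_zero)

lemma coord_uminus: "coord bs (- u) i = - coord bs u i"
  using coord_scale[of "- 1" u i] by simp

lemma coord_sum: "coord bs (sum f A) i = (\<Sum>a\<in>A. coord bs (f a) i)"
  by (induction A rule: infinite_finite_induct) (auto simp: coord_add)

lemma coord_bs: "i < d \<Longrightarrow> j < d \<Longrightarrow> coord bs (bs ! j) i = (if i = j then 1 else 0)"
  using representation_basis[OF independent_bs, of "bs ! j"] distinct_bs
  by (auto simp: coord_def nth_eq_iff_index_eq)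

lemma coord_expansion: "u = (\<Sum>i<d. coord bs u i *\<^sub>R bs ! i)"
proof -
  have "u = (\<Sum>b\<in>set bs. representation (set bs) u b *\<^sub>R b)"
    using sum_representation_eq[OF independent_bs, of u "set bs"] span_bs by simp
  also have "\<dots> = (\<Sum>i<d. coord bs u i *\<^sub>R bs ! i)"
    unfolding coord_def
    by (rule sum.reindex_bij_betw[symmetric, OF bij_betw_nth, OF distinct_bs]) auto
  finally show ?thesis .
qed

lemma coord_of_int: "i < d \<Longrightarrow> coord bs (\<Sum>i<d. of_int (k i) *\<^sub>R bs ! i) i = of_int (k i)"
  by (simp add: coord_sum coord_scale coord_bs if_distrib sum.delta cong: if_cong)

lemma mem_\<Lambda>_iff: "a \<in> \<Lambda> \<longleftrightarrow> (\<forall>i<d. coord bs a i \<in> \<int>)"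
proof
  assume "a \<in> \<Lambda>" then show "\<forall>i<d. coord bs a i \<in> \<int>"
    using coord_of_int by (auto simp: \<Lambda>_eq)
next
  assume *: "\<forall>i<d. coord bs a i \<in> \<int>"
  have "a = (\<Sum>i<d. of_int \<lfloor>coord bs a i\<rfloor> *\<^sub>R bs ! i)"
    by (subst coord_expansion, rule sum.cong) (use * in \<open>auto simp: Ints_def\<close>)
  then show "a \<in> \<Lambda>"
    unfolding \<Lambda>_eq by (intro CollectI exI[of _ "\<lambda>i. \<lfloor>coord bs a i\<rfloor>"]) simp
qed

lemma \<Lambda>_add: "a \<in> \<Lambda> \<Longrightarrow> b \<in> \<Lambda> \<Longrightarrow> a + b \<in> \<Lambda>"
  and \<Lambda>_uminus: "a \<in> \<Lambda> \<Longrightarrow> - a \<in> \<Lambda>"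
  and \<Lambda>_zero [simp]: "0 \<in> \<Lambda>"
  and \<Lambda>_bs: "i < d \<Longrightarrow> bs ! i \<in> \<Lambda>"
  by (auto simp: mem_\<Lambda>_iff coord_add coord_uminus coord_bs)

lemma lf_add: "lf (u + w) = lf u + lf w"
  and lf_scale: "lf (r *\<^sub>R u) = cscale (of_real r) (lf u)"
  by (auto simp: lin_form_def coord_add coord_scale cpm.scale_left_distrib sum.distrib cpm.scale_sum_right)

lemma lf_zero [simp]: "lf 0 = 0"
  by (simp add: lin_form_def)

lemma lf_bs: "i < d \<Longrightarrow> lf (bs ! i) = Var i"
proof -
  assume "i < d"
  then have "lf (bs ! i) = (\<Sum>j<d. if j = i then Var j else 0)"
    unfolding lin_form_def by (intro sum.cong) (auto simp: coord_bs)
  then show ?thesis using \<open>i < d\<close> by simp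
qed

lemma lf_polys [simp, intro]: "lf u \<in> polys d"
  unfolding lin_form_def by (intro polys.sum_in polys_cscale polys_Var) simp

lemma homog_lf: "homog 1 (lf u)"
proof -
  have "lookup (lf u) m = 0" if "mdeg m \<noteq> 1" for m
    unfolding lin_form_def lookup_sum Var_def
    by (rule sum.neutral) (use that in \<open>auto simp: lookup_single when_def\<close>)
  then show ?thesis by (auto simp: homog_def in_keys_iff)
qed

lemma lf_mN1 [simp]: "lf u \<in> mN 1"
  using homog_lf[of u] by (auto simp: homog_def mN_def)

lemma lf_eq_0: "lf u = 0 \<longleftrightarrow> u = 0"
proof
  assume "lf u = 0"
  have "coord bs u i = 0" if "i < d" for i
  proof -
    have "lookup (lf u) (single i 1) = (\<Sum>j<d. if j = i then of_real (coord bs u j) else 0)"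
      unfolding lin_form_def lookup_sum Var_def by (intro sum.cong) (auto simp: lookup_single when_def)
    then show ?thesis using \<open>lf u = 0\<close> that by simp
  qed
  then show "u = 0" by (subst coord_expansion) auto
qed auto

text \<open>Families over index sets replace lists: deletion becomes set difference, and repeated
  vectors keep distinct indices.\<close>

definition prodf :: "(nat \<Rightarrow> 'u) \<Rightarrow> nat set \<Rightarrow> mpoly"
  where "prodf v Z = (\<Prod>i\<in>Z. lf (v i))"

definition affine_form :: "(nat \<Rightarrow> 'u) \<Rightarrow> (nat \<Rightarrow> real) \<Rightarrow> nat \<Rightarrow> mpoly"
  where "affine_form v c i = lf (v i) - single 0 (of_real (c i))"

lemma affine_form_polys [simp, intro]: "affine_form v c i \<in> polys d"
  unfolding affine_form_def by auto

lemma prodf_polys [simp, intro]: "prodf v Z \<in> polys d"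
  unfolding prodf_def by (intro polys.prod_in) auto

lemma homog_prodf: "finite Z \<Longrightarrow> homog (card Z) (prodf v Z)"
proof (induction Z rule: finite_induct)
  case (insert x F)
  then show ?case using homog_mult[OF homog_lf] by (simp add: prodf_def)
qed (auto simp: homog_def prodf_def)


section \<open>Continuous case: decomposition of the polynomial ring\<close>

subsection \<open>Spanning by internal products and cocircuit multiples\<close>

lemma degless_add: "f \<in> degless n k \<Longrightarrow> g \<in> degless n k \<Longrightarrow> f + g \<in> degless n k"
  using keys_add[of f g] by (force simp: degless_def)

lemma degless_zero [simp]: "0 \<in> degless n k"
  by (simp add: degless_def)

lemma degless_cscale: "f \<in> degless n k \<Longrightarrow> cscale c f \<in> degless n k"
  by (auto simp: degless_def polys_cscale in_keys_iff)

lemma degless_0D: "f \<in> degless n 0 \<Longrightarrow> f = 0"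
  by (auto simp: degless_def in_keys_iff intro!: poly_mapping_eqI)

lemma degless_mono: "f \<in> degless n k \<Longrightarrow> k \<le> l \<Longrightarrow> f \<in> degless n l"
  by (force simp: degless_def)

lemma degless_mult:
  assumes "f \<in> degless n a" "g \<in> polys n" "\<And>m. m \<in> keys g \<Longrightarrow> mdeg m \<le> b"
  shows "g * f \<in> degless n (a + b)"
proof -
  have "mdeg m < a + b" if "m \<in> keys (g * f)" for m
  proof -
    obtain p q where "p \<in> keys f" "q \<in> keys g" "m = q + p"
      using keys_mult[of g f] \<open>m \<in> keys (g * f)\<close> by auto
    then have "mdeg p < a" "mdeg q \<le> b" using assms by (auto simp: degless_def)
    then show ?thesis by (simp add: \<open>m = q + p\<close> mdeg_add)
  qed
  then show ?thesis using assms by (auto simp: degless_def)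
qed

lemma mdeg_affine_form: "m \<in> keys (affine_form v c i) \<Longrightarrow> mdeg m \<le> 1"
  unfolding affine_form_def using keys_diff[of "lf (v i)" "single 0 (of_real (c i))"] homog_lf[of "v i"]
  by (auto simp: homog_def split: if_splits)

lemma degless_affine_mult:
  assumes "f \<in> degless d (k - 1)"
  shows "affine_form v c i * f \<in> degless d k"
proof (cases k)
  case 0
  then show ?thesis using degless_0D assms by fastforce
next
  case (Suc l)
  then show ?thesis using degless_mult[of f d l "affine_form v c i" 1] mdeg_affine_form assms by auto
qed

context
  fixes v :: "nat \<Rightarrow> 'u" and c :: "nat \<Rightarrow> real"
begin

text \<open>
  Deletion and contraction without leaving the ambient space: moving an index from \<open>I\<close> to \<open>S\<close>
  stands for the quotient by the corresponding line. Taking \<open>c = 0\<close> gives the homogeneous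
  statement, a generic \<open>c\<close> its affine deformation.
\<close>

definition P_gens :: "nat \<Rightarrow> nat set \<Rightarrow> nat set \<Rightarrow> mpoly set"
  where "P_gens k S I = {prodf v Z | Z. Z \<subseteq> I \<and> card Z < k \<and> span (v ` (S \<union> (I - Z))) = UNIV}"

text \<open>The bound on \<open>r\<close> keeps the whole product of degree below \<open>k\<close>.
  The comparison of top degrees needs this control, which membership in an ideal would not
  give.\<close>

definition J_gens :: "nat \<Rightarrow> nat set \<Rightarrow> nat set \<Rightarrow> mpoly set"
  where "J_gens k S I = {r * (\<Prod>i\<in>C. affine_form v c i) | r C.
    C \<subseteq> I \<and> span (v ` (S \<union> (I - C))) \<noteq> UNIV \<and> r \<in> degless d (k - card C)}"

text \<open>Multiples of the equations of the flat cut out by the contracted indices; there are none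
  for empty \<open>S\<close>, the case finally used.\<close>

definition flat_gens :: "nat \<Rightarrow> nat set \<Rightarrow> mpoly set"
  where "flat_gens k S = {r * affine_form v c s | r s. s \<in> S \<and> r \<in> degless d (k - 1)}"

definition all_gens :: "nat \<Rightarrow> nat set \<Rightarrow> nat set \<Rightarrow> mpoly set"
  where "all_gens k S I = P_gens k S I \<union> J_gens k S I \<union> flat_gens k S"

lemma all_gens_mono: "k \<le> l \<Longrightarrow> all_gens k S I \<subseteq> all_gens l S I"
  unfolding all_gens_def
proof (intro Un_mono)
  assume kl: "k \<le> l"
  show "P_gens k S I \<subseteq> P_gens l S I"
    unfolding P_gens_def using kl order_less_le_trans by blast
  show "J_gens k S I \<subseteq> J_gens l S I"
  proof
    fix x assume "x \<in> J_gens k S I"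
    then obtain r C where C: "x = r * (\<Prod>i\<in>C. affine_form v c i)" "C \<subseteq> I"
      "span (v ` (S \<union> (I - C))) \<noteq> UNIV" "r \<in> degless d (k - card C)" by (auto simp: J_gens_def)
    have "r \<in> degless d (l - card C)" by (rule degless_mono[OF C(4)]) (use kl in auto)
    then show "x \<in> J_gens l S I" unfolding J_gens_def using C by blast
  qed
  show "flat_gens k S \<subseteq> flat_gens l S"
    unfolding flat_gens_def using degless_mono[of _ d "k - 1" "l - 1"] kl by (fastforce simp: diff_le_mono)
qed

lemma all_gens_P: "Z \<subseteq> I \<Longrightarrow> card Z < k \<Longrightarrow> span (v ` (S \<union> (I - Z))) = UNIV \<Longrightarrow> prodf v Z \<in> cpm.span (all_gens k S I)"
  by (rule cpm.span_base) (auto simp: all_gens_def P_gens_def)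

lemma all_gens_J: "C \<subseteq> I \<Longrightarrow> span (v ` (S \<union> (I - C))) \<noteq> UNIV \<Longrightarrow> r \<in> degless d (k - card C) \<Longrightarrow>
    r * (\<Prod>i\<in>C. affine_form v c i) \<in> cpm.span (all_gens k S I)"
  by (rule cpm.span_base) (auto simp: all_gens_def J_gens_def)

lemma all_gens_flat: "s \<in> S \<Longrightarrow> r \<in> degless d (k - 1) \<Longrightarrow> r * affine_form v c s \<in> cpm.span (all_gens k S I)"
  by (rule cpm.span_base) (auto simp: all_gens_def flat_gens_def)

lemma affine_split: "r * lf (v s) = r * affine_form v c s + cscale (of_real (c s)) r"
  by (simp add: affine_form_def cscale_def algebra_simps)

text \<open>Modulo the flat equations a linear form is a constant, because the contracted vectors
  span. Linear factors are therefore split off a monomial until only a multiple of the empty product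
  \<open>prodf v {}\<close> remains.\<close>

lemma span_gens_base:
  assumes "span (v ` S) = UNIV" "f \<in> degless d k"
  shows "f \<in> cpm.span (all_gens k S {})"
  using assms(2)
proof (induction k arbitrary: f)
  case 0
  then show ?case using degless_0D cpm.span_zero by blast
next
  case (Suc k)
  let ?G = "cpm.span (all_gens (Suc k) S {})"
  have mult: "r * lf u \<in> ?G" if "r \<in> degless d k" for r u
  proof -
    have "u \<in> span (v ` S)" using assms(1) by simp
    then show ?thesis
    proof (induction rule: span_induct_alt)
      case base
      then show ?case by (simp add: cpm.span_zero)
    next
      case (step x w y)
      then obtain s where s: "s \<in> S" "w = v s" by auto
      have "r \<in> ?G" using Suc.IH[OF that] cpm.span_mono[OF all_gens_mono[of k "Suc k"]] by auto
      then have "r * lf w \<in> ?G"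
        unfolding s affine_split by (intro cpm.span_add cpm.span_scale all_gens_flat s) (use that in auto)
      then show ?case using step by (auto simp: lf_add lf_scale distrib_left intro!: cpm.span_add cpm.span_scale)
    qed
  qed
  have "f \<in> polys d" using Suc.prems by (simp add: degless_def)
  then show ?case
  proof (rule mpoly_induct_span)
    fix m b assume m: "keys m \<subseteq> {..<d}" "m \<in> keys f"
    then have deg: "mdeg m < Suc k" using Suc.prems by (auto simp: degless_def)
    show "single m b \<in> ?G"
    proof (cases "m = 0")
      case True
      have "single m b = cscale b (prodf v {})" by (simp add: True prodf_def cscale_def)
      then show ?thesis using all_gens_P[of "{}" "{}" "Suc k" S] assms(1) by (simp add: cpm.span_scale)
    next
      case False
      then obtain i where i: "i \<in> keys m" by (metis all_not_in_conv keys_eq_empty)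
      define m' where "m' = m - single i 1"
      have mm: "m = m' + single i 1"
        unfolding m'_def using i
        by (intro poly_mapping_eqI) (auto simp: lookup_add minus_poly_mapping.rep_eq lookup_single when_def in_keys_iff)
      have "keys m' \<subseteq> keys m" by (auto simp: mm in_keys_iff lookup_add)
      then have "single m' b \<in> degless d k"
        using m(1) deg by (auto simp: degless_def mm mdeg_add intro!: polys_single split: if_splits)
      moreover have "single m b = single m' b * lf (bs ! i)"
        using i m by (subst lf_bs) (auto simp: Var_def mult_single mm)
      ultimately show ?thesis using mult by simp
    qed
  qed (auto intro: cpm.span_zero cpm.span_add)
qed

text \<open>On an internal product the new factor gives \<open>prodf v (insert y Z)\<close> minus a
  multiple of \<open>prodf v Z\<close>. Both are internal: the complement of the first is unchanged,
  that of the second only grows.\<close>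

lemma span_affine_mult:
  assumes "r \<in> cpm.span (all_gens (k - 1) S I)" "k > 0" "y \<notin> I" "finite I"
  shows "affine_form v c y * r \<in> cpm.span (all_gens k S (insert y I))"
  using assms(1)
proof (induction rule: cpm.span_induct_alt)
  case base
  then show ?case by (simp add: cpm.span_zero)
next
  case (step b g h)
  let ?G = "cpm.span (all_gens k S (insert y I))"
  from step(1)[unfolded all_gens_def] have "affine_form v c y * g \<in> ?G"
  proof (elim UnE)
    assume "g \<in> P_gens (k - 1) S I"
    then obtain Z where Z: "g = prodf v Z" "Z \<subseteq> I" "card Z < k - 1" "span (v ` (S \<union> (I - Z))) = UNIV"
      by (auto simp: P_gens_def)
    have fin: "finite Z" "y \<notin> Z" using Z assms finite_subset by auto
    have eq: "affine_form v c y * g = prodf v (insert y Z) - cscale (of_real (c y)) (prodf v Z)"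
      using fin by (simp add: Z(1) affine_form_def prodf_def cscale_def algebra_simps)
    have "insert y I - insert y Z = I - Z" using assms by auto
    moreover have "span (v ` (S \<union> (insert y I - Z))) = UNIV"
      using span_mono[of "v ` (S \<union> (I - Z))" "v ` (S \<union> (insert y I - Z))"] Z(4) by auto
    ultimately show ?thesis
      unfolding eq using Z fin by (intro cpm.span_diff cpm.span_scale all_gens_P) auto
  next
    assume "g \<in> J_gens (k - 1) S I"
    then obtain r C where C: "g = r * (\<Prod>i\<in>C. affine_form v c i)" "C \<subseteq> I"
      "span (v ` (S \<union> (I - C))) \<noteq> UNIV" "r \<in> degless d (k - 1 - card C)" by (auto simp: J_gens_def)
    have fin: "finite C" "y \<notin> C" using C assms finite_subset by auto
    have "affine_form v c y * g = r * (\<Prod>i\<in>insert y C. affine_form v c i)"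
      using fin by (simp add: C(1) mult_ac)
    moreover have "insert y I - insert y C = I - C" using assms by auto
    ultimately show ?thesis
      using C fin all_gens_J[of "insert y C" "insert y I" S r k] by (simp add: subset_insertI2 mult.left_commute)
  next
    assume "g \<in> flat_gens (k - 1) S"
    then obtain r s where s: "g = r * affine_form v c s" "s \<in> S" "r \<in> degless d (k - 1 - 1)"
      by (auto simp: flat_gens_def)
    have eq: "affine_form v c y * g = (affine_form v c y * r) * affine_form v c s"
      by (simp add: s(1) mult_ac)
    show ?thesis
      unfolding eq by (rule all_gens_flat[OF s(2) degless_affine_mult[OF s(3)]])
  qed
  then show ?case using step by (auto simp: distrib_left intro!: cpm.span_add cpm.span_scale)
qed

text \<open>Generators for the contraction of \<open>y\<close> are already generators, apart from
  the multiples of the affine form of \<open>y\<close>. If \<open>S \<union> I\<close> spans, the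
  cofactor of such a multiple is expanded by the deletion of \<open>y\<close> and multiplied back;
  otherwise \<open>{y}\<close> has a non-spanning complement and its affine form is a cocircuit
  product itself.\<close>

lemma span_all_gens:
  assumes "finite I" "span (v ` (S \<union> I)) = UNIV" "f \<in> degless d k"
  shows "f \<in> cpm.span (all_gens k S I)"
  using assms
proof (induction I arbitrary: S f k rule: finite_induct)
  case empty
  then show ?case using span_gens_base by simp
next
  case (insert y I)
  show ?case
  proof (cases "v y \<in> span (v ` S)")
    \<comment> \<open>After contraction \<open>y\<close> is a loop, so adding it to a family changes
      no span.\<close>
    case True
    have *: "span (v ` (S \<union> (insert y A))) = span (v ` (S \<union> A))" for A
    proof -
      have "v y \<in> span (v ` (S \<union> A))" using True span_mono[of "v ` S" "v ` (S \<union> A)"] by auto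
      then have "span (insert (v y) (v ` (S \<union> A))) = span (v ` (S \<union> A))" by (rule span_redundant)
      then show ?thesis by simp
    qed
    have **: "insert y I - Z = insert y (I - Z)" if "Z \<subseteq> I" for Z
      using that insert.hyps by auto
    have "f \<in> cpm.span (all_gens k S I)"
      using insert.prems * insert.IH by blast
    moreover have "all_gens k S I \<subseteq> all_gens k S (insert y I)"
    proof -
      have sp: "span (v ` (S \<union> (insert y I - Z))) = span (v ` (S \<union> (I - Z)))" if "Z \<subseteq> I" for Z
        unfolding **[OF that] by (rule *)
      have "P_gens k S I \<subseteq> P_gens k S (insert y I)"
        unfolding P_gens_def using sp by (intro Collect_mono ex_mono) blast
      moreover have "J_gens k S I \<subseteq> J_gens k S (insert y I)"
        unfolding J_gens_def using sp by (intro Collect_mono ex_mono) blast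
      ultimately show ?thesis unfolding all_gens_def by blast
    qed
    ultimately show ?thesis using cpm.span_mono by blast
  next
    case False
    let ?G = "cpm.span (all_gens k S (insert y I))"
    have "f \<in> cpm.span (all_gens k (insert y S) I)"
      using insert.prems by (intro insert.IH) auto
    then show ?thesis
    proof (induction rule: cpm.span_induct_alt)
      case base
      then show ?case by (rule cpm.span_zero)
    next
      case (step b g h)
      have ins: "insert y I - Z = insert y (I - Z)" if "Z \<subseteq> I" for Z
        using that insert.hyps by auto
      from step(1)[unfolded all_gens_def] have "g \<in> ?G"
      proof (elim UnE)
        assume "g \<in> P_gens k (insert y S) I"
        then show ?thesis
          unfolding all_gens_def P_gens_def
          by (intro cpm.span_base UnI1 CollectI) (elim CollectE ex_forward, auto simp: ins)
      next
        assume "g \<in> J_gens k (insert y S) I"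
        then show ?thesis
          unfolding all_gens_def J_gens_def
          by (intro cpm.span_base UnI1 UnI2 CollectI) (elim CollectE ex_forward, auto simp: ins)
      next
        assume "g \<in> flat_gens k (insert y S)"
        then obtain r s where s: "g = r * affine_form v c s" "s \<in> insert y S" "r \<in> degless d (k - 1)"
          by (auto simp: flat_gens_def)
        show ?thesis
        proof (cases "s \<in> S")
          case True
          then show ?thesis using s by (auto intro: all_gens_flat)
        next
          case False
          then have "s = y" using s by simp
          show ?thesis
          proof (cases "span (v ` (S \<union> I)) = UNIV")
            case True
            show ?thesis
            proof (cases "k = 0")
              case True
              then show ?thesis using s degless_0D cpm.span_zero by fastforce
            next
              case False
              have "r \<in> cpm.span (all_gens (k - 1) S I)" by (rule insert.IH[OF True s(3)])
              then show ?thesis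
                using span_affine_mult[of r k S I y] False insert.hyps s \<open>s = y\<close> by (simp add: mult.commute)
            qed
          next
            case False
            have "insert y I - {y} = I" using insert.hyps by auto
            then show ?thesis using all_gens_J[of "{y}" "insert y I" S r k] False s \<open>s = y\<close> by simp
          qed
        qed
      qed
      then show ?case using step(2) by (intro cpm.span_add cpm.span_scale)
    qed
  qed
qed

lemma degless_decompose:
  assumes "finite I" "span (v ` I) = UNIV" "f \<in> degless d k"
  obtains p j where "f = p + j" "p \<in> cpm.span (P_gens k {} I)" "j \<in> cpm.span (J_gens k {} I)"
proof -
  have "f \<in> cpm.span (all_gens k {} I)" using span_all_gens[of I "{}" f k] assms by simp
  moreover have "flat_gens k {} = {}" by (simp add: flat_gens_def)
  ultimately show ?thesis using that unfolding all_gens_def cpm.span_Un by auto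
qed

end

end

subsection \<open>Generic linear functionals\<close>

lemma ex_linear_functional:
  fixes S :: "'u::real_vector set"
  assumes "w \<notin> span S"
  obtains \<eta> :: "'u \<Rightarrow> real" where "linear \<eta>" "\<And>x. x \<in> span S \<Longrightarrow> \<eta> x = 0" "\<eta> w = 1"
proof -
  obtain B where B: "B \<subseteq> S" "independent B" "S \<subseteq> span B"
    using maximal_independent_subset by blast
  have sp: "span B = span S" using B by (simp add: span_eq span_superset subset_trans)
  then have "independent (insert w B)" "w \<notin> B"
    using B assms by (auto simp: independent_insert span_base)
  then obtain \<eta> :: "'u \<Rightarrow> real" where \<eta>: "linear \<eta>" "\<forall>x\<in>insert w B. \<eta> x = (if x = w then 1 else 0)"
    using linear_independent_extend[of "insert w B" "\<lambda>x. if x = w then 1 else 0"] by blast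
  have "\<eta> x = 0" if "x \<in> span S" for x
    by (rule linear_eq_0_on_span[OF \<eta>(1), of B]) (use \<eta>(2) \<open>w \<notin> B\<close> that sp in auto)
  then show ?thesis using that \<eta> by auto
qed

text \<open>Perturb the functional for \<open>W\<close> by \<open>t\<close> times one that is
  nonzero at \<open>w\<close>; each vector excludes at most one value of \<open>t\<close>.\<close>

lemma ex_generic_functional:
  fixes S :: "'u::real_vector set"
  assumes "finite W" "W \<inter> span S = {}"
  shows "\<exists>\<eta> :: 'u \<Rightarrow> real. linear \<eta> \<and> (\<forall>x\<in>span S. \<eta> x = 0) \<and> (\<forall>w\<in>W. \<eta> w \<noteq> 0)"
  using assms
proof (induction W rule: finite_induct)
  case empty
  show ?case by (rule exI[of _ "\<lambda>_. 0"]) (simp add: linear_zero)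
next
  case (insert w W)
  then obtain \<eta> :: "'u \<Rightarrow> real" where \<eta>: "linear \<eta>" "\<forall>x\<in>span S. \<eta> x = 0" "\<forall>w\<in>W. \<eta> w \<noteq> 0"
    by auto
  obtain \<eta>' :: "'u \<Rightarrow> real" where \<eta>': "linear \<eta>'" "\<And>x. x \<in> span S \<Longrightarrow> \<eta>' x = 0" "\<eta>' w = 1"
    using ex_linear_functional[of w S] insert.prems by blast
  have "finite ((\<lambda>x. - \<eta> x / \<eta>' x) ` insert w W)" using insert.hyps by simp
  then obtain t where t: "t \<notin> (\<lambda>x. - \<eta> x / \<eta>' x) ` insert w W"
    using ex_new_if_finite[OF infinite_UNIV_char_0] by blast
  have "\<eta> x + t * \<eta>' x \<noteq> 0" if "x \<in> insert w W" for x
  proof (cases "\<eta>' x = 0")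
    case True
    then show ?thesis using that \<eta> \<eta>' by auto
  next
    case False
    then have "t \<noteq> - \<eta> x / \<eta>' x" using t that by blast
    then show ?thesis using False by (auto simp: field_simps)
  qed
  moreover have "linear (\<lambda>x. \<eta> x + t * \<eta>' x)"
    using \<eta>(1) \<eta>'(1) by (intro linear_compose_add linear_compose_scale_right[of \<eta>' t, simplified])
  ultimately show ?case
    using \<eta> \<eta>' by (intro exI[of _ "\<lambda>x. \<eta> x + t * \<eta>' x"]) auto
qed

text \<open>No vertex of the arrangement of the affine hyperplanes \<open>v i = c i\<close> lies on more hyperplanes than necessary.\<close>

definition generic :: "(nat \<Rightarrow> 'u::real_vector) \<Rightarrow> (nat \<Rightarrow> real) \<Rightarrow> nat set \<Rightarrow> bool"
  where "generic v c I \<longleftrightarrow> (\<forall>S j \<mu>. S \<subseteq> I \<longrightarrow> j \<in> I - S \<longrightarrow> inj_on v S \<longrightarrow> independent (v ` S) \<longrightarrow>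
    v j = (\<Sum>s\<in>S. \<mu> s *\<^sub>R v s) \<longrightarrow> c j \<noteq> (\<Sum>s\<in>S. \<mu> s * c s))"

lemma independent_coeffs_unique:
  fixes v :: "nat \<Rightarrow> 'u::real_vector"
  assumes "finite S" "inj_on v S" "independent (v ` S)" "(\<Sum>s\<in>S. \<mu> s *\<^sub>R v s) = (\<Sum>s\<in>S. \<nu> s *\<^sub>R v s)" "s \<in> S"
  shows "\<mu> s = \<nu> s"
proof -
  define u where "u = (\<lambda>x. \<mu> (inv_into S v x) - \<nu> (inv_into S v x))"
  have "(\<Sum>x\<in>v ` S. u x *\<^sub>R x) = (\<Sum>s\<in>S. (\<mu> s - \<nu> s) *\<^sub>R v s)"
    using assms(2) by (simp add: sum.reindex u_def)
  also have "\<dots> = 0" using assms(4) by (simp add: scaleR_left_diff_distrib sum_subtractf)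
  finally have "u (v s) = 0"
    using independentD[OF assms(3), of "v ` S" u "v s"] assms(1,5) by auto
  then show ?thesis using assms(2,5) by (simp add: u_def)
qed

text \<open>The offsets are taken on a moment curve, \<open>c i = t ^ i\<close>. The coefficients
  expressing \<open>v j\<close> through the independent \<open>v s\<close> are unique, so a
  violation for \<open>(S, j)\<close> makes \<open>t\<close> a root of one fixed polynomial; it is
  nonzero because its coefficient at \<open>j\<close> is 1. Finitely many pairs leave a good
  \<open>t\<close>.\<close>

lemma ex_generic:
  fixes v :: "nat \<Rightarrow> 'u::real_vector"
  assumes I: "finite I"
  shows "\<exists>c. generic v c I"
proof -
  define bad where "bad S j = {t::real. \<exists>\<mu>. v j = (\<Sum>s\<in>S. \<mu> s *\<^sub>R v s) \<and> t ^ j = (\<Sum>s\<in>S. \<mu> s * t ^ s)}" for S j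
  define good where "good = (\<lambda>(S, j). S \<subseteq> I \<and> j \<in> I - S \<and> inj_on v S \<and> independent (v ` S))"
  have fin: "finite (bad S j)" if "good (S, j)" for S j
  proof (cases "\<exists>\<mu>. v j = (\<Sum>s\<in>S. \<mu> s *\<^sub>R v s)")
    case True
    then obtain \<mu> where \<mu>: "v j = (\<Sum>s\<in>S. \<mu> s *\<^sub>R v s)" by blast
    define q where "q = monom 1 j - (\<Sum>s\<in>S. monom (\<mu> s) s)"
    have S: "finite S" "j \<notin> S" "inj_on v S" "independent (v ` S)"
      using that finite_subset[OF _ I] by (auto simp: good_def)
    have "coeff q j = 1" using S by (auto simp: q_def coeff_sum intro!: sum.neutral)
    then have "finite {t. poly q t = 0}" by (intro poly_roots_finite) auto
    moreover have "bad S j \<subseteq> {t. poly q t = 0}"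
    proof
      fix t assume "t \<in> bad S j"
      then obtain \<nu> where \<nu>: "v j = (\<Sum>s\<in>S. \<nu> s *\<^sub>R v s)" "t ^ j = (\<Sum>s\<in>S. \<nu> s * t ^ s)"
        by (auto simp: bad_def)
      have "\<mu> s = \<nu> s" if "s \<in> S" for s
        by (rule independent_coeffs_unique[of S v]) (use S \<mu> \<nu>(1) that in auto)
      then show "t \<in> {t. poly q t = 0}" using \<nu>(2) by (simp add: q_def poly_sum poly_monom)
    qed
    ultimately show ?thesis by (rule rev_finite_subset)
  next
    case False
    then show ?thesis by (auto simp: bad_def)
  qed
  have "finite {x. good x}"
    by (rule finite_subset[of _ "Pow I \<times> I"]) (use I in \<open>auto simp: good_def\<close>)
  then have "finite (\<Union>(S, j)\<in>{x. good x}. bad S j)" using fin by auto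
  then obtain t where t: "t \<notin> (\<Union>(S, j)\<in>{x. good x}. bad S j)"
    using ex_new_if_finite[OF infinite_UNIV_char_0] by blast
  have "generic v (\<lambda>i. t ^ i) I"
    unfolding generic_def
  proof (intro allI impI notI)
    fix S j \<mu>
    assume "S \<subseteq> I" "j \<in> I - S" "inj_on v S" "independent (v ` S)" "v j = (\<Sum>s\<in>S. \<mu> s *\<^sub>R v s)"
      "t ^ j = (\<Sum>s\<in>S. \<mu> s * t ^ s)"
    then have "good (S, j)" "t \<in> bad S j" by (auto simp: good_def bad_def)
    then show False using t by blast
  qed
  then show ?thesis by blast
qed


subsection \<open>Interpolation on the vertices of a generic arrangement\<close>

context lattice
begin

text \<open>Points of the dual space are real linear functionals rather than coordinate vectors, so
  that flats can be described by spans in \<open>U\<close>.\<close>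

definition ev :: "mpoly \<Rightarrow> ('u \<Rightarrow> real) \<Rightarrow> complex"
  where "ev f \<theta> = poly_eval f (\<lambda>i. of_real (\<theta> (bs ! i)))"

lemma ev_simps: "ev (f + g) \<theta> = ev f \<theta> + ev g \<theta>" "ev (f - g) \<theta> = ev f \<theta> - ev g \<theta>"
  "ev (f * g) \<theta> = ev f \<theta> * ev g \<theta>" "ev (cscale b f) \<theta> = b * ev f \<theta>" "ev 0 \<theta> = 0" "ev 1 \<theta> = 1"
  "ev (single 0 b) \<theta> = b" "ev (prod F A) \<theta> = (\<Prod>i\<in>A. ev (F i) \<theta>)"
  by (simp_all add: ev_def poly_eval_add poly_eval_diff poly_eval_mult poly_eval_cscale poly_eval_single poly_eval_prod)

lemma linear_coord: "linear \<theta> \<Longrightarrow> \<theta> u = (\<Sum>i<d. coord bs u i * (\<theta> (bs ! i) :: real))"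
  by (subst coord_expansion[of u]) (simp add: linear_sum linear_cmul)

lemma ev_lf: "linear \<theta> \<Longrightarrow> ev (lf u) \<theta> = of_real (\<theta> u)"
  by (subst linear_coord) (simp_all add: ev_def lin_form_def poly_eval_sum poly_eval_cscale Var_def poly_eval_single)

lemma ev_affine_form: "linear \<theta> \<Longrightarrow> ev (affine_form v c i) \<theta> = of_real (\<theta> (v i) - c i)"
  by (simp add: affine_form_def ev_simps ev_lf)

lemma ev_eq_0:
  assumes "f \<in> polys d" "\<And>\<theta>. linear \<theta> \<Longrightarrow> ev f \<theta> = 0"
  shows "f = 0"
proof (rule poly_eval_eq_0[OF assms(1)])
  fix x :: "nat \<Rightarrow> real"
  define \<theta> where "\<theta> u = (\<Sum>i<d. coord bs u i * x i)" for u
  have lin: "linear \<theta>"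
    by (rule linearI) (simp_all add: \<theta>_def coord_add coord_scale algebra_simps sum.distrib sum_distrib_left)
  have \<theta>: "\<theta> (bs ! i) = x i" if "i < d" for i
  proof -
    have "\<theta> (bs ! i) = (\<Sum>j<d. if j = i then x j else 0)"
      unfolding \<theta>_def by (rule sum.cong) (use that in \<open>auto simp: coord_bs\<close>)
    then show ?thesis using that by simp
  qed
  have "poly_eval f (\<lambda>i. of_real (x i)) = ev f \<theta>"
    unfolding ev_def poly_eval_def
    by (intro sum.cong prod.cong arg_cong2[of _ _ _ _ "(*)"] refl) (use assms(1) \<theta> in \<open>force simp: polys_def\<close>)
  then show "poly_eval f (\<lambda>i. of_real (x i)) = 0" using assms(2)[OF lin] by simp
qed

definition P_fam :: "(nat \<Rightarrow> 'u) \<Rightarrow> nat set \<Rightarrow> mpoly set"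
  where "P_fam v I = cpm.span {prodf v Z | Z. Z \<subseteq> I \<and> span (v ` (I - Z)) = UNIV}"

text \<open>The sets \<open>C\<close> need not be minimal: the ideal is the same as for cocircuits.\<close>

definition J_fam_gens :: "(nat \<Rightarrow> 'u) \<Rightarrow> nat set \<Rightarrow> mpoly set"
  where "J_fam_gens v I = {prodf v C | C. C \<subseteq> I \<and> span (v ` (I - C)) \<noteq> UNIV}"

definition J_fam :: "(nat \<Rightarrow> 'u) \<Rightarrow> nat set \<Rightarrow> mpoly set"
  where "J_fam v I = idl (polys d) (J_fam_gens v I)"

definition vertex :: "(nat \<Rightarrow> 'u) \<Rightarrow> (nat \<Rightarrow> real) \<Rightarrow> nat set \<Rightarrow> ('u \<Rightarrow> real) \<Rightarrow> bool"
  where "vertex v c I \<theta> \<longleftrightarrow> linear \<theta> \<and> (\<exists>S\<subseteq>I. span (v ` S) = UNIV \<and> (\<forall>i\<in>S. \<theta> (v i) = c i))"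

lemma P_fam_polys: "f \<in> P_fam v I \<Longrightarrow> f \<in> polys d"
  unfolding P_fam_def
  by (induction rule: cpm.span_induct_alt) (auto intro!: polys.add_in polys_cscale)

lemma P_fam_line:
  assumes f: "f \<in> P_fam v I" and fin: "finite I" and I: "span (v ` I) = UNIV" and S: "span (v ` S) \<noteq> UNIV"
    and lin: "linear \<theta>" "linear \<eta>" and \<eta>: "\<And>x. x \<in> span (v ` S) \<Longrightarrow> \<eta> x = 0"
  obtains q :: "complex poly" where "degree q < card {i\<in>I. v i \<notin> span (v ` S)}"
    "\<And>t::real. ev f (\<lambda>u. \<theta> u + t * \<eta> u) = poly q (of_real t)"
proof -
  let ?T = "{i\<in>I. v i \<notin> span (v ` S)}"
  have outside: "\<exists>i\<in>A. v i \<notin> span (v ` S)" if "span (v ` A) = UNIV" for A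
  proof (rule ccontr)
    assume "\<not> ?thesis"
    then have "v ` A \<subseteq> span (v ` S)" by auto
    then have "span (v ` A) \<subseteq> span (v ` S)" by (simp add: span_minimal)
    then show False using that S by auto
  qed
  then have T: "card ?T > 0" using fin I by (auto simp: card_gt_0_iff)
  have lin': "linear (\<lambda>u. \<theta> u + t * \<eta> u)" for t
    using lin by (intro linear_compose_add linear_compose_scale_right[of \<eta> t, simplified])
  have "\<exists>q. degree q < card ?T \<and> (\<forall>t::real. ev f (\<lambda>u. \<theta> u + t * \<eta> u) = poly q (of_real t))"
    using f unfolding P_fam_def
  proof (induction rule: cpm.span_induct_alt)
    case base
    show ?case by (rule exI[of _ 0]) (use T in \<open>simp add: ev_simps\<close>)
  next
    case (step b g h)
    then obtain Z where Z: "g = prodf v Z" "Z \<subseteq> I" "span (v ` (I - Z)) = UNIV" by auto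
    have "finite Z" using Z fin finite_subset by blast
    define q where "q = (\<Prod>i\<in>Z. [:complex_of_real (\<theta> (v i)), complex_of_real (\<eta> (v i)):])"
    have "degree q \<le> (\<Sum>i\<in>Z. degree [:complex_of_real (\<theta> (v i)), complex_of_real (\<eta> (v i)):])"
      unfolding q_def
      using degree_prod_sum_le[OF \<open>finite Z\<close>, of "\<lambda>i. [:complex_of_real (\<theta> (v i)), complex_of_real (\<eta> (v i)):]"]
      unfolding comp_def .
    also have "\<dots> \<le> (\<Sum>i\<in>Z. if i \<in> ?T then 1 else 0)"
      by (rule sum_mono) (use Z(2) \<eta> in auto)
    also have "\<dots> = card (Z \<inter> ?T)" using \<open>finite Z\<close> by (simp add: sum.If_cases)
    also have "\<dots> < card ?T"
    proof (rule psubset_card_mono)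
      show "Z \<inter> ?T \<subset> ?T" using outside[OF Z(3)] by auto
    qed (use fin in auto)
    finally have "degree q < card ?T" .
    moreover have "ev g (\<lambda>u. \<theta> u + t * \<eta> u) = poly q (of_real t)" for t
      using lin' by (simp add: Z(1) prodf_def ev_simps ev_lf q_def poly_prod)
    moreover obtain q' where "degree q' < card ?T" "\<And>t::real. ev h (\<lambda>u. \<theta> u + t * \<eta> u) = poly q' (of_real t)"
      using step by blast
    ultimately show ?case
      by (intro exI[of _ "smult b q + q'"])
        (auto simp: ev_simps intro!: degree_add_less le_less_trans[OF degree_smult_le])
  qed
  then show ?thesis using that by blast
qed

text \<open>
  Downward induction on the flat \<open>\<theta> (v i) = c i\<close>, \<open>i \<in> S\<close>. On a generic line through \<open>\<theta>\<close> inside it the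
  remaining hyperplanes cut out distinct points, which lie in smaller flats; they are more numerous than
  the degree of \<open>f\<close> on the line.
\<close>

lemma P_fam_vanishing:
  assumes f: "f \<in> P_fam v I" and fin: "finite I" and I: "span (v ` I) = UNIV" and gen: "generic v c I"
    and vert: "\<And>\<theta>. vertex v c I \<theta> \<Longrightarrow> ev f \<theta> = 0"
    and S: "S \<subseteq> I" "inj_on v S" "independent (v ` S)" and lin: "linear \<theta>" "\<And>i. i \<in> S \<Longrightarrow> \<theta> (v i) = c i"
  shows "ev f \<theta> = 0"
  using S lin
proof (induction "card I - card S" arbitrary: S \<theta> rule: less_induct)
  case less
  show ?case
  proof (cases "span (v ` S) = UNIV")
    case True
    then have "vertex v c I \<theta>" unfolding vertex_def using less.prems by blast
    then show ?thesis by (rule vert)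
  next
    case False
    let ?T = "{i\<in>I. v i \<notin> span (v ` S)}"
    have finS: "finite S" using less.prems fin finite_subset by blast
    have ext: "insert i S \<subseteq> I \<and> inj_on v (insert i S) \<and> independent (v ` insert i S) \<and> i \<notin> S" if "i \<in> ?T" for i
    proof -
      have "i \<notin> S" using that span_base[of "v i" "v ` S"] by auto
      moreover have "v i \<notin> v ` S" using that span_base[of "v i" "v ` S"] by auto
      ultimately show ?thesis using that less.prems by (auto simp: independent_insert)
    qed
    have IH: "ev f \<theta>' = 0" if i: "i \<in> ?T" and \<theta>': "linear \<theta>'" "\<theta>' (v i) = c i" "\<And>s. s \<in> S \<Longrightarrow> \<theta>' (v s) = c s" for i \<theta>'
    proof (rule less.hyps)
      have "card (insert i S) = Suc (card S)" using ext[OF i] finS by simp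
      moreover have "card (insert i S) \<le> card I" using ext[OF i] fin by (intro card_mono) auto
      ultimately show "card I - card (insert i S) < card I - card S" by simp
    qed (use ext[OF i] \<theta>' in auto)
    show ?thesis
    proof (cases "\<exists>i\<in>?T. \<theta> (v i) = c i")
      case True
      then show ?thesis using IH less.prems by blast
    next
      case nz: False
      \<comment> \<open>\<open>\<eta> (w i j) = 0\<close> says exactly that the hyperplanes
        \<open>i\<close> and \<open>j\<close> meet the line in the same point.\<close>
      define w where "w i j = (c i - \<theta> (v i)) *\<^sub>R v j - (c j - \<theta> (v j)) *\<^sub>R v i" for i j
      define W where "W = v ` ?T \<union> {w i j | i j. i \<in> ?T \<and> j \<in> ?T \<and> i \<noteq> j}"
      have "finite {w i j | i j. i \<in> ?T \<and> j \<in> ?T \<and> i \<noteq> j}"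
        by (rule finite_subset[of _ "(\<lambda>(i, j). w i j) ` (?T \<times> ?T)"]) (use fin in auto)
      then have "finite W" using fin by (simp add: W_def)
      \<comment> \<open>Otherwise \<open>v j\<close> would be a combination of \<open>v i\<close>
        and the \<open>v s\<close>, and evaluating at \<open>\<theta>\<close> would give
        \<open>c j\<close> as the same combination of offsets, against genericity.\<close>
      have "w i j \<notin> span (v ` S)" if ij: "i \<in> ?T" "j \<in> ?T" "i \<noteq> j" for i j
      proof
        assume "w i j \<in> span (v ` S)"
        then obtain \<mu> where \<mu>: "w i j = (\<Sum>x\<in>v ` S. \<mu> x *\<^sub>R x)"
          using span_finite[of "v ` S"] finS by auto
        let ?\<alpha> = "c i - \<theta> (v i)" and ?\<beta> = "c j - \<theta> (v j)"
        have \<alpha>: "?\<alpha> \<noteq> 0" using nz ij by auto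
        define \<nu> where "\<nu> s = (if s = i then ?\<beta> / ?\<alpha> else \<mu> (v s) / ?\<alpha>)" for s
        have *: "(\<Sum>s\<in>insert i S. \<nu> s *\<^sub>R g s) = (1 / ?\<alpha>) *\<^sub>R (?\<beta> *\<^sub>R g i + (\<Sum>s\<in>S. \<mu> (v s) *\<^sub>R g s))"
          for g :: "nat \<Rightarrow> 'b::real_vector"
        proof -
          have "(\<Sum>s\<in>insert i S. \<nu> s *\<^sub>R g s) = \<nu> i *\<^sub>R g i + (\<Sum>s\<in>S. \<nu> s *\<^sub>R g s)"
            using ext[OF ij(1)] finS by simp
          also have "(\<Sum>s\<in>S. \<nu> s *\<^sub>R g s) = (\<Sum>s\<in>S. (1 / ?\<alpha>) *\<^sub>R \<mu> (v s) *\<^sub>R g s)"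
            using ext[OF ij(1)] by (intro sum.cong refl) (auto simp: \<nu>_def)
          finally show ?thesis by (simp add: \<nu>_def scaleR_sum_right scaleR_add_right)
        qed
        have sumS: "(\<Sum>s\<in>S. \<mu> (v s) *\<^sub>R v s) = w i j"
          unfolding \<mu> using less.prems by (simp add: sum.reindex)
        have "v j = (1 / ?\<alpha>) *\<^sub>R (?\<alpha> *\<^sub>R v j)" using \<alpha> by simp
        also have "?\<alpha> *\<^sub>R v j = ?\<beta> *\<^sub>R v i + w i j" by (simp add: w_def)
        also have "(1 / ?\<alpha>) *\<^sub>R \<dots> = (\<Sum>s\<in>insert i S. \<nu> s *\<^sub>R v s)"
          by (simp only: * sumS)
        finally have vj: "v j = (\<Sum>s\<in>insert i S. \<nu> s *\<^sub>R v s)" .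
        have "j \<notin> S" using ext[OF ij(2)] by simp
        have "c j \<noteq> (\<Sum>s\<in>insert i S. \<nu> s * c s)"
          using gen[unfolded generic_def, rule_format, of "insert i S" j \<nu>] ext[OF ij(1)] ij \<open>j \<notin> S\<close> vj by auto
        moreover have "(\<Sum>s\<in>insert i S. \<nu> s * c s) = c j"
        proof -
          have "(\<Sum>s\<in>S. \<mu> (v s) * c s) = (\<Sum>s\<in>S. \<mu> (v s) *\<^sub>R \<theta> (v s))"
            using less.prems by (intro sum.cong) auto
          also have "\<dots> = \<theta> (w i j)"
            using less.prems(4) by (simp add: linear_sum linear_cmul flip: sumS)
          also have "\<dots> = ?\<alpha> * \<theta> (v j) - ?\<beta> * \<theta> (v i)"
            using less.prems(4) by (simp add: w_def linear_diff linear_cmul)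
          finally have "(\<Sum>s\<in>insert i S. \<nu> s * c s) = (1 / ?\<alpha>) * (?\<beta> * c i + (?\<alpha> * \<theta> (v j) - ?\<beta> * \<theta> (v i)))"
            using *[of c] by simp
          also have "?\<beta> * c i + (?\<alpha> * \<theta> (v j) - ?\<beta> * \<theta> (v i)) = ?\<alpha> * c j"
            by (simp add: algebra_simps)
          finally show ?thesis using \<alpha> by simp
        qed
        ultimately show False by simp
      qed
      then have "W \<inter> span (v ` S) = {}" by (auto simp: W_def)
      then obtain \<eta> :: "'u \<Rightarrow> real" where \<eta>: "linear \<eta>" "\<And>x. x \<in> span (v ` S) \<Longrightarrow> \<eta> x = 0" "\<And>w. w \<in> W \<Longrightarrow> \<eta> w \<noteq> 0"
        using ex_generic_functional[OF \<open>finite W\<close>] by metis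
      obtain q where q: "degree q < card ?T" "\<And>t::real. ev f (\<lambda>u. \<theta> u + t * \<eta> u) = poly q (of_real t)"
        using P_fam_line[OF f fin I False less.prems(4) \<eta>(1,2)] by blast
      \<comment> \<open>The parameter at which the line crosses the hyperplane
        \<open>i\<close>.\<close>
      define \<tau> where "\<tau> i = (c i - \<theta> (v i)) / \<eta> (v i)" for i
      have \<eta>T: "\<eta> (v i) \<noteq> 0" if "i \<in> ?T" for i using \<eta>(3) that by (auto simp: W_def)
      have root: "poly q (of_real (\<tau> i)) = 0" if "i \<in> ?T" for i
        unfolding q(2)[symmetric]
      proof (rule IH[OF that])
        show "linear (\<lambda>u. \<theta> u + \<tau> i * \<eta> u)"
          using less.prems(4) \<eta>(1) by (intro linear_compose_add linear_compose_scale_right[of \<eta> "\<tau> i", simplified])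
        show "\<theta> (v i) + \<tau> i * \<eta> (v i) = c i" using \<eta>T[OF that] by (simp add: \<tau>_def)
        show "\<theta> (v s) + \<tau> i * \<eta> (v s) = c s" if "s \<in> S" for s
          using \<eta>(2)[of "v s"] less.prems(5) that by (simp add: span_base)
      qed
      have "inj_on \<tau> ?T"
      proof (rule inj_onI, rule ccontr)
        fix i j assume ij: "i \<in> ?T" "j \<in> ?T" "\<tau> i = \<tau> j" "i \<noteq> j"
        then have "(c i - \<theta> (v i)) * \<eta> (v j) = (c j - \<theta> (v j)) * \<eta> (v i)"
          using \<eta>T[OF ij(1)] \<eta>T[OF ij(2)] by (simp add: \<tau>_def field_simps)
        then have "\<eta> (w i j) = 0" using \<eta>(1) by (simp add: w_def linear_diff linear_cmul)
        moreover have "w i j \<in> W" using ij by (auto simp: W_def)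
        ultimately show False using \<eta>(3) by blast
      qed
      then have card: "card ((\<lambda>i. complex_of_real (\<tau> i)) ` ?T) = card ?T"
        by (intro card_image) (auto simp: inj_on_def)
      \<comment> \<open>There are \<open>card ?T\<close> distinct roots, more than the degree
        allows; \<open>t = 0\<close> then gives the value at \<open>\<theta>\<close>.\<close>
      have "q = 0"
      proof (rule ccontr)
        assume "q \<noteq> 0"
        have "card ((\<lambda>i. complex_of_real (\<tau> i)) ` ?T) \<le> card {x. poly q x = 0}"
          by (rule card_mono) (use root poly_roots_finite[OF \<open>q \<noteq> 0\<close>] in auto)
        also have "\<dots> \<le> degree q" by (rule card_poly_roots_bound[OF \<open>q \<noteq> 0\<close>])
        finally show False using q(1) card by simp
      qed
      then show ?thesis using q(2)[of 0] by simp
    qed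
  qed
qed

lemma P_fam_vertices:
  assumes "f \<in> P_fam v I" "finite I" "span (v ` I) = UNIV" "generic v c I"
    "\<And>\<theta>. vertex v c I \<theta> \<Longrightarrow> ev f \<theta> = 0"
  shows "f = 0"
proof (rule ev_eq_0[OF P_fam_polys[OF assms(1)]])
  fix \<theta> :: "'u \<Rightarrow> real" assume "linear \<theta>"
  then show "ev f \<theta> = 0"
    by (intro P_fam_vanishing[OF assms, of "{}"]) (auto simp: real_vector.independent_empty)
qed


subsection \<open>The internal space complements the cocircuit ideal\<close>

lemma J_fam_gens_polys: "J_fam_gens v I \<subseteq> polys d"
  by (auto simp: J_fam_gens_def)

lemma J_fam_span:
  assumes "f \<in> J_fam v I"
  shows "f \<in> cpm.span {r * prodf v C | r C. r \<in> polys d \<and> C \<subseteq> I \<and> span (v ` (I - C)) \<noteq> UNIV}"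
    (is "f \<in> cpm.span ?G")
  using J_fam_gens_polys assms[unfolded J_fam_def]
proof (induction rule: polys.ideal_induct)
  case zero
  then show ?case by (rule cpm.span_zero)
next
  case (gen s)
  then obtain C where "s = 1 * prodf v C" "C \<subseteq> I" "span (v ` (I - C)) \<noteq> UNIV"
    by (auto simp: J_fam_gens_def)
  then show ?case
    by (intro cpm.span_base CollectI exI[of _ 1] exI[of _ C]) simp
next
  case (add x y)
  then show ?case by (intro cpm.span_add)
next
  case (mult r x)
  from mult(3) show ?case
  proof (induction rule: cpm.span_induct_alt)
    case base
    show ?case by (simp add: cpm.span_zero)
  next
    case (step b g h)
    then obtain s C where "g = s * prodf v C" "s \<in> polys d" "C \<subseteq> I" "span (v ` (I - C)) \<noteq> UNIV" by auto
    then have "r * g \<in> cpm.span ?G"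
      by (intro cpm.span_base CollectI exI[of _ "r * s"] exI[of _ C]) (simp add: mult.assoc polys.mult_in mult(1))
    then show ?case using step(2) unfolding distrib_left cscale_mult_right by (intro cpm.span_add cpm.span_scale)
  qed
qed

lemma J_fam_gen: "C \<subseteq> I \<Longrightarrow> span (v ` (I - C)) \<noteq> UNIV \<Longrightarrow> prodf v C \<in> J_fam v I"
  unfolding J_fam_def by (rule polys.idl_gen[OF J_fam_gens_polys]) (auto simp: J_fam_gens_def)

lemmas J_fam_zero = polys.idl_zero[OF J_fam_gens_polys, folded J_fam_def]
  and J_fam_add = polys.idl_add[OF J_fam_gens_polys, folded J_fam_def]
  and J_fam_diff = polys.idl_diff[OF J_fam_gens_polys, folded J_fam_def]
  and J_fam_mult = polys.idl_mult[OF J_fam_gens_polys, folded J_fam_def]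
  and J_fam_sum = polys.idl_sum[OF J_fam_gens_polys, folded J_fam_def]
  and J_fam_polys = polys.idl_in[OF J_fam_gens_polys, folded J_fam_def]

lemma J_fam_cscale: "f \<in> J_fam v I \<Longrightarrow> cscale b f \<in> J_fam v I"
  unfolding cscale_def by (rule J_fam_mult) auto

text \<open>The generators are homogeneous, so the ideal is graded. The exact degrees of the
  cofactors are recorded for the degree estimates to come.\<close>

lemma J_fam_hpart:
  assumes "finite I" "f \<in> J_fam v I"
  shows "hpart k f \<in> cpm.span {r * prodf v C | r C. r \<in> polys d \<and> homog (k - card C) r \<and> card C \<le> k \<and>
    C \<subseteq> I \<and> span (v ` (I - C)) \<noteq> UNIV}" (is "_ \<in> cpm.span ?H")
  using J_fam_span[OF assms(2)]
proof (induction rule: cpm.span_induct_alt)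
  case base
  show ?case by (simp add: cpm.span_zero)
next
  case (step b g h)
  then obtain r C where C: "g = r * prodf v C" "r \<in> polys d" "C \<subseteq> I" "span (v ` (I - C)) \<noteq> UNIV" by auto
  have "finite C" using C assms finite_subset by blast
  then have eq: "hpart k g = (if card C \<le> k then hpart (k - card C) r * prodf v C else 0)"
    unfolding C(1) by (rule hpart_mult[OF homog_prodf])
  have "hpart k g \<in> cpm.span ?H"
  proof (cases "card C \<le> k")
    case True
    then show ?thesis unfolding eq using C homog_hpart hpart_in_polys
      by (intro cpm.span_base CollectI exI[of _ "hpart (k - card C) r"] exI[of _ C]) simp
  next
    case False
    then show ?thesis unfolding eq by (simp add: cpm.span_zero)
  qed
  then show ?case using step(2) unfolding hpart_add hpart_cscale by (intro cpm.span_add cpm.span_scale)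
qed

lemma P_fam_hpart:
  assumes "finite I" "f \<in> P_fam v I"
  shows "hpart k f \<in> P_fam v I"
  using assms(2) unfolding P_fam_def
proof (induction rule: cpm.span_induct_alt)
  case base
  show ?case by (simp add: cpm.span_zero)
next
  case (step b g h)
  then obtain Z where Z: "g = prodf v Z" "Z \<subseteq> I" "span (v ` (I - Z)) = UNIV" by auto
  then have "homog (card Z) g" using assms(1) finite_subset homog_prodf by blast
  then have "hpart k g = (if k = card Z then g else 0)" using hpart_self hpart_other by metis
  then have "hpart k g \<in> cpm.span {prodf v Z | Z. Z \<subseteq> I \<and> span (v ` (I - Z)) = UNIV}"
    using step by (auto intro: cpm.span_base cpm.span_zero)
  then show ?case using step(2) unfolding hpart_add hpart_cscale by (intro cpm.span_add cpm.span_scale)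
qed

lemma affine_prod_diff:
  "finite C \<Longrightarrow> prodf v C - (\<Prod>i\<in>C. affine_form v c i) \<in> degless d (card C)"
proof (induction C rule: finite_induct)
  case (insert y C)
  let ?A = "\<Prod>i\<in>C. affine_form v c i"
  have "prodf v (insert y C) - (\<Prod>i\<in>insert y C. affine_form v c i)
      = affine_form v c y * (prodf v C - ?A) + cscale (of_real (c y)) (prodf v C)"
    using insert.hyps by (simp add: prodf_def affine_form_def cscale_def algebra_simps)
  moreover have "prodf v C \<in> degless d (card (insert y C))"
    using homog_prodf[of C v] insert.hyps by (auto simp: degless_def homog_def)
  moreover have "affine_form v c y * (prodf v C - ?A) \<in> degless d (card (insert y C))"
    by (rule degless_affine_mult) (use insert in simp)
  ultimately show ?case by (simp add: degless_add degless_cscale)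
qed (simp add: prodf_def)

text \<open>The indices active at a vertex span, so they cannot all lie in the non-spanning
  complement of \<open>C\<close>; an active index in \<open>C\<close> contributes a vanishing
  factor.\<close>

lemma vertex_cocircuit:
  assumes "vertex v c I \<theta>" "finite C" "C \<subseteq> I" "span (v ` (I - C)) \<noteq> UNIV"
  shows "ev (r * (\<Prod>i\<in>C. affine_form v c i)) \<theta> = 0"
proof -
  obtain S where S: "S \<subseteq> I" "span (v ` S) = UNIV" "\<And>i. i \<in> S \<Longrightarrow> \<theta> (v i) = c i" and lin: "linear \<theta>"
    using assms(1) by (auto simp: vertex_def)
  have "\<not> S \<subseteq> I - C"
    using span_mono[of "v ` S" "v ` (I - C)"] S(2) assms(4) by (auto simp: image_mono)
  then obtain i where "i \<in> S" "i \<in> C" using S(1) by auto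
  then have "\<exists>i\<in>C. ev (affine_form v c i) \<theta> = 0" using S(3) lin by (auto simp: ev_affine_form)
  then show ?thesis using assms(2) by (simp add: ev_simps)
qed

lemma P_gens_P_fam: "p \<in> cpm.span (P_gens v k {} I) \<Longrightarrow> p \<in> P_fam v I"
  unfolding P_fam_def P_gens_def Un_empty_left
  by (erule rev_subsetD, rule cpm.span_mono, rule Collect_mono) blast

text \<open>
  A homogeneous element of the intersection agrees, up to lower degree, with a combination of the affine
  cocircuit products, hence on the vertices with an element of \<open>P_fam\<close> of lower degree; by interpolation
  the two are equal.
\<close>

theorem P_fam_inter_J_fam:
  assumes fin: "finite I" and I: "span (v ` I) = UNIV" and f: "f \<in> P_fam v I" "f \<in> J_fam v I"
  shows "f = 0"
proof (rule eq_zero_hparts)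
  fix k
  obtain c where c: "generic v c I" using ex_generic[OF fin] by blast
  define V where "V = {g. \<forall>\<theta>. vertex v c I \<theta> \<longrightarrow> ev g \<theta> = 0}"
  have V_add: "x + y \<in> V" "x - y \<in> V" "cscale b x \<in> V" if "x \<in> V" "y \<in> V" for x y b
    using that by (auto simp: V_def ev_simps)
  let ?g = "hpart k f"
  have gP: "?g \<in> P_fam v I" using P_fam_hpart[OF fin f(1)] .
  have "\<exists>h\<in>V. ?g - h \<in> degless d k"
    using J_fam_hpart[OF fin f(2), of k]
  proof (induction rule: cpm.span_induct_alt)
    case base
    show ?case by (rule bexI[of _ 0]) (auto simp: V_def ev_simps)
  next
    case (step b x y)
    then obtain r C h where C: "x = r * prodf v C" "r \<in> polys d" "homog (k - card C) r" "card C \<le> k" "C \<subseteq> I"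
      "span (v ` (I - C)) \<noteq> UNIV" and h: "h \<in> V" "y - h \<in> degless d k" by auto
    have finC: "finite C" using C fin finite_subset by blast
    let ?A = "\<Prod>i\<in>C. affine_form v c i"
    \<comment> \<open>Replacing linear by affine forms changes only terms of lower degree, and the
      bounds add up to \<open>k\<close> because \<open>card C\<close> is at most
      \<open>k\<close>.\<close>
    have "r * (prodf v C - ?A) \<in> degless d (card C + (k - card C))"
      by (rule degless_mult[OF affine_prod_diff[OF finC]]) (use C in \<open>auto simp: homog_def\<close>)
    then have "x - r * ?A \<in> degless d k" using C by (simp add: algebra_simps)
    then have "cscale b x + y - (cscale b (r * ?A) + h) \<in> degless d k"
      using degless_add[OF degless_cscale[of "x - r * ?A" d k b] h(2)]
      by (simp add: cpm.scale_right_diff_distrib algebra_simps)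
    moreover have "r * ?A \<in> V" using vertex_cocircuit[OF _ finC C(5,6)] by (auto simp: V_def)
    then have "cscale b (r * ?A) + h \<in> V" by (intro V_add h(1))
    ultimately show ?case by (intro bexI[of _ "cscale b (r * ?A) + h"])
  qed
  then obtain h where h: "h \<in> V" "?g - h \<in> degless d k" by blast
  \<comment> \<open>Here the degree-controlled form of the decomposition is essential: it makes
    \<open>p\<close> an element of \<open>P_fam\<close> of degree below \<open>k\<close>.\<close>
  obtain p j where pj: "?g - h = p + j" "p \<in> cpm.span (P_gens v k {} I)" "j \<in> cpm.span (J_gens v c k {} I)"
    using degless_decompose[OF fin I h(2)] by blast
  have "j \<in> V"
    using pj(3)
  proof (induction rule: cpm.span_induct_alt)
    case (step b x y)
    then obtain r C where C: "x = r * (\<Prod>i\<in>C. affine_form v c i)" "C \<subseteq> I" "span (v ` (I - C)) \<noteq> UNIV"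
      unfolding J_gens_def Un_empty_left by blast
    then have "x \<in> V" unfolding V_def using vertex_cocircuit[OF _ finite_subset[OF C(2) fin] C(2,3)] by simp
    then show ?case by (intro V_add step(2))
  qed (auto simp: V_def ev_simps)
  have "p \<in> P_fam v I" by (rule P_gens_P_fam[OF pj(2)])
  moreover have "p \<in> degless d k"
    using pj(2)
  proof (induction rule: cpm.span_induct_alt)
    case (step b x y)
    then obtain Z where Z: "x = prodf v Z" "Z \<subseteq> I" "card Z < k" by (auto simp: P_gens_def)
    then have "x \<in> degless d k"
      using homog_prodf[of Z v] finite_subset[OF _ fin] by (auto simp: degless_def homog_def)
    then show ?case using step by (intro degless_add degless_cscale)
  qed simp
  moreover have "?g - p \<in> V" using V_add(1)[OF h(1) \<open>j \<in> V\<close>] pj(1) by (simp add: algebra_simps)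
  moreover have "?g - p \<in> P_fam v I" using gP \<open>p \<in> P_fam v I\<close> unfolding P_fam_def by (rule cpm.span_diff)
  ultimately have "?g - p = 0" using P_fam_vertices[OF _ fin I c, of "?g - p"] by (auto simp: V_def)
  then have "?g \<in> degless d k" using \<open>p \<in> degless d k\<close> by simp
  then show "?g = 0" by (rule hpart_degless[OF _ homog_hpart])
qed

theorem P_fam_plus_J_fam:
  assumes fin: "finite I" and I: "span (v ` I) = UNIV" and f: "f \<in> polys d"
  obtains p j where "f = p + j" "p \<in> P_fam v I" "j \<in> J_fam v I"
proof -
  have "f \<in> degless d (Suc (\<Sum>m\<in>keys f. mdeg m))"
    using f by (auto simp: degless_def less_Suc_eq_le intro: member_le_sum)
  then obtain k where "f \<in> degless d k" by blast
  then obtain p j where pj: "f = p + j" "p \<in> cpm.span (P_gens v k {} I)" "j \<in> cpm.span (J_gens v (\<lambda>_. 0) k {} I)"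
    using degless_decompose[OF fin I] by blast
  have "p \<in> P_fam v I" by (rule P_gens_P_fam[OF pj(2)])
  moreover have "j \<in> J_fam v I"
    using pj(3)
  proof (induction rule: cpm.span_induct_alt)
    case base
    show ?case by (rule J_fam_zero)
  next
    case (step b x y)
    then obtain r C where C: "x = r * prodf v C" "C \<subseteq> I" "span (v ` (I - C)) \<noteq> UNIV" "r \<in> polys d"
      unfolding J_gens_def degless_def affine_form_def prodf_def by simp blast
    have "x \<in> J_fam v I" unfolding C(1) by (rule J_fam_mult[OF C(4) J_fam_gen[OF C(2,3)]])
    then show ?case using step by (intro J_fam_add J_fam_cscale)
  qed
  ultimately show ?thesis using that pj(1) by blast
qed

text \<open>Elements of \<open>P_fam\<close> have degree at most \<open>card I\<close>. Decompose a
  monomial of higher degree and compare components in its degree: only the component from the graded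
  ideal survives. This is what justifies truncation in the discrete case.\<close>

lemma mN_J_fam:
  assumes fin: "finite I" and I: "span (v ` I) = UNIV" and f: "f \<in> polys d" "f \<in> mN (Suc (card I))"
  shows "f \<in> J_fam v I"
  using f(1)
proof (rule mpoly_induct_span)
  fix m b assume m: "keys m \<subseteq> {..<d}" "m \<in> keys f"
  then have deg: "card I < mdeg m" using f(2) by (auto simp: mN_def)
  obtain p j where pj: "single m b = p + j" "p \<in> P_fam v I" "j \<in> J_fam v I"
    using P_fam_plus_J_fam[OF fin I polys_single[OF m(1), of b]] by blast
  have "hpart (mdeg m) p = 0"
    using pj(2) unfolding P_fam_def
  proof (induction rule: cpm.span_induct_alt)
    case (step c x y)
    then obtain Z where Z: "x = prodf v Z" "Z \<subseteq> I" by auto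
    then have "homog (card Z) x" "card Z \<noteq> mdeg m"
      using homog_prodf[of Z v] finite_subset[OF _ fin] card_mono[OF fin Z(2)] deg by auto
    then show ?case using step by (simp add: hpart_add hpart_cscale hpart_other)
  qed simp
  moreover have "hpart (mdeg m) (single m b) = single m b" by (simp add: hpart_single)
  ultimately have "single m b = hpart (mdeg m) j" unfolding pj(1) hpart_add by simp
  moreover have "hpart (mdeg m) j \<in> J_fam v I"
    using J_fam_hpart[OF fin pj(3), of "mdeg m"]
  proof (induction rule: cpm.span_induct_alt)
    case base
    show ?case by (rule J_fam_zero)
  next
    case (step c x y)
    then obtain r C where C: "x = r * prodf v C" "r \<in> polys d" "C \<subseteq> I" "span (v ` (I - C)) \<noteq> UNIV"
      by blast
    have "x \<in> J_fam v I" unfolding C(1) by (rule J_fam_mult[OF C(2) J_fam_gen[OF C(3,4)]])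
    then show ?case using step by (intro J_fam_add J_fam_cscale)
  qed
  ultimately show "single m b \<in> J_fam v I" by simp
qed (auto intro: J_fam_zero J_fam_add)

end

section \<open>Index families and functionals on the local quotients\<close>

subsection \<open>Sublists and index families\<close>

lemma nths_eq_map: "nths xs A = map ((!) xs) (filter (\<lambda>i. i \<in> A) [0..<length xs])"
proof -
  have "zip xs [0..<length xs] = map (\<lambda>i. (xs ! i, i)) [0..<length xs]"
    by (rule nth_equalityI) auto
  then show ?thesis by (simp add: nths_def filter_map comp_def)
qed

lemma prod_list_nths:
  fixes F :: "'a \<Rightarrow> 'r::comm_monoid_mult"
  assumes "C \<subseteq> {..<length Y}"
  shows "prod_list (map F (nths Y C)) = (\<Prod>i\<in>C. F (Y ! i))"
proof -
  have "prod_list (map F (nths Y C)) = (\<Prod>i\<in>set (filter (\<lambda>i. i \<in> C) [0..<length Y]). F (Y ! i))"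
    by (subst prod.distinct_set_conv_list) (simp_all add: nths_eq_map comp_def)
  also have "set (filter (\<lambda>i. i \<in> C) [0..<length Y]) = C" using assms by auto
  finally show ?thesis .
qed

lemma set_nths_compl: "set (nths Y (- C)) = (!) Y ` ({..<length Y} - C)"
  by (auto simp: set_nths)

text \<open>\<open>F\<close> is a parameter so that the same results serve the linear forms and the
  elements \<open>1 - x\<close> of the group algebra.\<close>

definition cocirc_gens :: "('u::real_vector \<Rightarrow> 'r::comm_ring_1) \<Rightarrow> (nat \<Rightarrow> 'u) \<Rightarrow> nat set \<Rightarrow> 'r set"
  where "cocirc_gens F v I = {\<Prod>i\<in>C. F (v i) | C. C \<subseteq> I \<and> span (v ` (I - C)) \<noteq> UNIV}"

lemma cocirc_gensI: "C \<subseteq> I \<Longrightarrow> span (v ` (I - C)) \<noteq> UNIV \<Longrightarrow> (\<Prod>i\<in>C. F (v i)) \<in> cocirc_gens F v I"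
  unfolding cocirc_gens_def by blast

lemma cocircuit_subset:
  assumes "C \<subseteq> {..<length Y}" "span ((!) Y ` ({..<length Y} - C)) \<noteq> UNIV"
  obtains C' where "C' \<subseteq> C" "cocircuit Y C'"
proof -
  let ?P = "\<lambda>C'. C' \<subseteq> C \<and> span ((!) Y ` ({..<length Y} - C')) \<noteq> UNIV"
  have "?P C" using assms by simp
  from ex_has_least_nat[of ?P, OF this, of card]
  obtain C' where C': "?P C'" "\<forall>D. ?P D \<longrightarrow> card C' \<le> card D"
    by (rule exE) (erule conjE, rule that)
  have C'Y: "C' \<subseteq> {..<length Y}" by (rule subset_trans[OF conjunct1[OF C'(1)] assms(1)])
  have "finite C'" by (rule finite_subset[OF C'Y]) simp
  have "cocircuit Y C'"
    unfolding cocircuit_def set_nths_compl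
  proof (intro conjI allI impI)
    fix D assume "D \<subset> C'"
    then have less: "card D < card C'" using \<open>finite C'\<close> psubset_card_mono by blast
    have "D \<subseteq> C" using conjunct1[OF C'(1)] \<open>D \<subset> C'\<close> by auto
    show "span ((!) Y ` ({..<length Y} - D)) = UNIV"
    proof (rule ccontr)
      assume "span ((!) Y ` ({..<length Y} - D)) \<noteq> UNIV"
      with \<open>D \<subseteq> C\<close> have "card C' \<le> card D" by (intro C'(2)[rule_format] conjI)
      then show False using less by simp
    qed
  next
    show "C' \<subseteq> {..<length Y}" by (rule C'Y)
    show "span ((!) Y ` ({..<length Y} - C')) \<noteq> UNIV" by (rule conjunct2[OF C'(1)])
  qed
  then show ?thesis by (rule that[OF conjunct1[OF C'(1)]])
qed

context comm_subring
begin

text \<open>A product over \<open>C\<close> is a multiple of the product over a minimal subset with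
  non-spanning complement, so dropping minimality does not enlarge the ideal.\<close>

lemma idl_cocircuits:
  assumes F: "\<And>x. x \<in> set Y \<Longrightarrow> F x \<in> R"
  shows "idl R {prod_list (map F (nths Y C)) | C. cocircuit Y C} = idl R (cocirc_gens F ((!) Y) {..<length Y})"
    (is "idl R ?A = idl R ?B")
proof
  have FR: "(\<Prod>i\<in>C. F (Y ! i)) \<in> R" if "C \<subseteq> {..<length Y}" for C
    by (rule prod_in) (use that F in auto)
  have AB: "?A \<subseteq> ?B"
  proof
    fix x assume "x \<in> ?A"
    then obtain C where C: "x = prod_list (map F (nths Y C))" "cocircuit Y C" by blast
    then have "C \<subseteq> {..<length Y}" "span ((!) Y ` ({..<length Y} - C)) \<noteq> UNIV"
      unfolding cocircuit_def set_nths_compl by simp_all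
    then show "x \<in> ?B" using cocirc_gensI[of C "{..<length Y}" "(!) Y" F] by (simp add: C(1) prod_list_nths)
  qed
  have B: "?B \<subseteq> R" using FR by (auto simp: cocirc_gens_def)
  have A: "?A \<subseteq> R" using AB B by blast
  show "idl R ?A \<subseteq> idl R ?B"
    by (rule idl_subset[OF A B]) (use AB idl_gen[OF B] in blast)
  show "idl R ?B \<subseteq> idl R ?A"
  proof (rule idl_subset[OF B A])
    fix s assume "s \<in> ?B"
    then obtain C where C: "s = (\<Prod>i\<in>C. F (Y ! i))" "C \<subseteq> {..<length Y}" "span ((!) Y ` ({..<length Y} - C)) \<noteq> UNIV"
      unfolding cocirc_gens_def by blast
    obtain C' where C': "C' \<subseteq> C" "cocircuit Y C'" using cocircuit_subset[OF C(2,3)] .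
    have "finite C" using C(2) finite_subset by blast
    then have "s = (\<Prod>i\<in>C - C'. F (Y ! i)) * (\<Prod>i\<in>C'. F (Y ! i))"
      unfolding C(1) by (rule prod.subset_diff[OF C'(1)])
    moreover have "(\<Prod>i\<in>C'. F (Y ! i)) \<in> ?A"
      unfolding prod_list_nths[OF subset_trans[OF C'(1) C(2)], of F, symmetric] using C'(2) by blast
    moreover have "(\<Prod>i\<in>C - C'. F (Y ! i)) \<in> R" by (rule FR) (use C(2) in auto)
    ultimately show "s \<in> idl R ?A" using idl_mult[OF A _ idl_gen[OF A]] by simp
  qed
qed

end

lemma image_mset_split:
  assumes "finite I" "image_mset v (mset_set I) = Z + W"
  shows "\<exists>A\<subseteq>I. image_mset v (mset_set A) = Z \<and> image_mset v (mset_set (I - A)) = W"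
  using assms
proof (induction I arbitrary: Z W rule: finite_induct)
  case (insert i I)
  have split: "\<exists>A\<subseteq>I. image_mset v (mset_set A) = Z' \<and> image_mset v (mset_set (I - A)) = W'"
    if "image_mset v (mset_set I) = Z' + W'" for Z' W' using insert.IH[OF that] .
  have *: "add_mset (v i) (image_mset v (mset_set I)) = Z + W" using insert by simp
  then have "v i \<in># Z + W" by (metis union_single_eq_member)
  then consider Z' where "Z = add_mset (v i) Z'" | W' where "W = add_mset (v i) W'"
    by (metis mset_add union_iff)
  then show ?case
  proof cases
    case 1
    then obtain A where A: "A \<subseteq> I" "image_mset v (mset_set A) = Z'" "image_mset v (mset_set (I - A)) = W"
      using split[of Z' W] * by auto
    have "insert i I - insert i A = I - A" "i \<notin> A" "finite A"
      using insert.hyps A(1) finite_subset by auto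
    then show ?thesis using A 1 by (intro exI[of _ "insert i A"]) auto
  next
    case 2
    then obtain A where A: "A \<subseteq> I" "image_mset v (mset_set A) = Z" "image_mset v (mset_set (I - A)) = W'"
      using split[of Z W'] * by auto
    have "insert i I - A = insert i (I - A)" using insert.hyps A(1) by auto
    then show ?thesis using A 2 insert.hyps by (intro exI[of _ A]) auto
  qed
qed auto

text \<open>Products and spans of complements depend only on the multiset of vectors. Hence the
  positions in \<open>fixed_part X e\<close>, which vary with \<open>e\<close>, can be replaced by
  positions in \<open>X\<close> itself.\<close>

lemma family_transfer:
  fixes v w :: "nat \<Rightarrow> 'u" and F :: "'u \<Rightarrow> 'r::comm_monoid_mult"
  assumes fin: "finite I" "finite K" and eq: "image_mset v (mset_set I) = image_mset w (mset_set K)"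
    and A: "A \<subseteq> I"
  shows "\<exists>B\<subseteq>K. (\<Prod>i\<in>A. F (v i)) = (\<Prod>i\<in>B. F (w i)) \<and> v ` (I - A) = w ` (K - B)"
proof -
  have "mset_set I = mset_set A + mset_set (I - A)"
    using mset_set_Union[of A "I - A"] A fin finite_subset by (metis Diff_disjoint Diff_partition finite_Diff)
  then have "image_mset w (mset_set K) = image_mset v (mset_set A) + image_mset v (mset_set (I - A))"
    by (simp flip: eq)
  then obtain B where B: "B \<subseteq> K" "image_mset w (mset_set B) = image_mset v (mset_set A)"
    "image_mset w (mset_set (K - B)) = image_mset v (mset_set (I - A))"
    using image_mset_split[OF fin(2)] by metis
  have "(\<Prod>i\<in>A. F (v i)) = prod_mset (image_mset F (image_mset v (mset_set A)))"
    by (simp add: prod_unfold_prod_mset image_mset.compositionality comp_def)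
  also have "\<dots> = (\<Prod>i\<in>B. F (w i))"
    by (simp add: prod_unfold_prod_mset image_mset.compositionality comp_def flip: B(2))
  finally have "(\<Prod>i\<in>A. F (v i)) = (\<Prod>i\<in>B. F (w i))" .
  moreover have "set_mset (image_mset v (mset_set (I - A))) = set_mset (image_mset w (mset_set (K - B)))"
    using B(3) by simp
  then have "v ` (I - A) = w ` (K - B)" using fin by simp
  ultimately show ?thesis using B(1) by blast
qed

lemma cocirc_gens_transfer:
  assumes "finite I" "finite K" "image_mset v (mset_set I) = image_mset w (mset_set K)"
  shows "cocirc_gens F v I = cocirc_gens F w K"
proof -
  have "cocirc_gens F v I \<subseteq> cocirc_gens F w K"
    if "finite I" "finite K" "image_mset v (mset_set I) = image_mset w (mset_set K)" for v w I K
  proof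
    fix x assume "x \<in> cocirc_gens F v I"
    then obtain C where C: "x = (\<Prod>i\<in>C. F (v i))" "C \<subseteq> I" "span (v ` (I - C)) \<noteq> UNIV"
      unfolding cocirc_gens_def by blast
    then show "x \<in> cocirc_gens F w K"
      using family_transfer[OF that C(2), of F] by (auto intro!: cocirc_gensI)
  qed
  from this[OF assms] this[OF assms(2,1) assms(3)[symmetric]] show ?thesis by blast
qed

lemma mset_nth_image: "image_mset ((!) X) (mset_set {..<length X}) = mset X"
proof -
  have "mset X = mset (map ((!) X) [0..<length X])" by (simp add: map_nth)
  then show ?thesis by (simp add: atLeast0LessThan)
qed

definition fixed_idx :: "'u list \<Rightarrow> 'u character \<Rightarrow> nat set"
  where "fixed_idx X e = {i. i < length X \<and> e (X ! i) = 1}"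

lemma finite_fixed_idx [simp]: "finite (fixed_idx X e)"
  by (simp add: fixed_idx_def)

lemma card_fixed_idx: "card (fixed_idx X e) \<le> length X"
  using card_mono[of "{..<length X}" "fixed_idx X e"] by (auto simp: fixed_idx_def)

lemma mset_fixed_part:
  "image_mset ((!) (fixed_part X e)) (mset_set {..<length (fixed_part X e)}) = image_mset ((!) X) (mset_set (fixed_idx X e))"
proof -
  have "mset_set (fixed_idx X e) = filter_mset (\<lambda>i. e (X ! i) = 1) (mset_set {..<length X})"
    by (subst filter_mset_mset_set) (auto simp: fixed_idx_def intro!: arg_cong[of _ _ mset_set])
  then have "image_mset ((!) X) (mset_set (fixed_idx X e)) = filter_mset (\<lambda>x. e x = 1) (image_mset ((!) X) (mset_set {..<length X}))"
    by (simp add: filter_mset_image_mset)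
  then show ?thesis by (simp add: mset_nth_image fixed_part_def)
qed

context lattice
begin

lemma J_fam_gens_cocirc: "J_fam_gens v I = cocirc_gens lf v I"
  by (simp add: J_fam_gens_def cocirc_gens_def prodf_def)

lemma J_ideal_fixed: "J_ideal bs (fixed_part X e) = J_fam ((!) X) (fixed_idx X e)"
proof -
  let ?Y = "fixed_part X e"
  have "J_ideal bs ?Y = idl (polys d) (cocirc_gens lf ((!) ?Y) {..<length ?Y})"
    unfolding J_ideal_def form_prod_def by (rule polys.idl_cocircuits) auto
  also have "cocirc_gens lf ((!) ?Y) {..<length ?Y} = cocirc_gens lf ((!) X) (fixed_idx X e)"
    by (rule cocirc_gens_transfer) (auto simp: mset_fixed_part)
  finally show ?thesis by (simp add: J_fam_def J_fam_gens_cocirc)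
qed

lemma P_fam_transfer:
  assumes "finite I" "finite K" "image_mset v (mset_set I) = image_mset w (mset_set K)"
  shows "P_fam v I = P_fam w K"
proof -
  have "{prodf v Z | Z. Z \<subseteq> I \<and> span (v ` (I - Z)) = UNIV} \<subseteq> {prodf w Z | Z. Z \<subseteq> K \<and> span (w ` (K - Z)) = UNIV}"
    if "finite I" "finite K" "image_mset v (mset_set I) = image_mset w (mset_set K)" for v w I K
  proof
    fix x assume "x \<in> {prodf v Z | Z. Z \<subseteq> I \<and> span (v ` (I - Z)) = UNIV}"
    then obtain Z where Z: "x = (\<Prod>i\<in>Z. lf (v i))" "Z \<subseteq> I" "span (v ` (I - Z)) = UNIV"
      unfolding prodf_def by blast
    note fam = family_transfer[OF that Z(2), of lf]
    obtain B where "B \<subseteq> K" "x = (\<Prod>i\<in>B. lf (w i))" "v ` (I - Z) = w ` (K - B)"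
      using fam Z(1) by auto
    then show "x \<in> {prodf w Z | Z. Z \<subseteq> K \<and> span (w ` (K - Z)) = UNIV}"
      unfolding prodf_def using Z(3) by (intro CollectI exI[of _ B]) simp
  qed
  from this[OF assms] this[OF assms(2,1) assms(3)[symmetric]] show ?thesis
    unfolding P_fam_def by (intro arg_cong[of _ _ cpm.span]) blast
qed

lemma P_space_fixed: "P_space bs (fixed_part X e) = P_fam ((!) X) (fixed_idx X e)"
proof -
  let ?Y = "fixed_part X e"
  have "P_space bs ?Y = P_fam ((!) ?Y) {..<length ?Y}"
    unfolding P_space_def P_fam_def form_prod_def prodf_def set_nths_compl
    by (intro arg_cong[of _ _ cpm.span] Collect_cong) (metis prod_list_nths)
  also have "\<dots> = P_fam ((!) X) (fixed_idx X e)"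
    by (rule P_fam_transfer) (auto simp: mset_fixed_part)
  finally show ?thesis .
qed

lemma D_space_fixed:
  "D_space bs (fixed_part X e) = {f \<in> polys d. \<forall>q\<in>J_fam ((!) X) (fixed_idx X e). pairing q f = 0}"
  unfolding D_space_def J_ideal_fixed J_fam_def
  using D_space_iff[OF J_fam_gens_polys] by blast

lemma vertices_iff: "e \<in> vertices \<Lambda> X \<longleftrightarrow> e \<in> torus \<Lambda> \<and> span ((!) X ` fixed_idx X e) = UNIV"
proof
  assume "e \<in> vertices \<Lambda> X"
  then obtain B where B: "e \<in> torus \<Lambda>" "B \<subseteq> set X" "span B = UNIV" "\<forall>b\<in>B. e b = 1"
    by (auto simp: vertices_def)
  have "B \<subseteq> (!) X ` fixed_idx X e"
  proof
    fix b assume "b \<in> B"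
    then obtain i where "i < length X" "X ! i = b" using B(2) by (metis in_set_conv_nth subsetD)
    then show "b \<in> (!) X ` fixed_idx X e" using B(4) \<open>b \<in> B\<close> by (auto simp: fixed_idx_def)
  qed
  then show "e \<in> torus \<Lambda> \<and> span ((!) X ` fixed_idx X e) = UNIV"
    using B span_mono by blast
next
  assume e: "e \<in> torus \<Lambda> \<and> span ((!) X ` fixed_idx X e) = UNIV"
  obtain B where B: "B \<subseteq> (!) X ` fixed_idx X e" "independent B" "(!) X ` fixed_idx X e \<subseteq> span B"
    using maximal_independent_subset by blast
  have "span ((!) X ` fixed_idx X e) \<subseteq> span B" by (rule span_minimal[OF B(3)]) simp
  then have "span B = UNIV" using e by (simp add: top.extremum_uniqueI)
  moreover have "B \<subseteq> set X" "\<forall>b\<in>B. e b = 1" using B(1) by (auto simp: fixed_idx_def)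
  ultimately show "e \<in> vertices \<Lambda> X" using e B(2) by (auto simp: vertices_def)
qed


subsection \<open>Functionals modulo the cocircuit ideal\<close>

lemma finite_monomials: "finite {m :: nat \<Rightarrow>\<^sub>0 nat. keys m \<subseteq> {..<n} \<and> mdeg m \<le> k}"
proof (rule finite_imageD)
  let ?f = "\<lambda>m :: nat \<Rightarrow>\<^sub>0 nat. restrict (lookup m) {..<n}"
  have "?f ` {m. keys m \<subseteq> {..<n} \<and> mdeg m \<le> k} \<subseteq> PiE {..<n} (\<lambda>_. {..k})"
  proof (rule image_subsetI)
    fix m :: "nat \<Rightarrow>\<^sub>0 nat" assume "m \<in> {m. keys m \<subseteq> {..<n} \<and> mdeg m \<le> k}"
    then have m: "keys m \<subseteq> {..<n}" "mdeg m \<le> k" by auto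
    have "lookup m i \<le> k" if "i < n" for i
      using member_le_sum[of i "{..<n}" "lookup m"] that m mdeg_superset[of "{..<n}" m] by simp
    then show "?f m \<in> PiE {..<n} (\<lambda>_. {..k})" by auto
  qed
  then show "finite (?f ` {m. keys m \<subseteq> {..<n} \<and> mdeg m \<le> k})"
    by (rule finite_subset) (intro finite_PiE, auto)
  show "inj_on ?f {m. keys m \<subseteq> {..<n} \<and> mdeg m \<le> k}"
  proof (rule inj_onI, rule poly_mapping_eqI)
    fix m m' :: "nat \<Rightarrow>\<^sub>0 nat" and i
    assume m: "m \<in> {m. keys m \<subseteq> {..<n} \<and> mdeg m \<le> k}" "m' \<in> {m. keys m \<subseteq> {..<n} \<and> mdeg m \<le> k}" "?f m = ?f m'"
    show "lookup m i = lookup m' i"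
    proof (cases "i < n")
      case True
      then show ?thesis using fun_cong[OF m(3), of i] by simp
    next
      case False
      then have "i \<notin> keys m" "i \<notin> keys m'" using m by auto
      then show ?thesis by (simp add: in_keys_iff)
    qed
  qed
qed

text \<open>A functional killing the ideal vanishes on monomials of degree above
  \<open>card I\<close>, so its values on the others assemble into a polynomial; dividing by
  \<open>mfact\<close> compensates the factorials in the pairing.\<close>

lemma functional_represented:
  fixes \<phi> :: "mpoly \<Rightarrow> complex"
  assumes fin: "finite I" and I: "span (v ` I) = UNIV"
    and add: "\<And>p q. p \<in> polys d \<Longrightarrow> q \<in> polys d \<Longrightarrow> \<phi> (p + q) = \<phi> p + \<phi> q"
    and scale: "\<And>c p. p \<in> polys d \<Longrightarrow> \<phi> (cscale c p) = c * \<phi> p"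
    and J: "\<And>q. q \<in> J_fam v I \<Longrightarrow> \<phi> q = 0"
  obtains f where "f \<in> polys d" "\<And>q. q \<in> polys d \<Longrightarrow> pairing q f = \<phi> q"
proof -
  let ?M = "{m. keys m \<subseteq> {..<d} \<and> mdeg m \<le> card I}"
  define f where "f = (\<Sum>m\<in>?M. single m (\<phi> (single m 1) / mfact m))"
  have f: "f \<in> polys d" unfolding f_def by (rule polys.sum_in) (auto intro: polys_single)
  have lf: "lookup f m = (if m \<in> ?M then \<phi> (single m 1) / mfact m else 0)" for m
    unfolding f_def lookup_sum lookup_single when_def
    using finite_monomials[of d "card I"] by (simp add: sum.delta')
  have mono: "pairing (single m c) f = \<phi> (single m c)" if m: "keys m \<subseteq> {..<d}" for m :: "nat \<Rightarrow>\<^sub>0 nat" and c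
  proof (cases "mdeg m \<le> card I")
    case True
    then have "pairing (single m c) f = c * \<phi> (single m 1)"
      using m by (simp add: pairing_single ncoef_def lf)
    also have "\<dots> = \<phi> (single m c)" using scale[OF polys_single[OF m, of 1], of c] by simp
    finally show ?thesis .
  next
    case False
    then have "single m c \<in> J_fam v I"
      by (intro mN_J_fam[OF fin I] polys_single m) (auto simp: mN_def)
    then show ?thesis using J False by (simp add: pairing_single ncoef_def lf)
  qed
  have "pairing q f = \<phi> q" if q: "q \<in> polys d" for q
  proof -
    have "pairing q f = \<phi> q \<and> q \<in> polys d"
      using q
    proof (rule mpoly_induct_span)
      show "pairing 0 f = \<phi> 0 \<and> 0 \<in> polys d" using J[OF J_fam_zero] by simp
      fix p q assume "pairing p f = \<phi> p \<and> p \<in> polys d" "pairing q f = \<phi> q \<and> q \<in> polys d"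
      then show "pairing (p + q) f = \<phi> (p + q) \<and> p + q \<in> polys d"
        by (auto simp: pairing_add add)
    next
      fix m :: "nat \<Rightarrow>\<^sub>0 nat" and c assume "keys m \<subseteq> {..<d}"
      then show "pairing (single m c) f = \<phi> (single m c) \<and> single m c \<in> polys d"
        using mono polys_single by blast
    qed
    then show ?thesis ..
  qed
  then show ?thesis using that f by blast
qed

end

section \<open>Algebraic tools for the discrete case\<close>

subsection \<open>Univariate polynomials\<close>

definition pev :: "complex poly \<Rightarrow> ('a::comm_monoid_add \<Rightarrow>\<^sub>0 complex) \<Rightarrow> ('a \<Rightarrow>\<^sub>0 complex)"
  where "pev p x = poly (map_poly (single 0) p) x"

lemma pev_pCons: "pev (pCons a p) x = single 0 a + x * pev p x"
  by (simp add: pev_def map_poly_pCons)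

lemma pev_0 [simp]: "pev 0 x = 0"
  by (simp add: pev_def)

lemma pev_1 [simp]: "pev 1 x = 1"
  by (simp add: one_pCons pev_pCons)

lemma pev_X [simp]: "pev [:0, 1:] x = x"
  by (simp add: pev_pCons)

lemma pev_add: "pev (p + q) x = pev p x + pev q x"
  by (induction p q rule: poly_induct2) (simp_all add: pev_pCons single_add algebra_simps)

lemma pev_smult: "pev (smult c p) x = cscale c (pev p x)"
  by (induction p) (simp_all add: pev_pCons cscale_def mult_single algebra_simps)

lemma pev_diff: "pev (p - q) x = pev p x - pev q x"
  using pev_add[of "p - q" q x] by simp

lemma pev_uminus: "pev (- p) x = - pev p x"
  using pev_diff[of 0 p x] by simp

lemma pev_mult: "pev (p * q) x = pev p x * pev q x"
  by (induction p) (simp_all add: pev_pCons pev_add pev_smult cscale_def algebra_simps)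

lemma pev_power: "pev (p ^ n) x = pev p x ^ n"
  by (induction n) (simp_all add: pev_mult)

lemma pev_sum: "pev (sum f A) x = (\<Sum>i\<in>A. pev (f i) x)"
  by (induction A rule: infinite_finite_induct) (simp_all add: pev_add)

lemma pev_pcompose: "pev (pcompose p q) x = pev p (pev q x)"
  by (induction p) (simp_all add: pcompose_pCons pev_add pev_mult pev_pCons)

lemma pev_monom: "pev (monom c k) x = cscale c (x ^ k)"
  by (induction k) (simp_all add: monom_0 monom_Suc pev_pCons cscale_def)

lemma pev_in:
  assumes "comm_subring R" "x \<in> R" "\<And>c. single 0 c \<in> R"
  shows "pev p x \<in> R"
proof -
  interpret comm_subring R by fact
  show ?thesis
  proof (induction p)
    case (pCons a p)
    show ?case unfolding pev_pCons by (intro add_in mult_in assms(2,3) pCons.IH)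
  qed simp
qed

lemma pev_polys: "x \<in> polys n \<Longrightarrow> pev p x \<in> polys n"
  by (rule pev_in[OF polys.comm_subring_axioms]) simp_all

lemma complex_poly_bezout:
  fixes p q :: "complex poly"
  assumes "coprime p q"
  obtains a b where "a * p + b * q = 1"
  using bezout_coefficients_fst_snd[of p q] assms by (metis coprime_iff_gcd_eq_1)

lemma coprime_linear_powers: "z \<noteq> w \<Longrightarrow> coprime ([:-z, 1:] ^ m) ([:-w, 1:] ^ n)" for z w :: complex
proof -
  assume "z \<noteq> w"
  have "smult (1 / (w - z)) [:-z, 1:] - smult (1 / (w - z)) [:-w, 1:] = smult (1 / (w - z)) [:w - z:]"
    unfolding smult_diff_right[symmetric] by simp
  also have "\<dots> = 1" using \<open>z \<noteq> w\<close> by (simp add: one_pCons)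
  finally have "smult (1 / (w - z)) [:-z, 1:] - smult (1 / (w - z)) [:-w, 1:] = 1" .
  then have "coprime [:-z, 1:] [:-w, 1:]"
    by (intro coprimeI) (metis dvd_diff dvd_smult)
  then show ?thesis by (simp add: coprime_power_left_iff coprime_power_right_iff)
qed

text \<open>Modulo the full product the \<open>u z\<close> act as orthogonal idempotents, one for
  each root. They come from a Bezout identity between the factor of a new root and the product of
  the old ones.\<close>

lemma partial_fractions:
  fixes A :: "complex set"
  assumes "finite A"
  shows "\<exists>u. (\<Sum>z\<in>A. u z) = (if A = {} then 0 else 1) \<and>
    (\<forall>z\<in>A. (\<Prod>w\<in>A - {z}. [:-w, 1:] ^ M) dvd (u z :: complex poly))"
  using assms
proof (induction A rule: finite_induct)
  case (insert w A)
  then obtain u where u: "(\<Sum>z\<in>A. u z) = (if A = {} then 0 else 1)"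
    "\<And>z. z \<in> A \<Longrightarrow> (\<Prod>w\<in>A - {z}. [:-w, 1:] ^ M) dvd u z" by blast
  let ?A = "\<Prod>z\<in>A. [:-z, 1:] ^ M" and ?B = "[:-w, 1:] ^ M"
  have "coprime ?A ?B"
  proof (rule prod_coprime_left)
    fix z assume "z \<in> A"
    then have "z \<noteq> w" using insert.hyps by auto
    then show "coprime ([:-z, 1:] ^ M) ?B" by (rule coprime_linear_powers)
  qed
  then obtain a b where ab: "a * ?A + b * ?B = 1" by (rule complex_poly_bezout)
  show ?case
  proof (cases "A = {}")
    case True
    then show ?thesis by (intro exI[of _ "\<lambda>_. 1"]) auto
  next
    case False
    \<comment> \<open>One summand of the Bezout identity serves the new root; the other, divisible
      by its factor, multiplies all the old solutions.\<close>
    define u' where "u' z = (if z = w then a * ?A else b * ?B * u z)" for z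
    have "(\<Sum>z\<in>insert w A. u' z) = a * ?A + b * ?B * (\<Sum>z\<in>A. u z)"
      using insert.hyps by (auto simp: u'_def sum_distrib_left intro!: sum.cong)
    then have "(\<Sum>z\<in>insert w A. u' z) = 1" using ab u(1) False by simp
    moreover have "(\<Prod>w\<in>insert w A - {z}. [:-w, 1:] ^ M) dvd u' z" if "z \<in> insert w A" for z
    proof (cases "z = w")
      case True
      then have "insert w A - {z} = A" using insert.hyps by auto
      then show ?thesis by (simp add: u'_def True)
    next
      case False
      then have "insert w A - {z} = insert w (A - {z})" by auto
      then have "(\<Prod>w\<in>insert w A - {z}. [:-w, 1:] ^ M) = ?B * (\<Prod>w\<in>A - {z}. [:-w, 1:] ^ M)"
        using insert.hyps by simp
      moreover have "\<dots> dvd ?B * u z" using u(2) False that by (intro mult_dvd_mono) auto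
      ultimately show ?thesis using False by (simp add: u'_def mult.assoc)
    qed
    ultimately show ?thesis by (intro exI[of _ u']) auto
  qed
qed simp

lemma complex_poly_dvd_roots:
  fixes F :: "complex poly"
  assumes "F \<noteq> 0" "degree F \<le> M"
  shows "F dvd (\<Prod>z | poly F z = 0. [:-z, 1:] ^ M)"
proof -
  have "F = smult (lead_coeff F) (\<Prod>z | poly F z = 0. [:-z, 1:] ^ Polynomial.order z F)"
    by (simp add: complex_poly_decompose)
  also have "\<dots> dvd (\<Prod>z | poly F z = 0. [:-z, 1:] ^ Polynomial.order z F)"
    using assms by (simp add: smult_dvd_iff)
  also have "\<dots> dvd (\<Prod>z | poly F z = 0. [:-z, 1:] ^ M)"
    by (rule prod_dvd_prod, rule le_imp_power_dvd) (use order_degree[OF assms(1)] assms(2) order_trans in blast)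
  finally show ?thesis .
qed


subsection \<open>Truncated exponential and logarithm\<close>

definition expo :: "nat \<Rightarrow> complex poly"
  where "expo N = (\<Sum>k<N. monom (inverse (fact k)) k)"

text \<open>The bound \<open>N \<ge> 2\<close> keeps the linear term, so \<open>exp x - 1\<close> is
  \<open>x\<close> times something invertible near 0, even after truncation.\<close>

lemma expo_split:
  assumes "N \<ge> 2"
  obtains w where "expo N - 1 = [:0, 1:] * w" "poly w 0 = 1"
proof -
  define w where "w = (\<Sum>k<N - 1. monom (inverse (fact (Suc k))) k :: complex poly)"
  obtain n where N: "N = Suc (Suc n)" using assms by (metis add_2_eq_Suc le_Suc_ex)
  have "expo N = monom 1 0 + (\<Sum>k<Suc n. monom (inverse (fact (Suc k))) (Suc k))"
    unfolding expo_def N by (subst sum.lessThan_Suc_shift) simp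
  also have "(\<Sum>k<Suc n. monom (inverse (fact (Suc k))) (Suc k)) = [:0, 1:] * w"
    unfolding w_def N by (simp add: sum_distrib_left monom_Suc del: sum.lessThan_Suc)
  finally have "expo N - 1 = [:0, 1:] * w" by (simp add: monom_0 one_pCons)
  moreover have "poly w 0 = 1"
    unfolding w_def N by (simp add: poly_sum poly_monom power_0_left sum.lessThan_Suc_shift del: sum.lessThan_Suc)
  ultimately show ?thesis using that by blast
qed

lemma pcompose_diff_dvd: "p - q dvd pcompose r p - pcompose r q" for p q r :: "complex poly"
proof (induction r)
  case (pCons a r)
  have "pcompose (pCons a r) p - pcompose (pCons a r) q = (p - q) * pcompose r p + q * (pcompose r p - pcompose r q)"
    by (simp add: pcompose_pCons algebra_simps)
  then show ?case using pCons.IH by simp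
qed simp

lemma X_dvd_iff: "[:0, 1:] dvd p \<longleftrightarrow> poly p 0 = 0" for p :: "complex poly"
  using poly_eq_0_iff_dvd[of p 0] by simp

lemma pcompose_power: "pcompose (p ^ n) q = pcompose p q ^ n" for p q :: "complex poly"
  by (induction n) (simp_all add: pcompose_mult one_pCons)

lemma coprime_X:
  fixes p :: "complex poly"
  assumes "poly p 0 \<noteq> 0"
  shows "coprime ([:0, 1:] ^ n) p"
proof -
  obtain a q where p: "p = pCons a q" by (cases p)
  then have "smult (1 / a) p - smult (1 / a) (q * [:0, 1:]) = smult (1 / a) [:a:]"
    unfolding smult_diff_right[symmetric] by simp
  then have *: "smult (1 / a) p - smult (1 / a) (q * [:0, 1:]) = 1"
    using assms p by (simp add: one_pCons)
  have "coprime [:0, 1:] p"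
    by (rule coprimeI) (metis * dvd_diff dvd_smult dvd_mult)
  then show ?thesis by (simp add: coprime_power_left_iff)
qed

text \<open>Substituting \<open>X\<close> times a unit preserves the order of vanishing at 0:
  factors \<open>X\<close> are stripped one at a time, and \<open>w\<close> is coprime to
  them.\<close>

lemma dvd_pcompose_unit:
  fixes w h :: "complex poly"
  assumes w: "poly w 0 = 1" and "[:0, 1:] ^ k dvd pcompose h ([:0, 1:] * w)"
  shows "[:0, 1:] ^ k dvd h"
  using assms(2)
proof (induction k arbitrary: h)
  case (Suc k)
  have "[:0, 1:] dvd pcompose h ([:0, 1:] * w)"
    by (rule dvd_trans[OF _ Suc.prems]) (simp only: power_Suc dvd_triv_left)
  then have "poly h 0 = 0" by (simp add: X_dvd_iff poly_pcompose)
  then obtain h1 where h: "h = [:0, 1:] * h1" unfolding X_dvd_iff[symmetric] by (elim dvdE)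
  have "pcompose h ([:0, 1:] * w) = [:0, 1:] * (w * pcompose h1 ([:0, 1:] * w))"
    by (simp add: h pcompose_mult pcompose_pCons mult.assoc)
  then have *: "[:0, 1:] ^ k dvd w * pcompose h1 ([:0, 1:] * w)"
    using Suc.prems by (simp only: power_Suc dvd_mult_cancel_left pCons_eq_0_iff) simp
  have "coprime ([:0, 1:] ^ k) w" by (rule coprime_X) (simp add: w)
  then have "[:0, 1:] ^ k dvd pcompose h1 ([:0, 1:] * w)"
    using * by (simp add: coprime_dvd_mult_right_iff)
  then have "[:0, 1:] ^ k dvd h1" by (rule Suc.IH)
  then show ?case unfolding h power_Suc by (rule mult_dvd_mono[OF dvd_refl])
qed simp

text \<open>The inverse series is built one order at a time: as \<open>(expo N - 1) ^ k\<close> is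
  \<open>X ^ k\<close> times a unit with value 1 at 0, adding the constant term of the current error
  quotient times \<open>X ^ k\<close> raises the order of the error.\<close>

lemma ex_truncated_log:
  assumes N: "N \<ge> 2"
  obtains l where "poly l 0 = 0" "[:0, 1:] ^ N dvd [:0, 1:] - pcompose l (expo N - 1)"
    "[:0, 1:] ^ N dvd [:1, 1:] - pcompose (expo N) l"
proof -
  obtain w where w: "expo N - 1 = [:0, 1:] * w" "poly w 0 = 1" using expo_split[OF N] .
  have "\<exists>l. [:0, 1:] ^ k dvd [:0, 1:] - pcompose l (expo N - 1)" for k
  proof (induction k)
    case (Suc k)
    then obtain l r where l: "[:0, 1:] - pcompose l (expo N - 1) = [:0, 1:] ^ k * r" by (auto elim: dvdE)
    let ?c = "poly r 0"
    have "[:0, 1:] - pcompose (l + smult ?c ([:0, 1:] ^ k)) (expo N - 1)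
        = [:0, 1:] - pcompose l (expo N - 1) - smult ?c ((expo N - 1) ^ k)"
      by (simp add: pcompose_add pcompose_smult pcompose_power pcompose_pCons)
    also have "\<dots> = [:0, 1:] ^ k * (r - smult ?c (w ^ k))"
      unfolding l unfolding w(1) power_mult_distrib by (simp only: right_diff_distrib mult_smult_right)
    finally have eq: "[:0, 1:] - pcompose (l + smult ?c ([:0, 1:] ^ k)) (expo N - 1) = [:0, 1:] ^ k * (r - smult ?c (w ^ k))" .
    have "poly (r - smult ?c (w ^ k)) 0 = 0" using w(2) by simp
    then have "[:0, 1:] dvd r - smult ?c (w ^ k)" unfolding X_dvd_iff .
    then have "[:0, 1:] ^ Suc k dvd [:0, 1:] - pcompose (l + smult ?c ([:0, 1:] ^ k)) (expo N - 1)"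
      unfolding eq power_Suc2 by (rule mult_dvd_mono[OF dvd_refl])
    then show ?case by blast
  qed simp
  then obtain l where l: "[:0, 1:] ^ N dvd [:0, 1:] - pcompose l (expo N - 1)" by blast
  have "[:0, 1:] dvd [:0, 1:] - pcompose l (expo N - 1)"
    by (rule dvd_trans[OF dvd_power l]) (use N in auto)
  then have "poly ([:0, 1:] - pcompose l (expo N - 1)) 0 = 0" unfolding X_dvd_iff .
  then have l0: "poly l 0 = 0" by (simp add: poly_pcompose w(1))
  \<comment> \<open>Substituting \<open>expo N - 1\<close> into \<open>?h\<close> reduces the second
    congruence to the first; \<open>dvd_pcompose_unit\<close> then undoes the substitution.\<close>
  let ?h = "[:1, 1:] - pcompose (expo N) l"
  have "pcompose ?h (expo N - 1) = pcompose (expo N) [:0, 1:] - pcompose (expo N) (pcompose l (expo N - 1))"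
    by (simp add: pcompose_diff pcompose_pCons pcompose_assoc one_pCons)
  moreover have "[:0, 1:] ^ N dvd \<dots>" by (rule dvd_trans[OF l pcompose_diff_dvd])
  ultimately have "[:0, 1:] ^ N dvd ?h" using dvd_pcompose_unit[OF w(2)] w(1) by simp
  then show ?thesis using that l0 l by blast
qed

lemma of_nat_cscale: "of_nat n * x = cscale (of_nat n) x"
  by (simp add: cscale_def)

lemma exp_term_add:
  fixes x y :: "'a::comm_monoid_add \<Rightarrow>\<^sub>0 complex"
  shows "cscale (inverse (fact k)) ((x + y) ^ k) =
    (\<Sum>i\<le>k. cscale (inverse (fact i)) (x ^ i) * cscale (inverse (fact (k - i))) (y ^ (k - i)))"
  unfolding binomial_ring cpm.scale_sum_right
proof (rule sum.cong[OF refl])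
  fix i assume "i \<in> {..k}"
  then have "inverse (fact k) * complex_of_nat (k choose i) = inverse (fact i) * inverse (fact (k - i))"
    by (simp add: binomial_fact field_simps)
  then show "cscale (inverse (fact k)) (of_nat (k choose i) * x ^ i * y ^ (k - i)) =
      cscale (inverse (fact i)) (x ^ i) * cscale (inverse (fact (k - i))) (y ^ (k - i))"
    by (simp add: of_nat_cscale mult.assoc)
qed

lemma pev_expo: "pev (expo N) x = (\<Sum>k<N. cscale (inverse (fact k)) (x ^ k))"
  by (simp add: expo_def pev_sum pev_monom)

text \<open>By the binomial theorem the terms with \<open>i + j < N\<close> agree on both sides. The
  product has only further terms with \<open>i + j \<ge> N\<close>, which have order at least
  \<open>N\<close>.\<close>

lemma expo_add_cong:
  assumes x: "x \<in> mN 1" and y: "y \<in> mN 1"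
  shows "pev (expo N) (x + y) - pev (expo N) x * pev (expo N) y \<in> mN N"
proof -
  define f where "f i j = cscale (inverse (fact i)) (x ^ i) * cscale (inverse (fact j)) (y ^ j)" for i j
  let ?T = "{(i, j). i + j < N}" and ?S = "{..<N} \<times> {..<N}"
  have TS: "?T \<subseteq> ?S" by auto
  have "pev (expo N) (x + y) = (\<Sum>k<N. \<Sum>i\<le>k. f i (k - i))"
    by (simp add: pev_expo exp_term_add f_def)
  also have "\<dots> = (\<Sum>(i, j)\<in>?T. f i j)" by (rule sum.triangle_reindex[symmetric])
  finally have 1: "pev (expo N) (x + y) = (\<Sum>(i, j)\<in>?T. f i j)" .
  have 2: "pev (expo N) x * pev (expo N) y = (\<Sum>(i, j)\<in>?S. f i j)"
    by (simp add: pev_expo sum_product sum.cartesian_product f_def)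
  have "(\<Sum>(i, j)\<in>?S. f i j) = (\<Sum>(i, j)\<in>?S - ?T. f i j) + (\<Sum>(i, j)\<in>?T. f i j)"
    by (rule sum.subset_diff[OF TS]) simp
  then have "pev (expo N) (x + y) - pev (expo N) x * pev (expo N) y = - (\<Sum>(i, j)\<in>?S - ?T. f i j)"
    unfolding 1 2 by simp
  also have "\<dots> \<in> mN N"
  proof (intro mN_uminus mN_sum)
    fix p assume "p \<in> ?S - ?T"
    then obtain i j where p: "p = (i, j)" "N \<le> i + j" by force
    have "f i j \<in> mN (i + j)"
      unfolding f_def by (intro mN_mult mN_cscale mN_power x y)
    then show "(case p of (i, j) \<Rightarrow> f i j) \<in> mN N" using p by (auto intro: mN_mono)
  qed
  finally show ?thesis .
qed

text \<open>\<open>p\<close> is coprime to \<open>X ^ N\<close>; its Bezout cofactor, evaluated at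
  \<open>x\<close>, is an inverse up to order \<open>N\<close>.\<close>

lemma pev_unit_mod:
  assumes "poly p 0 \<noteq> 0" "x \<in> mN 1" "x \<in> polys n"
  obtains w where "w \<in> polys n" "pev p x * w - 1 \<in> mN N"
proof -
  have "coprime p ([:0, 1:] ^ N)" using coprime_X[OF assms(1)] by (simp add: coprime_commute)
  then obtain a b where "a * p + b * [:0, 1:] ^ N = 1" by (rule complex_poly_bezout)
  then have "pev a x * pev p x + pev b x * x ^ N = 1"
    by (metis pev_add pev_mult pev_power pev_X pev_1)
  then have "pev p x * pev a x - 1 = - (pev b x * x ^ N)" by (simp add: algebra_simps)
  then show ?thesis
    using that[of "pev a x"] pev_polys[OF assms(3)] mN_power[OF assms(2)] by (simp add: mN_uminus mN_mult_left)
qed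


subsection \<open>Torsion modulo a sublattice of full rank\<close>

interpretation ratv: vector_space "\<lambda>(q::rat) (x::'u::real_vector). of_rat q *\<^sub>R x"
  by unfold_locales (simp_all add: algebra_simps of_rat_add of_rat_mult)

lemma ratv_independent:
  fixes B :: "'u::real_vector set"
  assumes "independent B"
  shows "ratv.independent B"
proof
  assume "ratv.dependent B"
  then obtain T u where T: "finite T" "T \<subseteq> B" "(\<Sum>v\<in>T. of_rat (u v) *\<^sub>R v) = 0" "\<exists>v\<in>T. u v \<noteq> (0::rat)"
    unfolding ratv.dependent_explicit by blast
  then obtain w where w: "w \<in> T" "u w \<noteq> 0" by blast
  have "(of_rat (u w) :: real) = 0"
    by (rule independentD[OF assms T(1,2,3) w(1)])
  then show False using w(2) by simp
qed

context lattice
begin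

lemma card_real_basis:
  fixes B :: "'u set"
  assumes "independent B" "span B = UNIV"
  shows "finite B \<and> card B = d"
proof -
  obtain f where "bij_betw f B (set bs)"
    using real_vector.bij_if_span_eq_span_bases[OF assms(1) independent_bs] assms(2) span_bs by auto
  then show ?thesis
    using bij_betw_finite bij_betw_same_card distinct_card[OF distinct_bs] by (metis List.finite_set)
qed

lemma ratv_span_bs: "a \<in> \<Lambda> \<Longrightarrow> a \<in> ratv.span (set bs)"
proof -
  assume a: "a \<in> \<Lambda>"
  have "(\<Sum>i<d. of_rat (of_int \<lfloor>coord bs a i\<rfloor>) *\<^sub>R bs ! i) \<in> ratv.span (set bs)"
    by (intro ratv.span_sum ratv.span_scale ratv.span_base) auto
  also have "(\<Sum>i<d. of_rat (of_int \<lfloor>coord bs a i\<rfloor>) *\<^sub>R bs ! i) = (\<Sum>i<d. coord bs a i *\<^sub>R bs ! i)"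
    using a by (intro sum.cong refl) (auto simp: mem_\<Lambda>_iff Ints_def)
  also have "\<dots> = a" by (rule coord_expansion[symmetric])
  finally show ?thesis .
qed

lemma subgroup_scale_nat:
  fixes G :: "'u set"
  assumes "0 \<in> G" "\<And>a b. a \<in> G \<Longrightarrow> b \<in> G \<Longrightarrow> a + b \<in> G" "x \<in> G"
  shows "real n *\<^sub>R x \<in> G"
  using assms by (induction n) (auto simp: algebra_simps)

lemma subgroup_scale_int:
  fixes G :: "'u set"
  assumes "0 \<in> G" "\<And>a b. a \<in> G \<Longrightarrow> b \<in> G \<Longrightarrow> a + b \<in> G" "\<And>a. a \<in> G \<Longrightarrow> - a \<in> G" "x \<in> G"
  shows "of_int k *\<^sub>R x \<in> G"
proof (cases k)
  case (nonneg n)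
  then show ?thesis using subgroup_scale_nat[OF assms(1,2,4), of n] by simp
next
  case (neg n)
  have "of_int k *\<^sub>R x = - (real (Suc n) *\<^sub>R x)" by (simp add: neg algebra_simps)
  then show ?thesis using assms(3)[OF subgroup_scale_nat[OF assms(1,2,4), of "Suc n"]] by simp
qed

text \<open>A real basis \<open>B\<close> inside \<open>S\<close> is independent over the rationals
  and has \<open>d\<close> elements, while the lattice lies in a rational space spanned by
  \<open>d\<close> vectors. So \<open>a\<close> is a rational combination of \<open>B\<close>, and
  clearing denominators puts a multiple of it into \<open>G\<close>.\<close>

lemma torsion:
  assumes G: "0 \<in> G" "\<And>a b. a \<in> G \<Longrightarrow> b \<in> G \<Longrightarrow> a + b \<in> G" "\<And>a. a \<in> G \<Longrightarrow> - a \<in> G"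
    and S: "S \<subseteq> G" "S \<subseteq> \<Lambda>" "span S = UNIV" and a: "a \<in> \<Lambda>"
  obtains n :: nat where "n > 0" "real n *\<^sub>R a \<in> G"
proof -
  define H where "H = {x. \<exists>n::nat. n > 0 \<and> real n *\<^sub>R x \<in> G}"
  obtain B where B: "B \<subseteq> S" "independent B" "S \<subseteq> span B"
    using maximal_independent_subset by blast
  have "span B = UNIV" using span_minimal[OF B(3)] S(3) by (simp add: top.extremum_uniqueI)
  then have card: "finite B" "card B = d" using card_real_basis[OF B(2)] by auto
  have indep: "ratv.independent B" by (rule ratv_independent[OF B(2)])
  have "a \<in> ratv.span B"
  proof (rule ccontr)
    assume "a \<notin> ratv.span B"
    then have "ratv.independent (insert a B)" "a \<notin> B" using indep ratv.span_base by (auto simp: ratv.independent_insert)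
    moreover have "insert a B \<subseteq> ratv.span (set bs)" using B S(2) a ratv_span_bs by auto
    ultimately have "card (insert a B) \<le> card (set bs)" using ratv.independent_span_bound by blast
    then show False using card \<open>a \<notin> B\<close> distinct_card[OF distinct_bs] by simp
  qed
  then have "a \<in> H"
  proof (induction rule: ratv.span_induct_alt)
    case base
    show ?case using G(1) by (auto simp: H_def intro: exI[of _ 1])
  next
    case (step q x y)
    then obtain n :: nat where n: "n > 0" "real n *\<^sub>R y \<in> G" by (auto simp: H_def)
    obtain k m where q: "quotient_of q = (k, m)" by (cases "quotient_of q")
    have m: "m > 0" "q = of_int k / of_int m" using quotient_of_denom_pos[OF q] quotient_of_div[OF q] by auto
    have eq: "of_rat q * real_of_int m = real_of_int k" using m by (simp add: of_rat_divide)
    have "real (nat m * n) *\<^sub>R (of_rat q *\<^sub>R x + y)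
        = of_int (int n * k) *\<^sub>R x + of_int m *\<^sub>R (real n *\<^sub>R y)"
    proof -
      have "real (nat m * n) * of_rat q = real n * (of_rat q * real_of_int m)" using m by simp
      then have "real (nat m * n) * of_rat q = of_int (int n * k)" unfolding eq by simp
      then show ?thesis using m by (simp add: scaleR_add_right)
    qed
    also have "\<dots> \<in> G"
      by (intro G(2) subgroup_scale_int G(1,3) n(2)) (use step(1) B(1) S(1) in auto)
    finally show ?case using n m by (auto simp: H_def intro!: exI[of _ "nat m * n"])
  qed
  then show ?thesis using that by (auto simp: H_def)
qed

end

section \<open>Local theory at a single character\<close>

subsection \<open>Local expansions at a character\<close>

definition cong_mN :: "nat \<Rightarrow> mpoly \<Rightarrow> mpoly \<Rightarrow> bool"
  where "cong_mN N f g \<longleftrightarrow> f - g \<in> mN N"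

lemma cong_mN_refl [simp]: "cong_mN N f f"
  by (simp add: cong_mN_def)

lemma cong_mN_sym: "cong_mN N f g \<Longrightarrow> cong_mN N g f"
  using mN_uminus[of "f - g" N] by (simp add: cong_mN_def)

lemma cong_mN_trans [trans]: "cong_mN N f g \<Longrightarrow> cong_mN N g h \<Longrightarrow> cong_mN N f h"
  using mN_add[of "f - g" N "g - h"] by (simp add: cong_mN_def)

lemma cong_mN_add: "cong_mN N f f' \<Longrightarrow> cong_mN N g g' \<Longrightarrow> cong_mN N (f + g) (f' + g')"
  using mN_add[of "f - f'" N "g - g'"] by (simp add: cong_mN_def algebra_simps)

lemma cong_mN_mult:
  assumes "cong_mN N f f'" "cong_mN N g g'"
  shows "cong_mN N (f * g) (f' * g')"
proof -
  have "f * g - f' * g' = f * (g - g') + (f - f') * g'" by (simp add: algebra_simps)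
  then show ?thesis using assms by (simp add: cong_mN_def mN_add mN_mult_left mN_mult_right)
qed

lemma cong_mN_mem: "cong_mN N f g \<Longrightarrow> M \<le> N \<Longrightarrow> g \<in> mN M \<Longrightarrow> f \<in> mN M"
  using mN_add[of "f - g" M g] mN_mono[of "f - g" N M] by (simp add: cong_mN_def)

lemma cong_mN_mono: "cong_mN N f g \<Longrightarrow> M \<le> N \<Longrightarrow> cong_mN M f g"
  unfolding cong_mN_def by (rule mN_mono)

lemma cong_mN_sum: "(\<And>i. i \<in> A \<Longrightarrow> cong_mN N (f i) (g i)) \<Longrightarrow> cong_mN N (sum f A) (sum g A)"
  by (induction A rule: infinite_finite_induct) (auto intro: cong_mN_add)

lemma polys_induct [consumes 1, case_names const Var add mult]:
  assumes "f \<in> polys n"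
    and const: "\<And>c. P (single 0 c)"
    and Var: "\<And>i. i < n \<Longrightarrow> P (Var i)"
    and add: "\<And>p q. p \<in> polys n \<Longrightarrow> q \<in> polys n \<Longrightarrow> P p \<Longrightarrow> P q \<Longrightarrow> P (p + q)"
    and mult: "\<And>p q. p \<in> polys n \<Longrightarrow> q \<in> polys n \<Longrightarrow> P p \<Longrightarrow> P q \<Longrightarrow> P (p * q)"
  shows "P f"
proof -
  have monomial: "P (single m c)" if "keys m \<subseteq> {..<n}" for m :: "nat \<Rightarrow>\<^sub>0 nat" and c
    using that
  proof (induction "mdeg m" arbitrary: m)
    case 0
    then show ?case using const mdeg_eq_0[of m] by simp
  next
    case (Suc k)
    then have "m \<noteq> 0" by auto
    then obtain i where i: "i \<in> keys m" by (metis all_not_in_conv keys_eq_empty)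
    define m' where "m' = m - single i 1"
    have mm: "m = m' + single i 1"
      unfolding m'_def using i
      by (intro poly_mapping_eqI) (auto simp: lookup_add minus_poly_mapping.rep_eq lookup_single when_def in_keys_iff)
    have "keys m' \<subseteq> keys m" by (auto simp: mm in_keys_iff lookup_add)
    then have sub: "keys m' \<subseteq> {..<n}" using Suc.prems by (rule subset_trans)
    have "mdeg m' = k" using Suc.hyps(2) by (simp add: mm mdeg_add)
    then have "P (single m' c)" using Suc.hyps(1) sub by blast
    moreover have "i < n" using i Suc.prems by auto
    ultimately have "P (single m' c * Var i)" by (intro mult polys_single sub polys_Var Var)
    then show ?case by (simp add: Var_def mult_single mm)
  qed
  have "f \<in> polys n \<and> P f"
    using assms(1)
  proof (rule mpoly_induct_span)
    show "0 \<in> polys n \<and> P 0" using const[of 0] by simp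
  qed (use monomial add polys_single in auto)
  then show ?thesis ..
qed

lemma pev_zero_arg: "pev p 0 = single 0 (poly p 0)"
  by (induction p) (simp_all add: pev_pCons)

lemma group_alg_iff: "g \<in> group_alg \<Lambda> \<longleftrightarrow> keys g \<subseteq> \<Lambda>"
  by (simp add: group_alg_def)

sublocale lattice \<subseteq> ga: comm_subring "group_alg \<Lambda>"
proof (unfold_locales, goal_cases)
  case (3 x y)
  then show ?case using keys_add[of x y] by (auto simp: group_alg_iff)
next
  case (4 x y)
  then show ?case using keys_mult[of x y] \<Lambda>_add by (auto simp: group_alg_iff subset_iff)
qed (auto simp: group_alg_iff)

context lattice
begin

lemma lf_mN_Suc [simp]: "lf u \<in> mN (Suc 0)"
  using lf_mN1 by simp

lemma single_ga: "a \<in> \<Lambda> \<Longrightarrow> single a c \<in> group_alg \<Lambda>"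
  by (simp add: group_alg_iff)

lemma const_ga [simp]: "single 0 c \<in> group_alg \<Lambda>"
  by (rule single_ga) simp

lemma cscale_ga: "g \<in> group_alg \<Lambda> \<Longrightarrow> cscale c g \<in> group_alg \<Lambda>"
  unfolding cscale_def by auto

lemma pev_ga: "x \<in> group_alg \<Lambda> \<Longrightarrow> pev p x \<in> group_alg \<Lambda>"
  by (rule pev_in[OF ga.comm_subring_axioms]) simp_all

lemma torus_add: "e \<in> torus \<Lambda> \<Longrightarrow> a \<in> \<Lambda> \<Longrightarrow> b \<in> \<Lambda> \<Longrightarrow> e (a + b) = e a * e b"
  by (simp add: torus_def)

lemma torus_norm: "e \<in> torus \<Lambda> \<Longrightarrow> a \<in> \<Lambda> \<Longrightarrow> norm (e a) = 1"
  by (auto simp: torus_def PiE_iff)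

lemma torus_nonzero: "e \<in> torus \<Lambda> \<Longrightarrow> a \<in> \<Lambda> \<Longrightarrow> e a \<noteq> 0"
  using torus_norm by fastforce

lemma torus_zero: "e \<in> torus \<Lambda> \<Longrightarrow> e 0 = 1"
  using torus_add[of e 0 0] torus_nonzero[of e 0] by simp

definition nabla :: "'u \<Rightarrow> 'u \<Rightarrow>\<^sub>0 complex"
  where "nabla a = 1 - single a 1"

lemma nabla_ga: "a \<in> \<Lambda> \<Longrightarrow> nabla a \<in> group_alg \<Lambda>"
  unfolding nabla_def by (intro ga.diff_in single_ga) auto

definition trunc_exp :: "nat \<Rightarrow> 'u \<Rightarrow> mpoly"
  where "trunc_exp N a = pev (expo N) (lf a)"

text \<open>
  Up to degree \<open>N\<close>, evaluation at \<open>a\<close> is the pairing with \<open>exp p\<^sub>a\<close>, so evaluating \<open>e f\<close> along \<open>g\<close> is the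
  pairing of \<open>Phi N e g\<close> with \<open>f\<close>. The inverse \<open>Psi N e\<close> sends \<open>s\<^sub>i\<close> to the logarithm of \<open>x\<^sub>i / e x\<^sub>i\<close>, where
  \<open>x\<^sub>i\<close> is the \<open>i\<close>-th basis vector.
\<close>

definition Phi :: "nat \<Rightarrow> 'u character \<Rightarrow> ('u \<Rightarrow>\<^sub>0 complex) \<Rightarrow> mpoly"
  where "Phi N e = lin (single 0) (\<lambda>a. cscale (e a) (trunc_exp N a))"

definition trunc_log :: "nat \<Rightarrow> complex poly"
  where "trunc_log N = (SOME l. poly l 0 = 0 \<and> [:0, 1:] ^ N dvd [:0, 1:] - pcompose l (expo N - 1) \<and>
    [:0, 1:] ^ N dvd [:1, 1:] - pcompose (expo N) l)"

text \<open>A local coordinate of the complex torus at \<open>e\<close>: the normalisation makes it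
  vanish there. An ideal is concentrated at \<open>e\<close> when it contains high powers of these
  elements.\<close>

definition local_var :: "'u character \<Rightarrow> nat \<Rightarrow> 'u \<Rightarrow>\<^sub>0 complex"
  where "local_var e i = cscale (inverse (e (bs ! i))) (single (bs ! i) 1) - 1"

definition Psi :: "nat \<Rightarrow> 'u character \<Rightarrow> mpoly \<Rightarrow> ('u \<Rightarrow>\<^sub>0 complex)"
  where "Psi N e = lin (single 0) (mon (\<lambda>i. pev (trunc_log N) (local_var e i)))"

lemma trunc_exp_polys: "trunc_exp N a \<in> polys d"
  unfolding trunc_exp_def by (rule pev_polys) simp

lemma trunc_exp_add: "cong_mN N (trunc_exp N (a + b)) (trunc_exp N a * trunc_exp N b)"
  unfolding cong_mN_def trunc_exp_def lf_add by (rule expo_add_cong) simp_all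

lemma Phi_add: "Phi N e (f + g) = Phi N e f + Phi N e g"
  and Phi_diff: "Phi N e (f - g) = Phi N e f - Phi N e g"
  and Phi_sum: "Phi N e (sum F A) = (\<Sum>i\<in>A. Phi N e (F i))"
  and Phi_zero [simp]: "Phi N e 0 = 0"
  and Phi_single: "Phi N e (single a c) = cscale (c * e a) (trunc_exp N a)"
  by (simp_all add: Phi_def lin_add lin_diff lin_sum cscale_def mult_single flip: mult.assoc)

lemma Phi_polys: "Phi N e g \<in> polys d"
  unfolding Phi_def lin_def by (intro polys.sum_in polys.mult_in polys_cscale trunc_exp_polys polys_const)

lemma Psi_add: "Psi N e (f + g) = Psi N e f + Psi N e g"
  and Psi_diff: "Psi N e (f - g) = Psi N e f - Psi N e g"
  and Psi_sum: "Psi N e (sum F A) = (\<Sum>i\<in>A. Psi N e (F i))"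
  and Psi_mult: "Psi N e (f * g) = Psi N e f * Psi N e g"
  and Psi_single: "Psi N e (single m c) = cscale c (mon (\<lambda>i. pev (trunc_log N) (local_var e i)) m)"
  and Psi_cscale: "Psi N e (cscale c f) = cscale c (Psi N e f)"
  by (simp_all add: Psi_def lin_add lin_diff lin_sum lin_cscale lin_mon_mult cscale_def)

lemma Psi_const [simp]: "Psi N e (single 0 c) = single 0 c"
  by (simp add: Psi_single cscale_def)

lemma Psi_1 [simp]: "Psi N e 1 = 1"
  using Psi_const[of N e 1] by simp

lemma Psi_0 [simp]: "Psi N e 0 = 0"
  using Psi_const[of N e 0] by simp

lemma Psi_Var: "Psi N e (Var i) = pev (trunc_log N) (local_var e i)"
  by (simp add: Var_def Psi_single cscale_def)

lemma Psi_pev: "Psi N e (pev p q) = pev p (Psi N e q)"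
  by (induction p) (simp_all add: pev_pCons Psi_add Psi_mult)

context
  fixes N :: nat and e :: "'u character"
  assumes N: "N \<ge> 2" and e: "e \<in> torus \<Lambda>"
begin

lemma trunc_log: "poly (trunc_log N) 0 = 0" "[:0, 1:] ^ N dvd [:0, 1:] - pcompose (trunc_log N) (expo N - 1)"
    "[:0, 1:] ^ N dvd [:1, 1:] - pcompose (expo N) (trunc_log N)"
proof -
  obtain l where "poly l 0 = 0" "[:0, 1:] ^ N dvd [:0, 1:] - pcompose l (expo N - 1)"
    "[:0, 1:] ^ N dvd [:1, 1:] - pcompose (expo N) l" using ex_truncated_log[OF N] .
  then have "poly l 0 = 0 \<and> [:0, 1:] ^ N dvd [:0, 1:] - pcompose l (expo N - 1) \<and>
    [:0, 1:] ^ N dvd [:1, 1:] - pcompose (expo N) l" by (intro conjI)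
  from someI[of "\<lambda>l. poly l 0 = 0 \<and> [:0, 1:] ^ N dvd [:0, 1:] - pcompose l (expo N - 1) \<and>
    [:0, 1:] ^ N dvd [:1, 1:] - pcompose (expo N) l", OF this, folded trunc_log_def]
  show "poly (trunc_log N) 0 = 0" "[:0, 1:] ^ N dvd [:0, 1:] - pcompose (trunc_log N) (expo N - 1)"
    "[:0, 1:] ^ N dvd [:1, 1:] - pcompose (expo N) (trunc_log N)" by simp_all
qed

lemma poly_expo_0: "poly (expo N) 0 = 1"
proof -
  obtain w where w: "expo N - 1 = [:0, 1:] * w" using expo_split[OF N] by blast
  have "poly (expo N - 1) 0 = 0" unfolding w by simp
  then show ?thesis by simp
qed

lemma trunc_exp_zero: "trunc_exp N 0 = 1"
  by (simp add: trunc_exp_def pev_zero_arg poly_expo_0)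

lemma Phi_const [simp]: "Phi N e (single 0 c) = single 0 c"
  by (simp add: Phi_single trunc_exp_zero torus_zero[OF e] cscale_def)

lemma Phi_one [simp]: "Phi N e 1 = 1"
  using Phi_const[of 1] by simp

lemma Phi_mult:
  assumes "f \<in> group_alg \<Lambda>" "g \<in> group_alg \<Lambda>"
  shows "cong_mN N (Phi N e (f * g)) (Phi N e f * Phi N e g)"
proof -
  let ?F = "\<lambda>a. cscale (e a) (trunc_exp N a)"
  have "Phi N e (f * g) = (\<Sum>a\<in>keys f. \<Sum>b\<in>keys g. single 0 (lookup f a) * single 0 (lookup g b) * ?F (a + b))"
    unfolding Phi_def by (rule lin_mult_sum) simp
  moreover have "Phi N e f * Phi N e g
      = (\<Sum>a\<in>keys f. \<Sum>b\<in>keys g. single 0 (lookup f a) * single 0 (lookup g b) * (?F a * ?F b))"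
    by (simp add: Phi_def lin_def sum_product mult_ac)
  moreover have "cong_mN N (\<Sum>a\<in>keys f. \<Sum>b\<in>keys g. single 0 (lookup f a) * single 0 (lookup g b) * ?F (a + b))
     (\<Sum>a\<in>keys f. \<Sum>b\<in>keys g. single 0 (lookup f a) * single 0 (lookup g b) * (?F a * ?F b))"
  proof (intro cong_mN_sum cong_mN_mult cong_mN_refl)
    fix a b assume "a \<in> keys f" "b \<in> keys g"
    then have "a \<in> \<Lambda>" "b \<in> \<Lambda>" using assms by (auto simp: group_alg_iff)
    then have "?F (a + b) - ?F a * ?F b = cscale (e a * e b) (trunc_exp N (a + b) - trunc_exp N a * trunc_exp N b)"
      by (simp add: torus_add[OF e] cpm.scale_right_diff_distrib mult.commute)
    then show "cong_mN N (?F (a + b)) (?F a * ?F b)"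
      using trunc_exp_add[of N a b] unfolding cong_mN_def by (simp add: mN_cscale)
  qed
  ultimately show ?thesis by simp
qed

lemma Phi_prod:
  assumes "\<And>i. i \<in> A \<Longrightarrow> g i \<in> group_alg \<Lambda>"
  shows "cong_mN N (Phi N e (prod g A)) (\<Prod>i\<in>A. Phi N e (g i))"
  using assms
proof (induction A rule: infinite_finite_induct)
  case (insert x F)
  have "cong_mN N (Phi N e (g x * prod g F)) (Phi N e (g x) * Phi N e (prod g F))"
    by (rule Phi_mult) (use insert.prems in \<open>auto intro: ga.prod_in\<close>)
  also have "cong_mN N \<dots> (Phi N e (g x) * (\<Prod>i\<in>F. Phi N e (g i)))"
    by (intro cong_mN_mult cong_mN_refl insert.IH insert.prems) auto
  finally show ?case using insert.hyps by simp
qed simp_all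

lemma Phi_power:
  assumes "g \<in> group_alg \<Lambda>"
  shows "cong_mN N (Phi N e (g ^ n)) (Phi N e g ^ n)"
  using Phi_prod[of "{..<n}" "\<lambda>_. g"] assms by simp

lemma Phi_pev:
  assumes "g \<in> group_alg \<Lambda>"
  shows "cong_mN N (Phi N e (pev p g)) (pev p (Phi N e g))"
proof (induction p)
  case (pCons a p)
  have "cong_mN N (Phi N e (g * pev p g)) (Phi N e g * Phi N e (pev p g))"
    by (rule Phi_mult) (use assms pev_ga in auto)
  also have "cong_mN N \<dots> (Phi N e g * pev p (Phi N e g))"
    by (intro cong_mN_mult cong_mN_refl pCons.IH)
  finally show ?case by (simp add: pev_pCons Phi_add cong_mN_add)
qed simp

lemma local_var_ga: "i < d \<Longrightarrow> local_var e i \<in> group_alg \<Lambda>"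
  unfolding local_var_def by (intro ga.diff_in cscale_ga single_ga \<Lambda>_bs) auto

lemma single_bs_local_var: "i < d \<Longrightarrow> single (bs ! i) 1 = cscale (e (bs ! i)) (1 + local_var e i)"
  using torus_nonzero[OF e \<Lambda>_bs] by (simp add: local_var_def)

lemma Phi_local_var: "i < d \<Longrightarrow> Phi N e (local_var e i) = trunc_exp N (bs ! i) - 1"
  using torus_nonzero[OF e \<Lambda>_bs] by (simp add: local_var_def Phi_diff Phi_single)

lemma Psi_ga: "q \<in> polys d \<Longrightarrow> Psi N e q \<in> group_alg \<Lambda>"
proof (induction rule: polys_induct)
  case (Var i)
  then show ?case unfolding Psi_Var by (intro pev_ga local_var_ga)
qed (auto simp: Psi_add Psi_mult)

lemma Phi_Psi: "q \<in> polys d \<Longrightarrow> cong_mN N (Phi N e (Psi N e q)) q"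
proof (induction rule: polys_induct)
  case (Var i)
  have "cong_mN N (Phi N e (Psi N e (Var i))) (pev (trunc_log N) (trunc_exp N (bs ! i) - 1))"
    using Phi_pev[OF local_var_ga[OF Var]] by (simp add: Psi_Var Phi_local_var[OF Var])
  also have "trunc_exp N (bs ! i) - 1 = pev (expo N - 1) (Var i)"
    by (simp add: trunc_exp_def lf_bs[OF Var] pev_diff)
  also have "pev (trunc_log N) \<dots> = pev (pcompose (trunc_log N) (expo N - 1)) (Var i)"
    by (simp add: pev_pcompose)
  also have "cong_mN N \<dots> (Var i)"
  proof -
    obtain r where "[:0, 1:] - pcompose (trunc_log N) (expo N - 1) = [:0, 1:] ^ N * r"
      using trunc_log(2) by (elim dvdE)
    then have "Var i - pev (pcompose (trunc_log N) (expo N - 1)) (Var i) = Var i ^ N * pev r (Var i)"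
      by (metis pev_diff pev_mult pev_power pev_X)
    moreover have "Var i \<in> mN 1" using lf_mN1[of "bs ! i"] by (simp add: lf_bs[OF Var])
    ultimately have "cong_mN N (Var i) (pev (pcompose (trunc_log N) (expo N - 1)) (Var i))"
      by (simp add: cong_mN_def mN_mult_right mN_power)
    then show ?thesis by (rule cong_mN_sym)
  qed
  finally show ?case .
next
  case (mult p q)
  have "cong_mN N (Phi N e (Psi N e p * Psi N e q)) (Phi N e (Psi N e p) * Phi N e (Psi N e q))"
    by (intro Phi_mult Psi_ga mult)
  also have "cong_mN N \<dots> (p * q)" by (intro cong_mN_mult mult)
  finally show ?case by (simp add: Psi_mult)
qed (simp_all add: Psi_add Phi_add cong_mN_add)

subsubsection \<open>Injectivity of the expansion\<close>

context
  fixes M :: nat and I :: "('u \<Rightarrow>\<^sub>0 complex) set"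
  assumes I_zero: "0 \<in> I" and I_add: "\<And>x y. x \<in> I \<Longrightarrow> y \<in> I \<Longrightarrow> x + y \<in> I"
    and I_mult: "\<And>r x. r \<in> group_alg \<Lambda> \<Longrightarrow> x \<in> I \<Longrightarrow> r * x \<in> I"
    and I_var: "\<And>i. i < d \<Longrightarrow> local_var e i ^ M \<in> I"
    and NM: "d * M < N" "M \<le> N"
begin

lemma I_uminus: "x \<in> I \<Longrightarrow> - x \<in> I"
  using I_mult[of "- 1" x] by auto

lemma I_diff: "x \<in> I \<Longrightarrow> y \<in> I \<Longrightarrow> x - y \<in> I"
  using I_add[of x "- y"] I_uminus by simp

lemma I_sum: "(\<And>i. i \<in> A \<Longrightarrow> f i \<in> I) \<Longrightarrow> sum f A \<in> I"
  by (induction A rule: infinite_finite_induct) (auto intro: I_zero I_add)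

lemma I_var_power: "i < d \<Longrightarrow> M \<le> n \<Longrightarrow> local_var e i ^ n \<in> I"
  using I_mult[OF ga.power_in[OF local_var_ga, of i "n - M"] I_var[of i]]
  by (simp flip: power_add)

text \<open>Pigeonhole: as \<open>d * M < N\<close>, a monomial of degree at least \<open>N\<close>
  has an exponent above \<open>M\<close>. The logarithm has no constant term, so the corresponding
  factor contains the \<open>M\<close>-th power of a local coordinate.\<close>

lemma Psi_mN:
  assumes "q \<in> polys d" "q \<in> mN N"
  shows "Psi N e q \<in> I"
  using assms(1)
proof (rule mpoly_induct_span)
  fix m c assume m: "keys m \<subseteq> {..<d}" "m \<in> keys q"
  have "\<exists>i<d. M < lookup m i"
  proof (rule ccontr)
    assume "\<not> ?thesis"
    then have "mdeg m \<le> (\<Sum>i<d. M)"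
      unfolding mdeg_superset[OF finite_lessThan m(1)] by (intro sum_mono) (meson lessThan_iff not_less)
    then show False using assms(2) m(2) NM by (auto simp: mN_def)
  qed
  then obtain i where i: "i < d" "M < lookup m i" by blast
  let ?p = "\<lambda>j. pev (trunc_log N) (local_var e j)"
  have pga: "?p j \<in> group_alg \<Lambda>" if "j < d" for j by (intro pev_ga local_var_ga that)
  obtain l where l: "trunc_log N = [:0, 1:] * l"
    using trunc_log(1) unfolding X_dvd_iff[symmetric] by (elim dvdE)
  have "?p i ^ lookup m i = pev l (local_var e i) ^ lookup m i * local_var e i ^ lookup m i"
    unfolding l pev_mult pev_X power_mult_distrib by (rule mult.commute)
  also have "\<dots> \<in> I"
    by (intro I_mult I_var_power ga.power_in pev_ga local_var_ga) (use i in auto)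
  finally have p: "?p i ^ lookup m i \<in> I" .
  have "mon ?p m = (\<Prod>j\<in>{..<d} - {i}. ?p j ^ lookup m j) * ?p i ^ lookup m i"
    unfolding mon_superset[OF finite_lessThan m(1)]
    using i(1) prod.remove[of "{..<d}" i "\<lambda>j. ?p j ^ lookup m j"] by (simp add: mult.commute)
  then have "Psi N e (single m c) = (single 0 c * (\<Prod>j\<in>{..<d} - {i}. ?p j ^ lookup m j)) * ?p i ^ lookup m i"
    unfolding Psi_single cscale_def by (simp only: mult.assoc)
  then show "Psi N e (single m c) \<in> I"
    using p by (simp only:) (intro I_mult ga.mult_in ga.prod_in ga.power_in pga const_ga p, auto)
qed (use I_zero I_add in \<open>auto simp: Psi_add\<close>)

text \<open>Both terms are multiplicative in \<open>a\<close> modulo \<open>I\<close>, so the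
  lattice points satisfying the claim form a subgroup. For a basis vector the claim says that the
  exponential inverts the logarithm up to order \<open>N\<close>.\<close>

lemma Psi_trunc_exp:
  assumes "a \<in> \<Lambda>"
  shows "single a 1 - cscale (e a) (Psi N e (trunc_exp N a)) \<in> I"
proof -
  define h where "h a = cscale (e a) (Psi N e (trunc_exp N a))" for a
  define G where "G = {a \<in> \<Lambda>. single a 1 - h a \<in> I}"
  have hga: "h a \<in> group_alg \<Lambda>" for a
    unfolding h_def by (intro cscale_ga Psi_ga trunc_exp_polys)
  have h_mult: "h (a + b) - h a * h b \<in> I" if "a \<in> \<Lambda>" "b \<in> \<Lambda>" for a b
  proof -
    have "h (a + b) = cscale (e a * e b) (Psi N e (trunc_exp N (a + b)))"
      by (simp add: h_def torus_add[OF e that])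
    moreover have "h a * h b = cscale (e a * e b) (Psi N e (trunc_exp N a * trunc_exp N b))"
      by (simp add: h_def Psi_mult mult.commute)
    ultimately have "h (a + b) - h a * h b = single 0 (e a * e b) * Psi N e (trunc_exp N (a + b) - trunc_exp N a * trunc_exp N b)"
      by (simp only: Psi_diff cpm.scale_right_diff_distrib flip: cscale_def)
    moreover have "Psi N e (trunc_exp N (a + b) - trunc_exp N a * trunc_exp N b) \<in> I"
      by (rule Psi_mN) (use trunc_exp_add[of N a b] in \<open>auto simp: cong_mN_def intro!: polys.diff_in polys.mult_in trunc_exp_polys\<close>)
    ultimately show ?thesis using I_mult by simp
  qed
  have h_zero: "h 0 = 1" by (simp add: h_def torus_zero[OF e] trunc_exp_zero)
  have G_zero: "0 \<in> G" by (simp add: G_def h_zero I_zero)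
  have G_add: "a + b \<in> G" if "a \<in> G" "b \<in> G" for a b
  proof -
    have "single (a + b) 1 - h (a + b) = single a 1 * (single b 1 - h b) + h b * (single a 1 - h a) - (h (a + b) - h a * h b)"
      by (simp add: mult_single algebra_simps)
    also have "\<dots> \<in> I"
      using that unfolding G_def
      by (intro I_diff[OF I_add[OF I_mult[OF single_ga] I_mult[OF hga]] h_mult]) auto
    finally show ?thesis using that \<Lambda>_add by (auto simp: G_def)
  qed
  have G_uminus: "- a \<in> G" if "a \<in> G" for a
  proof -
    have a: "a \<in> \<Lambda>" "- a \<in> \<Lambda>" "single a 1 - h a \<in> I" using that \<Lambda>_uminus by (auto simp: G_def)
    have "single (- a) 1 * single a 1 = (1 :: 'u \<Rightarrow>\<^sub>0 complex)" by (simp add: mult_single)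
    then have "single (- a) 1 - h (- a) = single (- a) 1 - single (- a) 1 * single a 1 * h (- a)" by simp
    also have "\<dots> = single (- a) 1 * ((h 0 - h a * h (- a)) - h (- a) * (single a 1 - h a))"
      by (simp add: h_zero algebra_simps)
    also have "\<dots> \<in> I"
      using h_mult[OF a(1,2)] by (intro I_mult[OF single_ga[OF a(2)] I_diff[OF _ I_mult[OF hga a(3)]]]) simp
    finally show ?thesis using a by (auto simp: G_def)
  qed
  have G_bs: "bs ! i \<in> G" if i: "i < d" for i
  proof -
    obtain r where "[:1, 1:] - pcompose (expo N) (trunc_log N) = [:0, 1:] ^ N * r"
      using trunc_log(3) by (elim dvdE)
    then have "pev [:1, 1:] (local_var e i) - pev (expo N) (pev (trunc_log N) (local_var e i))
        = local_var e i ^ N * pev r (local_var e i)"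
      by (metis pev_diff pev_mult pev_power pev_X pev_pcompose)
    then have eq: "1 + local_var e i - pev (expo N) (pev (trunc_log N) (local_var e i))
        = pev r (local_var e i) * local_var e i ^ N"
      by (simp add: pev_pCons mult.commute)
    have "single (bs ! i) 1 - h (bs ! i) = cscale (e (bs ! i)) (1 + local_var e i - pev (expo N) (pev (trunc_log N) (local_var e i)))"
      by (simp add: single_bs_local_var[OF i] h_def trunc_exp_def lf_bs[OF i] Psi_pev Psi_Var cpm.scale_right_diff_distrib)
    also have "\<dots> = single 0 (e (bs ! i)) * (pev r (local_var e i) * local_var e i ^ N)"
      unfolding eq cscale_def ..
    also have "\<dots> \<in> I"
      by (intro I_mult I_var_power pev_ga local_var_ga const_ga i NM)
    finally show ?thesis using \<Lambda>_bs[OF i] by (simp add: G_def)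
  qed
  have "(\<Sum>i\<in>A. of_int (k i) *\<^sub>R bs ! i) \<in> G" if "A \<subseteq> {..<d}" for A k
    using finite_subset[OF that finite_lessThan] that
    by (induction A rule: finite_induct)
      (auto intro!: G_zero G_add subgroup_scale_int[of G] G_uminus G_bs)
  then have "a \<in> G" using assms by (auto simp: \<Lambda>_eq)
  then show ?thesis by (simp add: G_def h_def)
qed

text \<open>Modulo \<open>I\<close>, \<open>g\<close> equals \<open>Psi N e (Phi N e g)\<close>, and
  \<open>Psi\<close> sends elements of order \<open>N\<close> into \<open>I\<close>. The ideal stays
  abstract because it will be the annihilator of an approximate idempotent modulo the cocircuit
  ideal.\<close>

lemma Phi_kernel:
  assumes g: "g \<in> group_alg \<Lambda>" "Phi N e g \<in> mN N"
  shows "g \<in> I"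
proof -
  have "g = (\<Sum>a\<in>keys g. single 0 (lookup g a) * single a 1)"
    by (subst pm_sum) (simp add: mult_single)
  moreover have "Psi N e (Phi N e g) = (\<Sum>a\<in>keys g. single 0 (lookup g a) * cscale (e a) (Psi N e (trunc_exp N a)))"
    unfolding Phi_def lin_def by (simp add: Psi_sum Psi_mult Psi_cscale)
  ultimately have "g - Psi N e (Phi N e g) = (\<Sum>a\<in>keys g. single 0 (lookup g a) * (single a 1 - cscale (e a) (Psi N e (trunc_exp N a))))"
    by (simp add: sum_subtractf right_diff_distrib)
  also have "\<dots> \<in> I"
    by (intro I_sum I_mult Psi_trunc_exp const_ga) (use g in \<open>auto simp: group_alg_iff\<close>)
  finally have "g - Psi N e (Phi N e g) \<in> I" .
  moreover have "Psi N e (Phi N e g) \<in> I" by (rule Psi_mN[OF Phi_polys g(2)])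
  ultimately show ?thesis using I_add by fastforce
qed

end


subsubsection \<open>Images of the cocircuit generators\<close>

lemma Phi_nabla:
  assumes "a \<in> \<Lambda>"
  shows "\<exists>u\<in>polys d. \<exists>w\<in>polys d. cong_mN N (u * w) 1 \<and> Phi N e (nabla a) = (if e a = 1 then lf a else 1) * u"
proof (cases "e a = 1")
  case True
  obtain w where w: "expo N - 1 = [:0, 1:] * w" "poly w 0 = 1" using expo_split[OF N] .
  have "Phi N e (nabla a) = - pev (expo N - 1) (lf a)"
    by (simp add: nabla_def Phi_diff Phi_single True trunc_exp_def pev_diff)
  also have "\<dots> = lf a * pev (- w) (lf a)"
    unfolding w(1) pev_mult pev_X pev_uminus by simp
  finally have eq: "Phi N e (nabla a) = lf a * pev (- w) (lf a)" .
  obtain u where "u \<in> polys d" "pev (- w) (lf a) * u - 1 \<in> mN N"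
    by (rule pev_unit_mod[of "- w" "lf a" d N]) (use w(2) in auto)
  then show ?thesis
    using eq True by (intro bexI[of _ "pev (- w) (lf a)"] bexI[of _ u]) (auto simp: cong_mN_def pev_polys)
next
  case False
  define p where "p = 1 - smult (e a) (expo N)"
  have "poly p 0 \<noteq> 0" using False by (simp add: p_def poly_expo_0)
  then obtain u where "u \<in> polys d" "pev p (lf a) * u - 1 \<in> mN N"
    by (rule pev_unit_mod[of p "lf a" d N]) auto
  moreover have "Phi N e (nabla a) = pev p (lf a)"
    by (simp add: nabla_def Phi_diff Phi_single trunc_exp_def p_def pev_diff pev_smult)
  ultimately show ?thesis
    using False by (intro bexI[of _ "pev p (lf a)"] bexI[of _ u]) (auto simp: cong_mN_def pev_polys)
qed

text \<open>The inverse \<open>w\<close> of the unit is kept because recovering a generator from its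
  expansion requires cancelling the unit.\<close>

lemma Phi_prod_nabla:
  assumes "finite C" "v ` C \<subseteq> \<Lambda>"
  shows "\<exists>u\<in>polys d. \<exists>w\<in>polys d. cong_mN N (u * w) 1 \<and>
    cong_mN N (Phi N e (\<Prod>i\<in>C. nabla (v i))) (prodf v {i\<in>C. e (v i) = 1} * u)"
  using assms
proof (induction C rule: finite_induct)
  case empty
  show ?case by (intro bexI[of _ 1]) (auto simp: prodf_def)
next
  case (insert y C)
  then obtain u w where u: "u \<in> polys d" "w \<in> polys d" "cong_mN N (u * w) 1"
    "cong_mN N (Phi N e (\<Prod>i\<in>C. nabla (v i))) (prodf v {i\<in>C. e (v i) = 1} * u)" by auto
  obtain u' w' where u': "u' \<in> polys d" "w' \<in> polys d" "cong_mN N (u' * w') 1"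
    "Phi N e (nabla (v y)) = (if e (v y) = 1 then lf (v y) else 1) * u'"
    using Phi_nabla[of "v y"] insert.prems by auto
  have "{i \<in> insert y C. e (v i) = 1} = (if e (v y) = 1 then insert y {i\<in>C. e (v i) = 1} else {i\<in>C. e (v i) = 1})"
    by auto
  then have pr: "prodf v {i \<in> insert y C. e (v i) = 1} = (if e (v y) = 1 then lf (v y) else 1) * prodf v {i\<in>C. e (v i) = 1}"
    using insert.hyps by (simp add: prodf_def)
  have "cong_mN N (Phi N e (nabla (v y) * (\<Prod>i\<in>C. nabla (v i)))) (Phi N e (nabla (v y)) * Phi N e (\<Prod>i\<in>C. nabla (v i)))"
    by (intro Phi_mult ga.prod_in nabla_ga) (use insert.prems in auto)
  also have "cong_mN N \<dots> (Phi N e (nabla (v y)) * (prodf v {i\<in>C. e (v i) = 1} * u))"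
    by (intro cong_mN_mult cong_mN_refl u)
  also have "\<dots> = prodf v {i \<in> insert y C. e (v i) = 1} * (u' * u)"
    unfolding pr u'(4) by (simp only: mult_ac)
  finally have "cong_mN N (Phi N e (\<Prod>i\<in>insert y C. nabla (v i))) (prodf v {i \<in> insert y C. e (v i) = 1} * (u' * u))"
    using insert.hyps by simp
  moreover have "cong_mN N ((u' * u) * (w' * w)) 1"
    using cong_mN_mult[OF u'(3) u(3)] by (simp add: mult_ac)
  ultimately show ?case using u u' by (intro bexI[of _ "u' * u"] bexI[of _ "w' * w"]) auto
qed

end

end

context lattice
begin

lemma lattice_induct:
  assumes "a \<in> \<Lambda>" "P 0" "\<And>i. i < d \<Longrightarrow> P (bs ! i)" "\<And>a b. P a \<Longrightarrow> P b \<Longrightarrow> P (a + b)" "\<And>a. P a \<Longrightarrow> P (- a)"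
  shows "P a"
proof -
  have "(\<Sum>i\<in>A. of_int (k i) *\<^sub>R bs ! i) \<in> Collect P" if "A \<subseteq> {..<d}" for A and k :: "nat \<Rightarrow> int"
    using finite_subset[OF that finite_lessThan] that
  proof (induction A rule: finite_induct)
    case (insert i A)
    have "of_int (k i) *\<^sub>R bs ! i \<in> Collect P"
      by (rule subgroup_scale_int) (use assms insert.prems in auto)
    then show ?case using insert assms(4) by auto
  qed (use assms in auto)
  then show ?thesis using assms(1) by (auto simp: \<Lambda>_eq)
qed

lemma torus_eqI:
  assumes "e \<in> torus \<Lambda>" "e' \<in> torus \<Lambda>" "\<And>i. i < d \<Longrightarrow> e (bs ! i) = e' (bs ! i)"
  shows "e = e'"
proof (rule extensionalityI[of _ \<Lambda>])
  fix a assume "a \<in> \<Lambda>"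
  then have "a \<in> \<Lambda> \<and> e a = e' a"
  proof (rule lattice_induct)
    fix a assume a: "a \<in> \<Lambda> \<and> e a = e' a"
    then have "e a * e (- a) = e a * e' (- a)"
      using torus_add[OF assms(1), of a "- a"] torus_add[OF assms(2), of a "- a"] \<Lambda>_uminus[of a]
        torus_zero[OF assms(1)] torus_zero[OF assms(2)] by simp
    then show "- a \<in> \<Lambda> \<and> e (- a) = e' (- a)"
      using a torus_nonzero[OF assms(1), of a] \<Lambda>_uminus[of a] by auto
  qed (use assms(3) in \<open>auto simp: \<Lambda>_bs \<Lambda>_add torus_add[OF assms(1)] torus_add[OF assms(2)]
      torus_zero[OF assms(1)] torus_zero[OF assms(2)]\<close>)
  then show "e a = e' a" ..
qed (use assms in \<open>auto simp: torus_def PiE_iff\<close>)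

text \<open>The character with prescribed values on the basis. On lattice points the floor is exact,
  coordinates being integers, and \<open>powi\<close> covers negative ones.\<close>

definition char_of :: "(nat \<Rightarrow> complex) \<Rightarrow> 'u character"
  where "char_of \<zeta> = (\<lambda>a\<in>\<Lambda>. \<Prod>i<d. \<zeta> i powi \<lfloor>coord bs a i\<rfloor>)"

lemma char_of_torus:
  assumes "\<And>i. i < d \<Longrightarrow> norm (\<zeta> i) = 1"
  shows "char_of \<zeta> \<in> torus \<Lambda>"
proof -
  have nz: "\<zeta> i \<noteq> 0" if "i < d" for i using assms[OF that] by auto
  have "char_of \<zeta> (a + b) = char_of \<zeta> a * char_of \<zeta> b" if "a \<in> \<Lambda>" "b \<in> \<Lambda>" for a b
  proof -
    have "\<zeta> i powi \<lfloor>coord bs (a + b) i\<rfloor> = \<zeta> i powi \<lfloor>coord bs a i\<rfloor> * \<zeta> i powi \<lfloor>coord bs b i\<rfloor>" if "i < d" for i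
    proof -
      have "coord bs a i \<in> \<int>" "coord bs b i \<in> \<int>"
        using \<open>a \<in> \<Lambda>\<close> \<open>b \<in> \<Lambda>\<close> that by (simp_all add: mem_\<Lambda>_iff)
      then obtain k l where "coord bs a i = of_int k" "coord bs b i = of_int l"
        by (elim Ints_cases)
      then show ?thesis using nz[OF that]
        by (simp add: coord_add power_int_add flip: of_int_add)
    qed
    then show ?thesis using that \<Lambda>_add by (simp add: char_of_def flip: prod.distrib)
  qed
  moreover have "norm (char_of \<zeta> a) = 1" if "a \<in> \<Lambda>" for a
    using that assms by (simp add: char_of_def norm_power_int flip: prod_norm)
  ultimately show ?thesis by (auto simp: torus_def PiE_iff char_of_def)
qed

lemma char_of_bs: "i < d \<Longrightarrow> char_of \<zeta> (bs ! i) = \<zeta> i"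
proof -
  assume i: "i < d"
  have "char_of \<zeta> (bs ! i) = (\<Prod>j<d. if j = i then \<zeta> i else 1)"
    unfolding char_of_def restrict_apply'[OF \<Lambda>_bs[OF i]]
    by (rule prod.cong) (use i in \<open>auto simp: coord_bs\<close>)
  then show ?thesis using i by simp
qed

definition nabla_ideal :: "(nat \<Rightarrow> 'u) \<Rightarrow> nat set \<Rightarrow> ('u \<Rightarrow>\<^sub>0 complex) set"
  where "nabla_ideal v I = idl (group_alg \<Lambda>) (cocirc_gens nabla v I)"

context
  fixes v :: "nat \<Rightarrow> 'u" and I :: "nat set"
  assumes fin: "finite I" and v: "v ` I \<subseteq> \<Lambda>"
begin

lemma nabla_ideal_gens_ga: "cocirc_gens nabla v I \<subseteq> group_alg \<Lambda>"
proof
  fix x assume "x \<in> cocirc_gens nabla v I"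
  then obtain C where "x = (\<Prod>i\<in>C. nabla (v i))" "C \<subseteq> I" unfolding cocirc_gens_def by blast
  then show "x \<in> group_alg \<Lambda>" using v by (auto intro!: ga.prod_in nabla_ga)
qed

lemmas nabla_ideal_zero = ga.idl_zero[OF nabla_ideal_gens_ga, folded nabla_ideal_def]
  and nabla_ideal_add = ga.idl_add[OF nabla_ideal_gens_ga, folded nabla_ideal_def]
  and nabla_ideal_diff = ga.idl_diff[OF nabla_ideal_gens_ga, folded nabla_ideal_def]
  and nabla_ideal_mult = ga.idl_mult[OF nabla_ideal_gens_ga, folded nabla_ideal_def]
  and nabla_ideal_sum = ga.idl_sum[OF nabla_ideal_gens_ga, folded nabla_ideal_def]
  and nabla_ideal_ga = ga.idl_in[OF nabla_ideal_gens_ga, folded nabla_ideal_def]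
  and nabla_ideal_ideal = ga.ideal_idl[OF nabla_ideal_gens_ga, folded nabla_ideal_def]

lemma nabla_ideal_gen: "C \<subseteq> I \<Longrightarrow> span (v ` (I - C)) \<noteq> UNIV \<Longrightarrow> (\<Prod>i\<in>C. nabla (v i)) \<in> nabla_ideal v I"
  unfolding nabla_ideal_def by (rule ga.idl_gen[OF nabla_ideal_gens_ga cocirc_gensI])

context
  fixes N :: nat and e :: "'u character" and K :: "nat set"
  assumes N: "N \<ge> 2" and e: "e \<in> torus \<Lambda>" and K_def: "K = {i \<in> I. e (v i) = 1}"
begin

lemma finK: "finite K"
  using fin by (simp add: K_def)

text \<open>A cocircuit product expands to a unit times the product of its fixed forms. The fixed
  indices outside \<open>C\<close> lie in its non-spanning complement, so that product is in the
  ideal; errors of order \<open>N > card K\<close> are absorbed by \<open>mN_J_fam\<close>.\<close>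

lemma Phi_Jn:
  assumes K: "span (v ` K) = UNIV" "card K < N" and g: "g \<in> nabla_ideal v I"
  shows "Phi N e g \<in> J_fam v K"
proof -
  have mN: "q \<in> J_fam v K" if "q \<in> polys d" "q \<in> mN N" for q
    by (rule mN_J_fam[OF finK K(1) that(1)]) (rule mN_mono[OF that(2)], use K(2) in simp)
  have cgJ: "p \<in> J_fam v K" if "cong_mN N p q" "p \<in> polys d" "q \<in> J_fam v K" for p q
  proof -
    have "p - q \<in> J_fam v K"
      by (rule mN) (use that J_fam_polys in \<open>auto simp: cong_mN_def\<close>)
    from J_fam_add[OF this that(3)] show ?thesis by simp
  qed
  from nabla_ideal_gens_ga g[unfolded nabla_ideal_def] show ?thesis
  proof (induction rule: ga.ideal_induct)
    case zero
    show ?case by (simp add: J_fam_zero)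
  next
    case (gen s)
    then obtain C where C: "s = (\<Prod>i\<in>C. nabla (v i))" "C \<subseteq> I" "span (v ` (I - C)) \<noteq> UNIV"
      unfolding cocirc_gens_def by blast
    let ?C = "{i \<in> C. e (v i) = 1}"
    have "finite C" "v ` C \<subseteq> \<Lambda>" using C(2) fin v finite_subset by auto
    then obtain u where u: "u \<in> polys d" "cong_mN N (Phi N e s) (prodf v ?C * u)"
      using Phi_prod_nabla[OF N e, of C v] unfolding C(1) by blast
    have "?C \<subseteq> K" using C(2) by (auto simp: K_def)
    moreover have "span (v ` (K - ?C)) \<noteq> UNIV"
    proof
      assume "span (v ` (K - ?C)) = UNIV"
      moreover have "K - ?C \<subseteq> I - C" by (auto simp: K_def)
      ultimately have "UNIV \<subseteq> span (v ` (I - C))" using span_mono[OF image_mono] by metis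
      then show False using C(3) by (simp add: top.extremum_unique)
    qed
    ultimately have "prodf v ?C \<in> J_fam v K" by (rule J_fam_gen)
    then have "prodf v ?C * u \<in> J_fam v K" by (subst mult.commute) (rule J_fam_mult[OF u(1)])
    then show ?case by (rule cgJ[OF u(2) Phi_polys])
  next
    case (add x y)
    then show ?case by (simp add: Phi_add J_fam_add)
  next
    case (mult r x)
    have "Phi N e r * Phi N e x \<in> J_fam v K" by (rule J_fam_mult[OF Phi_polys mult(3)])
    then show ?case by (rule cgJ[OF Phi_mult[OF N e mult(1,2)] Phi_polys])
  qed
qed

text \<open>Enlarge \<open>C'\<close> by all moved indices: they contribute only units, and
  \<open>I - C = K - C'\<close> still fails to span. The unit is cancelled by lifting its inverse
  with \<open>Psi\<close>. The lemma is applied to every candidate point of the support, not just to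
  vertices.\<close>

lemma J_fam_Phi:
  assumes "q \<in> J_fam v K"
  shows "\<exists>j\<in>nabla_ideal v I. cong_mN N q (Phi N e j)"
  using J_fam_gens_polys assms[unfolded J_fam_def]
proof (induction rule: polys.ideal_induct)
  case zero
  show ?case by (rule bexI[of _ 0]) (simp_all add: nabla_ideal_zero)
next
  case (gen s)
  then obtain C' where C': "s = prodf v C'" "C' \<subseteq> K" "span (v ` (K - C')) \<noteq> UNIV"
    unfolding J_fam_gens_def by blast
  define C where "C = C' \<union> (I - K)"
  have KI: "K \<subseteq> I" by (auto simp: K_def)
  have eqs: "I - C = K - C'" "{i \<in> C. e (v i) = 1} = C'" "C \<subseteq> I"
    using C'(2) KI by (auto simp: C_def K_def)
  have "finite C" "v ` C \<subseteq> \<Lambda>" using eqs(3) fin v finite_subset by auto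
  then obtain u w where u: "u \<in> polys d" "w \<in> polys d" "cong_mN N (u * w) 1"
    "cong_mN N (Phi N e (\<Prod>i\<in>C. nabla (v i))) (s * u)"
    using Phi_prod_nabla[OF N e, of C v] unfolding eqs(2) C'(1) by blast
  have gen: "(\<Prod>i\<in>C. nabla (v i)) \<in> nabla_ideal v I"
    by (rule nabla_ideal_gen[OF eqs(3)]) (simp add: eqs(1) C'(3))
  have "cong_mN N (Phi N e (Psi N e w * (\<Prod>i\<in>C. nabla (v i)))) (Phi N e (Psi N e w) * Phi N e (\<Prod>i\<in>C. nabla (v i)))"
    by (intro Phi_mult[OF N e] Psi_ga[OF N e] u nabla_ideal_ga gen)
  also have "cong_mN N \<dots> (w * (s * u))"
    by (intro cong_mN_mult Phi_Psi[OF N e] u)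
  also have "w * (s * u) = s * (u * w)" by (simp only: mult_ac)
  also have "cong_mN N \<dots> (s * 1)" by (intro cong_mN_mult cong_mN_refl u)
  finally have "cong_mN N s (Phi N e (Psi N e w * (\<Prod>i\<in>C. nabla (v i))))" by (simp add: cong_mN_sym)
  then show ?case using nabla_ideal_mult[OF Psi_ga[OF N e u(2)] gen] by blast
next
  case (add x y)
  then obtain j k where "j \<in> nabla_ideal v I" "cong_mN N x (Phi N e j)" "k \<in> nabla_ideal v I" "cong_mN N y (Phi N e k)" by blast
  then show ?case by (intro bexI[of _ "j + k"]) (auto simp: Phi_add intro: cong_mN_add nabla_ideal_add)
next
  case (mult r x)
  then obtain j where j: "j \<in> nabla_ideal v I" "cong_mN N x (Phi N e j)" by blast
  have "cong_mN N (Phi N e (Psi N e r * j)) (Phi N e (Psi N e r) * Phi N e j)"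
    by (intro Phi_mult[OF N e] Psi_ga[OF N e] mult nabla_ideal_ga j)
  also have "cong_mN N \<dots> (r * x)"
    by (intro cong_mN_mult Phi_Psi[OF N e] mult cong_mN_sym[OF j(2)])
  finally have "cong_mN N (r * x) (Phi N e (Psi N e r * j))" by (rule cong_mN_sym)
  then show ?case using nabla_ideal_mult[OF Psi_ga[OF N e mult(1)] j(1)] by (rule bexI)
qed

text \<open>Evaluation at \<open>e\<close> kills every generator: the fixed vectors span, so each
  \<open>C\<close> contains a fixed index, with factor \<open>1 - e (v i) = 0\<close>. It also sends
  \<open>pev F (single a 1)\<close> to \<open>poly F (e a)\<close>.\<close>

lemma char_root:
  assumes K: "span (v ` K) = UNIV" and a: "a \<in> \<Lambda>" and F: "pev F (single a 1) \<in> nabla_ideal v I"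
  shows "poly F (e a) = 0"
proof -
  let ?\<chi> = "lin (\<lambda>c. c) e"
  have mult: "?\<chi> (f * g) = ?\<chi> f * ?\<chi> g" if "f \<in> group_alg \<Lambda>" "g \<in> group_alg \<Lambda>" for f g
    by (rule lin_mult[of _ _ \<Lambda>]) (use that torus_add[OF e] in \<open>auto simp: group_alg_iff\<close>)
  have add: "?\<chi> (f + g) = ?\<chi> f + ?\<chi> g" "?\<chi> (f - g) = ?\<chi> f - ?\<chi> g" for f g
    by (simp_all add: lin_add lin_diff)
  have pev: "?\<chi> (pev p (single a 1)) = poly p (e a)" for p
  proof (induction p)
    case (pCons b p)
    then show ?case
      by (simp add: pev_pCons add mult single_ga pev_ga a torus_zero[OF e])
  qed simp
  have chi1: "?\<chi> 1 = 1"
    using lin_single[OF scalar_hom_id, of e 0 1] torus_zero[OF e] by simp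
  have prod: "?\<chi> (\<Prod>i\<in>C. nabla (v i)) = (\<Prod>i\<in>C. 1 - e (v i))" if "C \<subseteq> I" for C
    using finite_subset[OF that fin] that
  proof (induction C rule: finite_induct)
    case empty
    show ?case by (simp add: chi1)
  next
    case (insert i C)
    have "?\<chi> (nabla (v i)) = 1 - e (v i)" by (simp add: nabla_def add chi1)
    moreover have "?\<chi> (nabla (v i) * (\<Prod>i\<in>C. nabla (v i))) = ?\<chi> (nabla (v i)) * ?\<chi> (\<Prod>i\<in>C. nabla (v i))"
      by (intro mult ga.prod_in nabla_ga) (use insert.prems v in auto)
    ultimately show ?case using insert by simp
  qed
  have "?\<chi> g = 0" if "g \<in> nabla_ideal v I" for g
    using nabla_ideal_gens_ga that[unfolded nabla_ideal_def]
  proof (induction rule: ga.ideal_induct)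
    case (gen s)
    then obtain C where C: "s = (\<Prod>i\<in>C. nabla (v i))" "C \<subseteq> I" "span (v ` (I - C)) \<noteq> UNIV"
      unfolding cocirc_gens_def by blast
    have "\<not> K \<subseteq> I - C"
    proof
      assume "K \<subseteq> I - C"
      then have "UNIV \<subseteq> span (v ` (I - C))" using span_mono[OF image_mono] K by metis
      then show False using C(3) by (simp add: top.extremum_unique)
    qed
    then obtain i where "i \<in> C" "e (v i) = 1" by (auto simp: K_def)
    moreover have "finite C" using C(2) fin finite_subset by blast
    ultimately show ?case unfolding C(1) prod[OF C(2)] by (simp add: prod_zero_iff) blast
  qed (auto simp: add mult)
  then show ?thesis using F pev by metis
qed

end

end


section \<open>Support of the discrete quotient and gluing\<close>

subsection \<open>Finiteness of the vertices\<close>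

text \<open>The relations \<open>nabla (v s)\<close> divide the lattice by the subgroup generated by
  the contracted vectors, so no quotient lattice has to be formed.\<close>

definition rel_ideal :: "(nat \<Rightarrow> 'u) \<Rightarrow> nat set \<Rightarrow> nat set \<Rightarrow> ('u \<Rightarrow>\<^sub>0 complex) set"
  where "rel_ideal v S I = idl (group_alg \<Lambda>)
    ({\<Prod>i\<in>C. nabla (v i) | C. C \<subseteq> I \<and> span (v ` (S \<union> (I - C))) \<noteq> UNIV} \<union> (\<lambda>s. nabla (v s)) ` S)"

text \<open>Deletion and contraction, now multiplicatively: the polynomial is the product of those
  for the contraction and the deletion of \<open>y\<close>, so its roots keep modulus one. With no
  index left, the contracted vectors generate a sublattice of full rank, and torsion gives the
  polynomial \<open>1 - X ^ n\<close>.\<close>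

lemma annihilating_poly:
  assumes "finite I" "v ` (S \<union> I) \<subseteq> \<Lambda>" "span (v ` (S \<union> I)) = UNIV" and a: "a \<in> \<Lambda>"
  shows "\<exists>F. F \<noteq> 0 \<and> (\<forall>z. poly F z = 0 \<longrightarrow> norm z = 1) \<and> pev F (single a 1) \<in> rel_ideal v S I"
  using assms(1-3)
proof (induction I arbitrary: S rule: finite_induct)
  case empty
  let ?G = "{\<Prod>i\<in>C. nabla (v i) | C. C \<subseteq> {} \<and> span (v ` (S \<union> ({} - C))) \<noteq> UNIV} \<union> (\<lambda>s. nabla (v s)) ` S"
  have G: "?G \<subseteq> group_alg \<Lambda>" using empty by (auto intro: nabla_ga)
  let ?H = "{x \<in> \<Lambda>. nabla x \<in> rel_ideal v S {}}"
  have add: "nabla (x + y) = nabla x + single x 1 * nabla y" for x y :: 'u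
    by (simp add: nabla_def algebra_simps mult_single)
  have uminus: "nabla (- x) = - (single (- x) 1 * nabla x)" for x :: 'u
    by (simp add: nabla_def algebra_simps mult_single)
  obtain n :: nat where n: "n > 0" "real n *\<^sub>R a \<in> ?H"
  proof (rule torsion[of ?H "v ` S" a])
    show "0 \<in> ?H" using ga.idl_zero[OF G] by (simp add: nabla_def rel_ideal_def)
    show "x + y \<in> ?H" if "x \<in> ?H" "y \<in> ?H" for x y
      using that ga.idl_add[OF G _ ga.idl_mult[OF G single_ga]] \<Lambda>_add by (auto simp: add rel_ideal_def)
    show "- x \<in> ?H" if "x \<in> ?H" for x
      using that ga.idl_uminus[OF G ga.idl_mult[OF G single_ga]] \<Lambda>_uminus by (auto simp: uminus rel_ideal_def)
    show "v ` S \<subseteq> ?H" using ga.idl_gen[OF G] empty by (auto simp: rel_ideal_def)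
  qed (use empty a in auto)
  define F :: "complex poly" where "F = 1 - monom 1 n"
  have "poly F 0 = 1" using n by (simp add: F_def poly_monom power_0_left)
  then have "F \<noteq> 0" by auto
  moreover have "norm z = 1" if "poly F z = 0" for z
  proof -
    have "z ^ n = 1" using that by (simp add: F_def poly_monom)
    then show ?thesis using power_eq_1_iff[of z n] n(1) by simp
  qed
  moreover have "single a (1::complex) ^ k = single (real k *\<^sub>R a) 1" for k
    by (induction k) (simp_all add: mult_single algebra_simps)
  then have "pev F (single a 1) \<in> rel_ideal v S {}"
    using n by (simp add: F_def pev_diff pev_monom nabla_def)
  ultimately show ?case by blast
next
  case (insert y I)
  let ?gens = "\<lambda>S I. {\<Prod>i\<in>C. nabla (v i) | C. C \<subseteq> I \<and> span (v ` (S \<union> (I - C))) \<noteq> UNIV} \<union> (\<lambda>s. nabla (v s)) ` S"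
  have gens_ga: "?gens S' I' \<subseteq> group_alg \<Lambda>" if "v ` (S' \<union> I') \<subseteq> \<Lambda>" for S' I'
  proof
    fix x assume "x \<in> ?gens S' I'"
    then consider C where "x = (\<Prod>i\<in>C. nabla (v i))" "C \<subseteq> I'" | s where "x = nabla (v s)" "s \<in> S'" by blast
    then show "x \<in> group_alg \<Lambda>" using that by cases (auto intro!: ga.prod_in nabla_ga)
  qed
  have sub: "v ` (S \<union> insert y I) \<subseteq> \<Lambda>" "v ` (insert y S \<union> I) \<subseteq> \<Lambda>" "v ` (S \<union> I) \<subseteq> \<Lambda>"
    using insert.prems(1) by auto
  note G = gens_ga[OF sub(1)] and G1 = gens_ga[OF sub(2)] and G2 = gens_ga[OF sub(3)]
  let ?J = "rel_ideal v S (insert y I)"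
  note J_zero = ga.idl_zero[OF G, folded rel_ideal_def] and J_add = ga.idl_add[OF G, folded rel_ideal_def]
    and J_mult = ga.idl_mult[OF G, folded rel_ideal_def] and J_gen = ga.idl_gen[OF G, folded rel_ideal_def]
  have y: "nabla (v y) \<in> group_alg \<Lambda>" using insert.prems by (auto intro: nabla_ga)
  obtain F where F: "F \<noteq> 0" "\<forall>z. poly F z = 0 \<longrightarrow> norm z = 1" "pev F (single a 1) \<in> rel_ideal v (insert y S) I"
    using insert.IH[of "insert y S"] insert.prems by auto
  \<comment> \<open>The contraction adds the single relation \<open>nabla (v y)\<close>; multiplying
    by a \<open>g\<close> that carries this relation into \<open>?J\<close> repairs
    membership.\<close>
  have contraction: "f * g \<in> ?J" if f: "f \<in> rel_ideal v (insert y S) I" and g: "g \<in> group_alg \<Lambda>" "nabla (v y) * g \<in> ?J" for f g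
    using G1 f[unfolded rel_ideal_def]
  proof (induction rule: ga.ideal_induct)
    case zero
    show ?case by (simp add: J_zero)
  next
    case (gen s)
    then consider C where "s = (\<Prod>i\<in>C. nabla (v i))" "C \<subseteq> I" "span (v ` (insert y S \<union> (I - C))) \<noteq> UNIV"
      | "s = nabla (v y)" | t where "s = nabla (v t)" "t \<in> S" by blast
    then show ?case
    proof cases
      case 1
      have eq: "S \<union> (insert y I - C) = insert y S \<union> (I - C)" using 1(2) insert.hyps by auto
      have "span (v ` (S \<union> (insert y I - C))) \<noteq> UNIV" unfolding eq by (rule 1(3))
      then have "s \<in> ?J" by (intro J_gen UnI1 CollectI exI[of _ C] conjI 1(1) subset_insertI2[OF 1(2)])
      then show ?thesis by (subst mult.commute) (rule J_mult[OF g(1)])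
    next
      case 2
      then show ?thesis using g by simp
    next
      case 3
      then have "s \<in> ?J" by (intro J_gen UnI2) simp
      then show ?thesis by (subst mult.commute) (rule J_mult[OF g(1)])
    qed
  next
    case (add f f')
    then show ?case by (simp add: distrib_right J_add)
  next
    case (mult r f)
    then show ?case by (simp add: J_mult mult.assoc)
  qed
  show ?case
  proof (cases "span (v ` (S \<union> I)) = UNIV")
    case True
    then obtain F' where F': "F' \<noteq> 0" "\<forall>z. poly F' z = 0 \<longrightarrow> norm z = 1" "pev F' (single a 1) \<in> rel_ideal v S I"
      using insert.IH[of S] insert.prems by auto
    \<comment> \<open>Multiplication by \<open>nabla (v y)\<close> adds \<open>y\<close> to each
      removed set and leaves its complement unchanged.\<close>
    have deletion: "nabla (v y) * g \<in> ?J" if "g \<in> rel_ideal v S I" for g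
      using G2 that[unfolded rel_ideal_def]
    proof (induction rule: ga.ideal_induct)
      case zero
      show ?case by (simp add: J_zero)
    next
      case (gen s)
      then consider C where "s = (\<Prod>i\<in>C. nabla (v i))" "C \<subseteq> I" "span (v ` (S \<union> (I - C))) \<noteq> UNIV"
        | t where "s = nabla (v t)" "t \<in> S" by blast
      then show ?case
      proof cases
        case 1
        have "insert y I - insert y C = I - C" "y \<notin> C" "finite C"
          using 1(2) insert.hyps finite_subset by auto
        with 1 have "span (v ` (S \<union> (insert y I - insert y C))) \<noteq> UNIV"
          "nabla (v y) * s = (\<Prod>i\<in>insert y C. nabla (v i))" by simp_all
        then show ?thesis
          by (intro J_gen UnI1 CollectI exI[of _ "insert y C"] conjI insert_mono[OF 1(2)])
      next
        case 2
        then have "s \<in> ?J" by (intro J_gen UnI2) simp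
        then show ?thesis by (rule J_mult[OF y])
      qed
    next
      case (add f f')
      then show ?case by (simp add: distrib_left J_add)
    next
      case (mult r f)
      then show ?case using J_mult[of r "nabla (v y) * f"] by (simp add: mult_ac)
    qed
    have "pev F (single a 1) * pev F' (single a 1) \<in> ?J"
      by (rule contraction[OF F(3) pev_ga[OF single_ga[OF a]] deletion[OF F'(3)]])
    then show ?thesis
      using F F' by (intro exI[of _ "F * F'"]) (auto simp: pev_mult)
  next
    case False
    have "insert y I - {y} = I" using insert.hyps by auto
    with False have "span (v ` (S \<union> (insert y I - {y}))) \<noteq> UNIV" by simp
    then have "nabla (v y) \<in> ?J" by (intro J_gen UnI1 CollectI exI[of _ "{y}"] conjI) simp_all
    \<comment> \<open>If \<open>y\<close> is a coloop its relation is already in \<open>?J\<close>,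
      so the multiplier is 1 and the contraction alone suffices.\<close>
    then have "pev F (single a 1) * 1 \<in> ?J" by (intro contraction[OF F(3)]) simp_all
    then show ?thesis using F by auto
  qed
qed

lemma rel_ideal_empty: "rel_ideal v {} I = nabla_ideal v I"
  by (simp add: rel_ideal_def nabla_ideal_def cocirc_gens_def)

end

locale spanning_list = lattice +
  fixes X :: "'a list"
  assumes X_sub: "set X \<subseteq> \<Lambda>" and X_span: "span (set X) = UNIV"
begin

abbreviation V :: "'a character set" where "V \<equiv> vertices \<Lambda> X"
abbreviation K :: "'a character \<Rightarrow> nat set" where "K e \<equiv> fixed_idx X e"
abbreviation J :: "'a character \<Rightarrow> mpoly set" where "J e \<equiv> J_fam ((!) X) (K e)"
abbreviation JN :: "('a \<Rightarrow>\<^sub>0 complex) set" where "JN \<equiv> nabla_ideal ((!) X) {..<length X}"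

lemma image_X: "(!) X ` {..<length X} = set X"
  by (auto simp: in_set_conv_nth)

lemma X_image_sub: "(!) X ` {..<length X} \<subseteq> \<Lambda>"
  using X_sub by (simp add: image_X)

lemma K_eq: "K e = {i \<in> {..<length X}. e (X ! i) = 1}"
  by (auto simp: fixed_idx_def)

lemma V_torus: "e \<in> V \<Longrightarrow> e \<in> torus \<Lambda>"
  and V_span: "e \<in> V \<Longrightarrow> span ((!) X ` K e) = UNIV"
  by (simp_all add: vertices_iff)

lemma J_nabla_eq: "J_nabla \<Lambda> X = JN"
  unfolding J_nabla_def nabla_ideal_def nabla_def[symmetric]
  by (rule ga.idl_cocircuits) (use X_sub nabla_ga in auto)

lemmas JN_simps = nabla_ideal_zero[OF finite_lessThan X_image_sub] nabla_ideal_add[OF finite_lessThan X_image_sub]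
  nabla_ideal_diff[OF finite_lessThan X_image_sub] nabla_ideal_mult[OF finite_lessThan X_image_sub]
  nabla_ideal_sum[OF finite_lessThan X_image_sub] nabla_ideal_ga[OF finite_lessThan X_image_sub]

lemmas JN_zero = JN_simps(1) and JN_add = JN_simps(2) and JN_diff = JN_simps(3)
  and JN_mult = JN_simps(4) and JN_sum = JN_simps(5) and JN_ga = JN_simps(6)

lemma trivial_vertex: "(\<lambda>a\<in>\<Lambda>. 1) \<in> V"
proof -
  have "K (\<lambda>a\<in>\<Lambda>. 1) = {..<length X}"
    using X_image_sub by (auto simp: fixed_idx_def)
  moreover have "(\<lambda>a\<in>\<Lambda>. 1) \<in> torus \<Lambda>" by (auto simp: torus_def \<Lambda>_add)
  ultimately show ?thesis using X_span by (simp add: vertices_iff image_X)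
qed

lemma vertex_root:
  "e \<in> V \<Longrightarrow> a \<in> \<Lambda> \<Longrightarrow> pev F (single a 1) \<in> JN \<Longrightarrow> poly F (e a) = 0"
  by (rule char_root[OF finite_lessThan X_image_sub _ V_torus K_eq V_span, where N = 2]) auto

lemma J_mN:
  assumes "e \<in> V" "q \<in> polys d" "q \<in> mN (Suc (length X))"
  shows "q \<in> J e"
  by (rule mN_J_fam[OF finite_fixed_idx V_span[OF assms(1)] assms(2)])
    (rule mN_mono[OF assms(3)], use card_fixed_idx in simp)

text \<open>The \<open>W e\<close> are, up to high order at each vertex, the idempotents of the semilocal quotient by \<open>JN\<close>.\<close>

theorem local_global:
  obtains N :: nat and W :: "'a character \<Rightarrow> 'a \<Rightarrow>\<^sub>0 complex"
  where "N \<ge> 2" "length X < N" "finite V" "\<And>e. e \<in> V \<Longrightarrow> W e \<in> group_alg \<Lambda>"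
    "\<And>e e'. e \<in> V \<Longrightarrow> e' \<in> V \<Longrightarrow> e \<noteq> e' \<Longrightarrow> Phi N e (W e') \<in> mN (Suc (length X))"
    "\<And>e. e \<in> V \<Longrightarrow> cong_mN (Suc (length X)) (Phi N e (W e)) 1"
    "\<And>g. g \<in> group_alg \<Lambda> \<Longrightarrow> (\<And>e. e \<in> V \<Longrightarrow> Phi N e g \<in> J e) \<Longrightarrow> g \<in> JN"
proof -
  define x where "x i = (single (bs ! i) 1 :: 'a \<Rightarrow>\<^sub>0 complex)" for i
  have x_ga: "x i \<in> group_alg \<Lambda>" if "i < d" for i
    unfolding x_def by (rule single_ga[OF \<Lambda>_bs[OF that]])
  have "\<exists>F. F \<noteq> 0 \<and> (\<forall>z. poly F z = 0 \<longrightarrow> norm z = 1) \<and> pev F (x i) \<in> JN" if "i < d" for i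
    using annihilating_poly[of "{..<length X}" "(!) X" "{}" "bs ! i"] X_image_sub X_span \<Lambda>_bs[OF that]
    by (simp add: rel_ideal_empty image_X x_def)
  then obtain F where F: "\<And>i. i < d \<Longrightarrow> F i \<noteq> 0" "\<And>i z. i < d \<Longrightarrow> poly (F i) z = 0 \<Longrightarrow> norm z = 1"
    "\<And>i. i < d \<Longrightarrow> pev (F i) (x i) \<in> JN" by metis
  define Rt where "Rt i = {z. poly (F i) z = 0}" for i
  have fin: "finite (Rt i)" if "i < d" for i unfolding Rt_def by (rule poly_roots_finite[OF F(1)[OF that]])
  have root: "e (bs ! i) \<in> Rt i" if "e \<in> V" "i < d" for e i
    unfolding Rt_def using vertex_root[OF that(1) \<Lambda>_bs[OF that(2)]] F(3)[OF that(2)] by (simp add: x_def)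
  \<comment> \<open>The first summand puts errors of order \<open>M\<close> into every local ideal
    at a vertex; the second bounds all root multiplicities.\<close>
  define M where "M = Suc (length X) + (\<Sum>i<d. degree (F i))"
  \<comment> \<open>Large enough for the pigeonhole argument (\<open>d * M < N\<close>), for
    reducing to order \<open>M\<close>, and for the logarithm (\<open>N \<ge> 2\<close>).\<close>
  define N where "N = d * M + M + 2"
  have N2: "N \<ge> 2" and MN: "M \<le> N" "d * M < N" and XM: "Suc (length X) \<le> M" by (auto simp: N_def M_def)
  have "\<exists>u. (\<Sum>z\<in>Rt i. u z) = 1 \<and> (\<forall>z\<in>Rt i. (\<Prod>w\<in>Rt i - {z}. [:-w, 1:] ^ M) dvd (u z :: complex poly))"
    if "i < d" for i
  proof -
    \<comment> \<open>The trivial character supplies a root; without one the partial fractions would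
      sum to 0 instead of 1.\<close>
    have "Rt i \<noteq> {}" using root[OF trivial_vertex that] by blast
    then show ?thesis using partial_fractions[OF fin[OF that], of M] by simp
  qed
  then obtain u where u: "\<And>i. i < d \<Longrightarrow> (\<Sum>z\<in>Rt i. u i z) = (1 :: complex poly)"
    "\<And>i z. i < d \<Longrightarrow> z \<in> Rt i \<Longrightarrow> (\<Prod>w\<in>Rt i - {z}. [:-w, 1:] ^ M) dvd u i z" by metis
  \<comment> \<open>One univariate idempotent per coordinate: \<open>U \<zeta>\<close> isolates the
    point \<open>\<zeta>\<close> of the grid of all combinations of roots, which contains every
    vertex.\<close>
  define U where "U \<zeta> = (\<Prod>i<d. pev (u i (\<zeta> i)) (x i))" for \<zeta>
  define Z where "Z = PiE {..<d} Rt"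
  have finZ: "finite Z" unfolding Z_def by (rule finite_PiE) (auto intro: fin)
  have U_split: "U \<zeta> = (\<Prod>j\<in>{..<d} - {i}. pev (u j (\<zeta> j)) (x j)) * pev (u i (\<zeta> i)) (x i)"
    and U_rest: "(\<Prod>j\<in>{..<d} - {i}. pev (u j (\<zeta> j)) (x j)) \<in> group_alg \<Lambda>" if "i < d" for \<zeta> i
    unfolding U_def using that prod.remove[of "{..<d}" i "\<lambda>j. pev (u j (\<zeta> j)) (x j)"]
    by (auto simp: mult.commute intro!: ga.prod_in pev_ga x_ga)
  have U_ga: "U \<zeta> \<in> group_alg \<Lambda>" for \<zeta>
    unfolding U_def by (intro ga.prod_in pev_ga x_ga) simp
  have sumU: "(\<Sum>\<zeta>\<in>Z. U \<zeta>) = 1"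
  proof -
    have "(\<Sum>\<zeta>\<in>Z. U \<zeta>) = (\<Prod>i<d. \<Sum>z\<in>Rt i. pev (u i z) (x i))"
      unfolding Z_def U_def by (rule prod_sum_PiE[symmetric]) (auto intro: fin)
    also have "\<dots> = 1" by (simp add: u(1) flip: pev_sum)
    finally show ?thesis .
  qed
  \<comment> \<open>With the factor at \<open>\<zeta> i\<close> restored, the partial fraction
    contains every root of \<open>F i\<close> to the power \<open>M\<close> and is divisible by
    \<open>F i\<close>.\<close>
  have U_kill: "U \<zeta> * (x i - single 0 (\<zeta> i)) ^ M \<in> JN" if \<zeta>: "\<zeta> \<in> Z" and i: "i < d" for \<zeta> i
  proof -
    have zi: "\<zeta> i \<in> Rt i" using that by (auto simp: Z_def)
    have "degree (F i) \<le> (\<Sum>i<d. degree (F i))" by (rule member_le_sum) (use i in auto)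
    then have "degree (F i) \<le> M" by (simp add: M_def)
    then have "F i dvd (\<Prod>w\<in>Rt i. [:-w, 1:] ^ M)"
      unfolding Rt_def by (rule complex_poly_dvd_roots[OF F(1)[OF i]])
    also have "(\<Prod>w\<in>Rt i. [:-w, 1:] ^ M) = [:-\<zeta> i, 1:] ^ M * (\<Prod>w\<in>Rt i - {\<zeta> i}. [:-w, 1:] ^ M)"
      by (rule prod.remove[OF fin[OF i] zi])
    also have "\<dots> dvd [:-\<zeta> i, 1:] ^ M * u i (\<zeta> i)"
      by (rule mult_dvd_mono[OF dvd_refl u(2)[OF i zi]])
    finally obtain r where r: "[:-\<zeta> i, 1:] ^ M * u i (\<zeta> i) = F i * r" by (elim dvdE)
    have "pev [:-\<zeta> i, 1:] (x i) = x i - single 0 (\<zeta> i)" by (simp add: pev_pCons single_uminus)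
    then have "(x i - single 0 (\<zeta> i)) ^ M * pev (u i (\<zeta> i)) (x i) = pev r (x i) * pev (F i) (x i)"
      using arg_cong[OF r, of "\<lambda>p. pev p (x i)"] by (simp add: pev_mult pev_power mult.commute)
    moreover have "pev r (x i) * pev (F i) (x i) \<in> JN" by (intro JN_mult pev_ga x_ga F(3) i)
    ultimately have "(x i - single 0 (\<zeta> i)) ^ M * pev (u i (\<zeta> i)) (x i) \<in> JN" by simp
    from JN_mult[OF U_rest[OF i] this] show ?thesis
      unfolding U_split[OF i, of \<zeta>] by (simp add: mult_ac)
  qed
  define ze where "ze e = restrict (\<lambda>i. e (bs ! i)) {..<d}" for e :: "'a character"
  have ze: "ze e \<in> Z" "char_of (ze e) = e" if "e \<in> V" for e
  proof -
    show "ze e \<in> Z" using root[OF that] by (auto simp: ze_def Z_def)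
    show "char_of (ze e) = e"
    proof (rule torus_eqI[OF char_of_torus V_torus[OF that]])
      show "norm (ze e i) = 1" if "i < d" for i
        using torus_norm[OF V_torus[OF \<open>e \<in> V\<close>] \<Lambda>_bs[OF that]] that by (simp add: ze_def)
      show "char_of (ze e) (bs ! i) = e (bs ! i)" if "i < d" for i
        using char_of_bs[OF that] that by (simp add: ze_def)
    qed
  qed
  have inj_ze: "inj_on ze V" by (rule inj_onI) (metis ze(2))
  have finV: "finite V"
    by (rule finite_imageD[OF _ inj_ze]) (rule finite_subset[OF _ finZ], use ze in auto)
  \<comment> \<open>Some coordinate of \<open>\<zeta>\<close> differs from that of \<open>e\<close>;
    its partial fraction contains the \<open>M\<close>-th power of a factor vanishing at
    \<open>e\<close>.\<close>
  have other: "Phi N e (U \<zeta>) \<in> mN (Suc (length X))" if e: "e \<in> V" and \<zeta>: "\<zeta> \<in> Z" "\<zeta> \<noteq> ze e" for e \<zeta>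
  proof -
    have "\<exists>i<d. \<zeta> i \<noteq> e (bs ! i)"
    proof (rule ccontr)
      assume "\<not> ?thesis"
      then have "\<zeta> = ze e" using \<zeta>(1) by (intro PiE_ext[of \<zeta> "{..<d}" Rt]) (use ze(1)[OF e] in \<open>auto simp: Z_def ze_def\<close>)
      then show False using \<zeta>(2) by simp
    qed
    then obtain i where i: "i < d" "\<zeta> i \<noteq> e (bs ! i)" by blast
    let ?z = "e (bs ! i)"
    have "[:-?z, 1:] ^ M dvd (\<Prod>w\<in>Rt i - {\<zeta> i}. [:-w, 1:] ^ M)"
      by (rule dvd_prodI) (use fin[OF i(1)] root[OF e i(1)] i in auto)
    also have "\<dots> dvd u i (\<zeta> i)" by (rule u(2)[OF i(1)]) (use \<zeta>(1) i in \<open>auto simp: Z_def\<close>)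
    finally obtain r where r: "u i (\<zeta> i) = [:-?z, 1:] ^ M * r" by (elim dvdE)
    have "pev [:-?z, 1:] (x i) = x i - single 0 ?z" by (simp add: pev_pCons single_uminus)
    then have "pev (u i (\<zeta> i)) (x i) = (x i - single 0 ?z) ^ M * pev r (x i)"
      by (simp add: r pev_mult pev_power)
    then have U: "U \<zeta> = (x i - single 0 ?z) ^ M * (pev r (x i) * (\<Prod>j\<in>{..<d} - {i}. pev (u j (\<zeta> j)) (x j)))"
      unfolding U_split[OF i(1), of \<zeta>] by (simp only: mult_ac)
    have et: "e \<in> torus \<Lambda>" by (rule V_torus[OF e])
    have xz: "x i - single 0 ?z \<in> group_alg \<Lambda>" by (intro ga.diff_in x_ga i const_ga)
    let ?r = "pev r (x i) * (\<Prod>j\<in>{..<d} - {i}. pev (u j (\<zeta> j)) (x j))"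
    have rga: "?r \<in> group_alg \<Lambda>" by (intro ga.mult_in pev_ga x_ga i U_rest)
    have cong_mN: "cong_mN N (Phi N e (U \<zeta>)) (Phi N e (x i - single 0 ?z) ^ M * Phi N e ?r)"
      unfolding U
      by (rule cong_mN_trans[OF Phi_mult[OF N2 et ga.power_in[OF xz] rga]])
        (rule cong_mN_mult[OF Phi_power[OF N2 et xz] cong_mN_refl])
    obtain w where w: "expo N - 1 = [:0, 1:] * w" using expo_split[OF N2] by blast
    have "Phi N e (x i - single 0 ?z) = Phi N e (x i) - single 0 ?z"
      by (simp only: Phi_diff Phi_const[OF N2 et])
    also have "\<dots> = cscale ?z (pev (expo N - 1) (lf (bs ! i)))"
      by (simp add: x_def Phi_single trunc_exp_def pev_diff cscale_def right_diff_distrib)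
    also have "\<dots> \<in> mN 1"
      unfolding w pev_mult pev_X by (intro mN_cscale mN_mult_right lf_mN1)
    finally have "Phi N e (x i - single 0 ?z) ^ M \<in> mN M" by (rule mN_power)
    then have "Phi N e (U \<zeta>) \<in> mN M" by (intro cong_mN_mem[OF cong_mN MN(1)] mN_mult_right)
    then show ?thesis by (rule mN_mono[OF _ XM])
  qed
  have self: "cong_mN (Suc (length X)) (Phi N e (U (ze e))) 1" if e: "e \<in> V" for e
  proof -
    have "1 = Phi N e (\<Sum>\<zeta>\<in>Z. U \<zeta>)" by (simp add: sumU Phi_one[OF N2 V_torus[OF e]])
    also have "\<dots> = Phi N e (U (ze e)) + (\<Sum>\<zeta>\<in>Z - {ze e}. Phi N e (U \<zeta>))"
      unfolding Phi_sum by (rule sum.remove[OF finZ ze(1)[OF e]])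
    finally have "1 - Phi N e (U (ze e)) = (\<Sum>\<zeta>\<in>Z - {ze e}. Phi N e (U \<zeta>))" by (simp add: algebra_simps)
    moreover have "\<dots> \<in> mN (Suc (length X))" by (rule mN_sum, rule other[OF e]) auto
    ultimately have "cong_mN (Suc (length X)) 1 (Phi N e (U (ze e)))" by (simp add: cong_mN_def)
    then show ?thesis by (rule cong_mN_sym)
  qed
  have inj: "g \<in> JN" if g: "g \<in> group_alg \<Lambda>" "\<And>e. e \<in> V \<Longrightarrow> Phi N e g \<in> J e" for g
  proof -
    have "U \<zeta> * g \<in> JN" if \<zeta>: "\<zeta> \<in> Z" for \<zeta>
    proof -
      define e where "e = char_of \<zeta>"
      have et: "e \<in> torus \<Lambda>"
        unfolding e_def
      proof (rule char_of_torus)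
        fix i assume i: "i < d"
        then have "\<zeta> i \<in> Rt i" using \<zeta> by (auto simp: Z_def)
        then show "norm (\<zeta> i) = 1" using F(2)[OF i] by (simp add: Rt_def)
      qed
      have "Phi N e g \<in> J e"
      proof (cases "span ((!) X ` K e) = UNIV")
        case True
        then show ?thesis using g(2) et by (simp add: vertices_iff)
      next
        case False
        \<comment> \<open>A grid point need not be a vertex. There even the empty product is a
          generator, so the local ideal is the whole ring and the hypothesis on \<open>g\<close> is
          automatic.\<close>
        then have "prodf ((!) X) {} \<in> J e" by (intro J_fam_gen) simp_all
        from J_fam_mult[OF Phi_polys this] show ?thesis by (simp add: prodf_def)
      qed
      then obtain j where j: "j \<in> JN" "cong_mN N (Phi N e g) (Phi N e j)"
        using J_fam_Phi[OF finite_lessThan X_image_sub N2 et K_eq] by blast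
      \<comment> \<open>By \<open>U_kill\<close> this ideal contains the \<open>M\<close>-th powers
        of the local coordinates at \<open>e\<close>, so the expansion at this one point decides
        membership.\<close>
      let ?I = "{r \<in> group_alg \<Lambda>. U \<zeta> * r \<in> JN}"
      have "g - j \<in> ?I"
      proof (rule Phi_kernel[OF N2 et, where M = M])
        show "local_var e i ^ M \<in> ?I" if i: "i < d" for i
        proof -
          have zi: "e (bs ! i) = \<zeta> i" unfolding e_def by (rule char_of_bs[OF i])
          have "\<zeta> i \<noteq> 0" using torus_nonzero[OF et \<Lambda>_bs[OF i]] zi by simp
          then have "local_var e i = single 0 (inverse (\<zeta> i)) * (x i - single 0 (\<zeta> i))"
            by (simp add: local_var_def zi x_def cscale_def right_diff_distrib mult_single)
          then have "local_var e i ^ M = single 0 (inverse (\<zeta> i)) ^ M * (x i - single 0 (\<zeta> i)) ^ M"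
            by (simp add: power_mult_distrib)
          then have "U \<zeta> * local_var e i ^ M = single 0 (inverse (\<zeta> i)) ^ M * (U \<zeta> * (x i - single 0 (\<zeta> i)) ^ M)"
            by (simp only: mult_ac)
          also have "\<dots> \<in> JN" by (intro JN_mult ga.power_in const_ga U_kill \<zeta> i)
          finally show ?thesis by (simp add: ga.power_in local_var_ga[OF N2 et i])
        qed
        show "Phi N e (g - j) \<in> mN N" using j(2) by (simp add: cong_mN_def Phi_diff)
        show "g - j \<in> group_alg \<Lambda>" by (intro ga.diff_in g JN_ga j)
        show "r * y \<in> ?I" if "r \<in> group_alg \<Lambda>" "y \<in> ?I" for r y
          using that JN_mult[of r "U \<zeta> * y"] by (auto simp: mult.left_commute)
        show "y + z \<in> ?I" if "y \<in> ?I" "z \<in> ?I" for y z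
          using that JN_add by (auto simp: distrib_left)
      qed (use JN_zero MN in auto)
      then have "U \<zeta> * (g - j) \<in> JN" by simp
      from JN_add[OF this JN_mult[OF U_ga[of \<zeta>] j(1)]] show ?thesis by (simp add: right_diff_distrib)
    qed
    then have "(\<Sum>\<zeta>\<in>Z. U \<zeta> * g) \<in> JN" by (rule JN_sum)
    then show ?thesis by (simp add: sumU flip: sum_distrib_right)
  qed
  show ?thesis
  proof (rule that[of N "\<lambda>e. U (ze e)"])
    show "length X < N" using XM MN by simp
    show "Phi N e (U (ze e')) \<in> mN (Suc (length X))" if "e \<in> V" "e' \<in> V" "e \<noteq> e'" for e e'
      by (rule other[OF that(1) ze(1)[OF that(2)]]) (use inj_ze that in \<open>auto dest: inj_onD\<close>)
  qed (use N2 finV U_ga self inj in auto)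
qed

end

section \<open>Duality with the discrete space and the isomorphism\<close>

subsection \<open>Taylor expansion\<close>

lemma pairing_right_zero [simp]: "pairing q 0 = 0"
  by (simp add: pairing_lin lin_def ncoef_def)

lemma pairing_right_sum: "pairing q (sum h A) = (\<Sum>i\<in>A. pairing q (h i))"
proof -
  have "pairing q (f + g) = pairing q f + pairing q g" for f g
    by (simp add: pairing_lin lin_def ncoef_def lookup_add algebra_simps sum.distrib)
  then show ?thesis by (induction A rule: infinite_finite_induct) simp_all
qed

lemma pairing_Var_mult: "pairing (Var i * q) h = pairing q (partial i h)"
proof -
  have "pairing (Var i * q) h = lin (\<lambda>c. c) (ncoef h) (q * Var i)"
    by (simp add: pairing_lin mult.commute)
  also have "\<dots> = (\<Sum>a\<in>keys q. \<Sum>b\<in>keys (Var i). lookup q a * lookup (Var i) b * ncoef h (a + b))"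
    by (rule lin_mult_sum[OF scalar_hom_id])
  also have "\<dots> = pairing q (partial i h)"
    unfolding ncoef_def[of "partial i h"] pairing_lin lin_def ncoef_partial by (simp add: Var_def ncoef_partial)
  finally show ?thesis .
qed

lemma partial_single: "partial i (single m b) = single (m - single i 1) (of_nat (lookup m i) * b)"
  by (simp add: partial_def)

context lattice
begin

lemma Phi_cscale: "Phi N e (cscale c f) = cscale c (Phi N e f)"
  unfolding Phi_def lin_cscale[OF scalar_hom_single] by (simp only: cscale_def)

lemma pairing_lf_mult: "pairing (lf a * q) h = (\<Sum>i<d. of_real (coord bs a i) * pairing q (partial i h))"
  by (simp add: lin_form_def sum_distrib_right pairing_sum pairing_cscale pairing_Var_mult)

text \<open>Differentiating along \<open>a\<close> produces one summand per variable, weighted by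
  its exponent; the exponents add up to the degree, as in Euler's identity, and so the factorial
  builds up.\<close>

lemma pairing_lf_power:
  assumes "keys m \<subseteq> {..<d}"
  shows "pairing (lf a ^ n) (single m b) =
    (if mdeg m = n then fact n * b * mon (\<lambda>i. of_real (coord bs a i)) m else 0)"
  using assms
proof (induction n arbitrary: m b)
  case 0
  have "pairing 1 (single m b) = ncoef (single m b) 0"
    using pairing_single[of 0 1 "single m b"] by simp
  then show ?case by (auto simp: mdeg_eq_0 ncoef_def lookup_single when_def mfact_def)
next
  case (Suc n)
  let ?x = "\<lambda>i. complex_of_real (coord bs a i)"
  have summand: "?x i * pairing (lf a ^ n) (partial i (single m b)) =
      (if mdeg m = Suc n then fact n * b * mon ?x m * of_nat (lookup m i) else 0)" for i
  proof (cases "lookup m i = 0")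
    case True
    then show ?thesis by (simp add: partial_single)
  next
    case False
    define m' where "m' = m - single i 1"
    have mm: "m = m' + single i 1"
      unfolding m'_def using False
      by (intro poly_mapping_eqI) (auto simp: lookup_add minus_poly_mapping.rep_eq lookup_single when_def)
    have "keys m' \<subseteq> keys m" by (auto simp: mm in_keys_iff lookup_add)
    then have sub: "keys m' \<subseteq> {..<d}" using Suc.prems by (rule subset_trans)
    have "mdeg m = Suc (mdeg m')" "mon ?x m = mon ?x m' * ?x i"
      by (simp_all add: mm mdeg_add mon_add)
    then show ?thesis
      unfolding partial_single m'_def[symmetric] Suc.IH[OF sub] by (auto simp: mult_ac)
  qed
  have "pairing (lf a ^ Suc n) (single m b)
      = (\<Sum>i<d. if mdeg m = Suc n then fact n * b * mon ?x m * of_nat (lookup m i) else 0)"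
    by (simp only: power_Suc pairing_lf_mult summand)
  also have "\<dots> = (if mdeg m = Suc n then fact n * b * mon ?x m * of_nat (mdeg m) else 0)"
  proof (cases "mdeg m = Suc n")
    case True
    have deg: "complex_of_nat (mdeg m) = (\<Sum>i<d. of_nat (lookup m i))"
      by (simp add: mdeg_superset[OF finite_lessThan Suc.prems])
    show ?thesis unfolding if_P[OF True] deg by (rule sum_distrib_left[symmetric])
  qed simp
  finally show ?case by (simp add: mult_ac)
qed

lemma pairing_trunc_exp:
  assumes "h \<in> polys d" "\<And>m. m \<in> keys h \<Longrightarrow> mdeg m < N"
  shows "pairing (trunc_exp N a) h = eval_at bs h a"
proof -
  let ?x = "\<lambda>i. complex_of_real (coord bs a i)"
  have mono: "pairing (trunc_exp N a) (single m b) = b * mon ?x m" if "keys m \<subseteq> {..<d}" "mdeg m < N" for m b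
  proof -
    have "pairing (trunc_exp N a) (single m b)
        = (\<Sum>k<N. inverse (fact k) * (if mdeg m = k then fact k * b * mon ?x m else 0))"
      unfolding trunc_exp_def pev_expo pairing_sum pairing_cscale pairing_lf_power[OF that(1)] ..
    also have "\<dots> = (\<Sum>k<N. if k = mdeg m then b * mon ?x m else 0)"
      by (rule sum.cong) auto
    finally show ?thesis using that(2) by simp
  qed
  have "pairing (trunc_exp N a) h = (\<Sum>m\<in>keys h. pairing (trunc_exp N a) (single m (lookup h m)))"
    by (subst (1) pm_sum) (rule pairing_right_sum)
  also have "\<dots> = (\<Sum>m\<in>keys h. lookup h m * mon ?x m)"
    by (intro sum.cong refl mono) (use assms in \<open>auto simp: polys_def\<close>)
  finally show ?thesis by (simp add: eval_at_def poly_eval_lin lin_def)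
qed

end


subsection \<open>The discrete space as a dual\<close>

definition eval_functional :: "('u \<Rightarrow> complex) \<Rightarrow> ('u \<Rightarrow>\<^sub>0 complex) \<Rightarrow> complex"
  where "eval_functional f = lin (\<lambda>c. c) f"

context lattice
begin

text \<open>Inversion changes \<open>1 - x\<close> only by the unit \<open>- x^{-1}\<close>.\<close>

lemma inversion_cocircuit:
  assumes "finite C" "v ` C \<subseteq> \<Lambda>"
  shows "\<exists>s\<in>group_alg \<Lambda>. lin (single 0) (\<lambda>a. single (- a) 1) (\<Prod>i\<in>C. nabla (v i)) = s * (\<Prod>i\<in>C. nabla (v i))"
  using assms
proof (induction C rule: finite_induct)
  case empty
  have "lin (single 0) (\<lambda>a. single (- a) 1) (single 0 1) = (1 :: 'u \<Rightarrow>\<^sub>0 complex)"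
    by (subst lin_single) auto
  then show ?case by (intro bexI[of _ 1]) auto
next
  case (insert y C)
  let ?\<iota> = "lin (single 0) (\<lambda>a. single (- a) 1) :: ('u \<Rightarrow>\<^sub>0 complex) \<Rightarrow> 'u \<Rightarrow>\<^sub>0 complex"
  obtain s where s: "s \<in> group_alg \<Lambda>" "?\<iota> (\<Prod>i\<in>C. nabla (v i)) = s * (\<Prod>i\<in>C. nabla (v i))"
    using insert by auto
  have "?\<iota> (single 0 1) = 1" by (subst lin_single) auto
  then have "?\<iota> (nabla (v y)) = 1 - single (- v y) 1"
    by (simp add: nabla_def lin_diff)
  also have "\<dots> = single (- v y) (- 1) * nabla (v y)"
    by (simp add: nabla_def right_diff_distrib mult_single single_uminus)
  finally have y: "?\<iota> (nabla (v y)) = single (- v y) (- 1) * nabla (v y)" .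
  have "?\<iota> (nabla (v y) * (\<Prod>i\<in>C. nabla (v i))) = ?\<iota> (nabla (v y)) * ?\<iota> (\<Prod>i\<in>C. nabla (v i))"
    by (rule lin_mult[of _ _ UNIV]) (auto simp: mult_single)
  also have "\<dots> = (single (- v y) (- 1) * s) * (nabla (v y) * (\<Prod>i\<in>C. nabla (v i)))"
    unfolding y s(2) by (simp only: mult_ac)
  finally show ?case
    using insert.hyps insert.prems s(1) by (intro bexI[of _ "single (- v y) (- 1) * s"] ga.mult_in single_ga \<Lambda>_uminus) auto
qed

text \<open>The action translates by \<open>- a\<close> whereas the pairing evaluates at \<open>a\<close>; the ideal is stable under inversion.\<close>

lemma inversion_Jn:
  assumes fin: "finite I" and v: "v ` I \<subseteq> \<Lambda>" and g: "g \<in> nabla_ideal v I"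
  shows "lin (single 0) (\<lambda>a. single (- a) 1) g \<in> nabla_ideal v I"
  using nabla_ideal_gens_ga[OF fin v] g[unfolded nabla_ideal_def]
proof (induction rule: ga.ideal_induct)
  case zero
  show ?case using nabla_ideal_zero[OF fin v] by simp
next
  case (gen s)
  then obtain C where C: "s = (\<Prod>i\<in>C. nabla (v i))" "C \<subseteq> I" "span (v ` (I - C)) \<noteq> UNIV"
    unfolding cocirc_gens_def by blast
  have "finite C" "v ` C \<subseteq> \<Lambda>" using C(2) fin v finite_subset by auto
  then show ?case
    using inversion_cocircuit[of C v] nabla_ideal_mult[OF fin v _ nabla_ideal_gen[OF fin v C(2,3)]] unfolding C(1) by metis
next
  case (add x y)
  then show ?case using nabla_ideal_add[OF fin v] by (simp add: lin_add)
next
  case (mult r x)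
  let ?\<iota> = "lin (single 0) (\<lambda>a. single (- a) 1) :: ('u \<Rightarrow>\<^sub>0 complex) \<Rightarrow> 'u \<Rightarrow>\<^sub>0 complex"
  have "?\<iota> (r * x) = ?\<iota> r * ?\<iota> x"
    by (rule lin_mult[of _ _ UNIV]) (auto simp: mult_single)
  moreover have "?\<iota> r \<in> group_alg \<Lambda>"
    unfolding lin_def using mult(1)
    by (intro ga.sum_in ga.mult_in const_ga single_ga \<Lambda>_uminus) (auto simp: group_alg_iff)
  ultimately show ?case using nabla_ideal_mult[OF fin v _ mult(3)] by simp
qed

text \<open>Evaluating \<open>f\<close> along \<open>g\<close> is the action of the inverted
  \<open>g\<close>, read off at 0.\<close>

lemma eval_functional_Jn:
  assumes fin: "finite I" and v: "v ` I \<subseteq> \<Lambda>" and g: "g \<in> nabla_ideal v I"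
    and f: "\<And>g u. g \<in> nabla_ideal v I \<Longrightarrow> u \<in> \<Lambda> \<Longrightarrow> act g f u = 0"
  shows "eval_functional f g = 0"
proof -
  let ?\<iota> = "lin (single 0) (\<lambda>a. single (- a) 1) g :: 'u \<Rightarrow>\<^sub>0 complex"
  have act: "act h f 0 = lin (\<lambda>c. c) (\<lambda>a. f (- a)) h" for h
    by (simp add: act_def lin_def translate_def)
  have "act ?\<iota> f 0 = (\<Sum>a\<in>keys g. lin (\<lambda>c. c) (\<lambda>a. f (- a)) (single (- a) (lookup g a)))"
    unfolding act by (subst (2) lin_def) (simp add: lin_sum mult_single)
  also have "\<dots> = eval_functional f g"
    by (simp add: eval_functional_def lin_def[of _ f])
  finally show ?thesis using f[OF inversion_Jn[OF fin v g], of 0] by simp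
qed

end

text \<open>Fixes one choice of the truncation order and approximate idempotents provided by
  \<open>local_global\<close>.\<close>

locale local_units = spanning_list +
  fixes N :: nat and W :: "'a character \<Rightarrow> 'a \<Rightarrow>\<^sub>0 complex"
  assumes N2: "N \<ge> 2" and NX: "length X < N" and finV: "finite V"
    and W_ga: "\<And>e. e \<in> V \<Longrightarrow> W e \<in> group_alg \<Lambda>"
    and W_other: "\<And>e e'. e \<in> V \<Longrightarrow> e' \<in> V \<Longrightarrow> e \<noteq> e' \<Longrightarrow> Phi N e (W e') \<in> mN (Suc (length X))"
    and W_self: "\<And>e. e \<in> V \<Longrightarrow> cong_mN (Suc (length X)) (Phi N e (W e)) 1"
    and JN_local: "\<And>g. g \<in> group_alg \<Lambda> \<Longrightarrow> (\<And>e. e \<in> V \<Longrightarrow> Phi N e g \<in> J e) \<Longrightarrow> g \<in> JN"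
begin

abbreviation Ph :: "'a character \<Rightarrow> ('a \<Rightarrow>\<^sub>0 complex) \<Rightarrow> mpoly" where "Ph \<equiv> Phi N"
abbreviation Ps :: "'a character \<Rightarrow> mpoly \<Rightarrow> ('a \<Rightarrow>\<^sub>0 complex)" where "Ps \<equiv> Psi N"

lemma Phi_JN: "g \<in> JN \<Longrightarrow> e \<in> V \<Longrightarrow> Ph e g \<in> J e"
  by (rule Phi_Jn[OF finite_lessThan X_image_sub N2 V_torus K_eq V_span])
    (use NX card_fixed_idx in \<open>auto intro: le_less_trans\<close>)

lemma Ps_ga: "e \<in> V \<Longrightarrow> q \<in> polys d \<Longrightarrow> Ps e q \<in> group_alg \<Lambda>"
  by (rule Psi_ga[OF N2 V_torus])

lemma lift_ga: "e \<in> V \<Longrightarrow> q \<in> polys d \<Longrightarrow> W e * Ps e q \<in> group_alg \<Lambda>"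
  by (intro ga.mult_in W_ga Ps_ga)

lemma J_cg: "e \<in> V \<Longrightarrow> cong_mN (Suc (length X)) p q \<Longrightarrow> p \<in> polys d \<Longrightarrow> q \<in> polys d \<Longrightarrow> p - q \<in> J e"
  by (rule J_mN) (auto simp: cong_mN_def)

lemma Phi_lift_self: "e \<in> V \<Longrightarrow> q \<in> polys d \<Longrightarrow> Ph e (W e * Ps e q) - q \<in> J e"
proof (rule J_cg)
  assume e: "e \<in> V" and q: "q \<in> polys d"
  have "cong_mN (Suc (length X)) (Ph e (W e * Ps e q)) (Ph e (W e) * Ph e (Ps e q))"
    by (rule cong_mN_mono[OF Phi_mult[OF N2 V_torus[OF e] W_ga[OF e] Ps_ga[OF e q]]]) (use NX in simp)
  also have "cong_mN (Suc (length X)) \<dots> (1 * q)"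
    by (intro cong_mN_mult W_self[OF e] cong_mN_mono[OF Phi_Psi[OF N2 V_torus[OF e] q]]) (use NX in simp)
  finally show "cong_mN (Suc (length X)) (Ph e (W e * Ps e q)) q" by simp
qed (auto intro: Phi_polys)

lemma Phi_lift_other: "e \<in> V \<Longrightarrow> e' \<in> V \<Longrightarrow> e \<noteq> e' \<Longrightarrow> q \<in> polys d \<Longrightarrow> Ph e (W e' * Ps e' q) \<in> J e"
proof (rule J_mN)
  assume e: "e \<in> V" "e' \<in> V" "e \<noteq> e'" and q: "q \<in> polys d"
  show "Ph e (W e' * Ps e' q) \<in> mN (Suc (length X))"
    by (rule cong_mN_mem[OF Phi_mult[OF N2 V_torus[OF e(1)] W_ga[OF e(2)] Ps_ga[OF e(2) q]]])
      (use NX in simp, rule mN_mult_right[OF W_other[OF e]])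
qed (auto intro: Phi_polys)

text \<open>Chinese remainder theorem: \<open>W e' * Ps e' q\<close> expands to \<open>q\<close> at
  \<open>e'\<close> and to 0 at all other vertices, modulo the local ideals, so arbitrary expansions
  can be prescribed simultaneously.\<close>

lemma Phi_sum_lift:
  assumes e: "e \<in> V" and q: "\<And>e. e \<in> V \<Longrightarrow> q e \<in> polys d"
  shows "Ph e (\<Sum>e'\<in>V. W e' * Ps e' (q e')) - q e \<in> J e"
proof -
  have "Ph e (\<Sum>e'\<in>V. W e' * Ps e' (q e'))
      = Ph e (W e * Ps e (q e)) + (\<Sum>e'\<in>V - {e}. Ph e (W e' * Ps e' (q e')))"
    unfolding Phi_sum by (rule sum.remove[OF finV e])
  then have "Ph e (\<Sum>e'\<in>V. W e' * Ps e' (q e')) - q e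
      = (Ph e (W e * Ps e (q e)) - q e) + (\<Sum>e'\<in>V - {e}. Ph e (W e' * Ps e' (q e')))"
    by simp
  also have "\<dots> \<in> J e"
    by (intro J_fam_add Phi_lift_self J_fam_sum Phi_lift_other) (use e q in auto)
  finally show ?thesis .
qed

lemma sum_lift_JN:
  assumes g: "g \<in> group_alg \<Lambda>"
  shows "g - (\<Sum>e\<in>V. W e * Ps e (Ph e g)) \<in> JN"
proof (rule JN_local)
  show "g - (\<Sum>e\<in>V. W e * Ps e (Ph e g)) \<in> group_alg \<Lambda>"
    by (intro ga.diff_in g ga.sum_in lift_ga Phi_polys)
  fix e assume e: "e \<in> V"
  have "Ph e (\<Sum>e'\<in>V. W e' * Ps e' (Ph e' g)) - Ph e g \<in> J e"
    by (rule Phi_sum_lift[OF e]) (rule Phi_polys)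
  from J_fam_diff[OF J_fam_zero this] show "Ph e (g - (\<Sum>e\<in>V. W e * Ps e (Ph e g))) \<in> J e"
    by (simp add: Phi_diff)
qed

lemma eval_functional_DM:
  assumes "f \<in> DM_space \<Lambda> X" "g \<in> JN"
  shows "eval_functional f g = 0"
  by (rule eval_functional_Jn[OF finite_lessThan X_image_sub assms(2)])
    (use assms(1) in \<open>auto simp: DM_space_def J_nabla_eq\<close>)

definition decomposes :: "('a \<Rightarrow> complex) \<Rightarrow> ('a character \<Rightarrow>\<^sub>0 mpoly) \<Rightarrow> bool"
  where "decomposes f h \<longleftrightarrow> keys h \<subseteq> V \<and> (\<forall>e\<in>V. lookup h e \<in> D_space bs (fixed_part X e)) \<and>
    (\<forall>a\<in>\<Lambda>. f a = (\<Sum>e\<in>V. e a * eval_at bs (lookup h e) a))"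

text \<open>A monomial of degree at least \<open>N\<close> lies in \<open>J e\<close>, and pairing
  with it reads off the corresponding coefficient of \<open>h\<close>. Hence truncated exponentials
  evaluate \<open>h\<close> exactly.\<close>

lemma D_degree:
  assumes e: "e \<in> V" and h: "h \<in> polys d" "\<And>q. q \<in> J e \<Longrightarrow> pairing q h = 0" and m: "m \<in> keys h"
  shows "mdeg m < N"
proof (rule ccontr)
  assume "\<not> mdeg m < N"
  then have "single m 1 \<in> J e"
    using NX m h(1) by (intro J_mN[OF e] polys_single) (auto simp: mN_def polys_def)
  then have "pairing (single m 1) h = 0" by (rule h(2))
  then show False using m by (simp add: pairing_single ncoef_def in_keys_iff)
qed

lemma D_pairing_trunc_exp:
  assumes "e \<in> V" "h \<in> polys d" "\<And>q. q \<in> J e \<Longrightarrow> pairing q h = 0"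
  shows "pairing (trunc_exp N a) h = eval_at bs h a"
  by (rule pairing_trunc_exp[OF assms(2)]) (rule D_degree[OF assms])

lemma decomposes_functional:
  assumes h: "decomposes f h" and g: "g \<in> group_alg \<Lambda>"
  shows "eval_functional f g = (\<Sum>e\<in>V. pairing (Ph e g) (lookup h e))"
proof -
  have D: "lookup h e \<in> polys d" "\<And>q. q \<in> J e \<Longrightarrow> pairing q (lookup h e) = 0" if "e \<in> V" for e
    using h that by (auto simp: decomposes_def D_space_fixed)
  have "eval_functional f g = (\<Sum>a\<in>keys g. lookup g a * (\<Sum>e\<in>V. e a * pairing (trunc_exp N a) (lookup h e)))"
    unfolding eval_functional_def lin_def
  proof (intro sum.cong refl arg_cong2[of _ _ _ _ "(*)"])
    fix a assume "a \<in> keys g"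
    then have "a \<in> \<Lambda>" using g by (auto simp: group_alg_iff)
    then show "f a = (\<Sum>e\<in>V. e a * pairing (trunc_exp N a) (lookup h e))"
      using h D_pairing_trunc_exp[OF _ D] by (simp add: decomposes_def)
  qed
  also have "\<dots> = (\<Sum>e\<in>V. \<Sum>a\<in>keys g. lookup g a * (e a * pairing (trunc_exp N a) (lookup h e)))"
    unfolding sum_distrib_left by (rule sum.swap)
  also have "\<dots> = (\<Sum>e\<in>V. pairing (Ph e g) (lookup h e))"
    by (simp only: Phi_def lin_def pairing_sum pairing_cscale flip: cscale_def)
  finally show ?thesis .
qed

text \<open>Testing \<open>f\<close> on an element concentrated at \<open>e\<close> isolates the
  summand at \<open>e\<close>. This formula proves uniqueness and also dictates the components in
  the existence proof.\<close>

lemma decomposes_component: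
  assumes h: "decomposes f h" and e: "e \<in> V" and q: "q \<in> polys d"
  shows "pairing q (lookup h e) = eval_functional f (W e * Ps e q)"
proof -
  have D: "\<And>q. q \<in> J e \<Longrightarrow> pairing q (lookup h e) = 0" if "e \<in> V" for e
    using h that by (auto simp: decomposes_def D_space_fixed)
  have "eval_functional f (W e * Ps e q) = pairing (Ph e (W e * Ps e q)) (lookup h e)
      + (\<Sum>e'\<in>V - {e}. pairing (Ph e' (W e * Ps e q)) (lookup h e'))"
    unfolding decomposes_functional[OF h lift_ga[OF e q]] by (rule sum.remove[OF finV e])
  also have "(\<Sum>e'\<in>V - {e}. pairing (Ph e' (W e * Ps e q)) (lookup h e')) = 0"
    by (intro sum.neutral ballI D Phi_lift_other e q) auto
  also have "pairing (Ph e (W e * Ps e q)) (lookup h e) = pairing q (lookup h e)"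
    using D[OF e Phi_lift_self[OF e q]] by (simp add: pairing_diff)
  finally show ?thesis by simp
qed

lemma decomposes_unique:
  assumes "decomposes f h" "decomposes f h'"
  shows "h = h'"
proof (rule poly_mapping_eqI)
  fix e show "lookup h e = lookup h' e"
  proof (cases "e \<in> V")
    case True
    show ?thesis
    proof (rule polys_pairing_eqI[of _ d])
      fix m :: "nat \<Rightarrow>\<^sub>0 nat" assume "keys m \<subseteq> {..<d}"
      then show "pairing (single m 1) (lookup h e) = pairing (single m 1) (lookup h' e)"
        using decomposes_component[OF assms(1) True] decomposes_component[OF assms(2) True] polys_single by simp
    qed (use assms True in \<open>auto simp: decomposes_def D_space_fixed\<close>)
  next
    case False
    then have "e \<notin> keys h" "e \<notin> keys h'" using assms by (auto simp: decomposes_def)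
    then show ?thesis by (simp add: in_keys_iff)
  qed
qed

text \<open>The functional \<open>q \<mapsto> eval_functional f (W e * Ps e q)\<close> kills
  \<open>J e\<close> and is therefore pairing with a polynomial. Writing a lattice point modulo
  \<open>JN\<close> as the sum of its local lifts recovers the value of \<open>f\<close>.\<close>

lemma decomposes_exists:
  assumes f: "f \<in> DM_space \<Lambda> X"
  shows "\<exists>h. decomposes f h"
proof -
  have zero: "eval_functional f (W e * Ps e q) = 0" if e: "e \<in> V" and q: "q \<in> J e" for e q
  proof (rule eval_functional_DM[OF f JN_local])
    show "W e * Ps e q \<in> group_alg \<Lambda>" by (rule lift_ga[OF e J_fam_polys[OF q]])
    fix e' assume e': "e' \<in> V"
    show "Ph e' (W e * Ps e q) \<in> J e'"
    proof (cases "e' = e")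
      case True
      show ?thesis using J_fam_add[OF Phi_lift_self[OF e J_fam_polys[OF q]] q] by (simp add: True)
    next
      case False
      then show ?thesis by (rule Phi_lift_other[OF e' e _ J_fam_polys[OF q]])
    qed
  qed
  have "\<exists>h. h \<in> polys d \<and> (\<forall>q\<in>polys d. pairing q h = eval_functional f (W e * Ps e q))" if e: "e \<in> V" for e
  proof -
    obtain h where "h \<in> polys d" "\<And>q. q \<in> polys d \<Longrightarrow> pairing q h = eval_functional f (W e * Ps e q)"
      using functional_represented[OF finite_fixed_idx V_span[OF e], of "\<lambda>q. eval_functional f (W e * Ps e q)"] zero[OF e]
      by (auto simp: eval_functional_def Psi_add Psi_cscale distrib_left lin_add lin_cscale)
    then show ?thesis by blast
  qed
  then obtain h where h: "\<And>e. e \<in> V \<Longrightarrow> h e \<in> polys d"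
    "\<And>e q. e \<in> V \<Longrightarrow> q \<in> polys d \<Longrightarrow> pairing q (h e) = eval_functional f (W e * Ps e q)" by metis
  have D: "pairing q (h e) = 0" if "e \<in> V" "q \<in> J e" for e q
    unfolding h(2)[OF that(1) J_fam_polys[OF that(2)]] by (rule zero[OF that])
  define H where "H = (\<Sum>e\<in>V. single e (h e))"
  have H: "lookup H e = (if e \<in> V then h e else 0)" for e
    unfolding H_def lookup_sum lookup_single when_def using finV by (simp add: sum.delta')
  have "decomposes f H"
    unfolding decomposes_def
  proof (intro conjI ballI)
    show "keys H \<subseteq> V" by (auto simp: in_keys_iff H split: if_splits)
    show "lookup H e \<in> D_space bs (fixed_part X e)" if "e \<in> V" for e
      using that h(1) D by (simp add: H D_space_fixed)
    fix a assume a: "a \<in> \<Lambda>"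
    let ?g = "single a 1 :: 'a \<Rightarrow>\<^sub>0 complex"
    have "eval_functional f (?g - (\<Sum>e\<in>V. W e * Ps e (Ph e ?g))) = 0"
      by (rule eval_functional_DM[OF f sum_lift_JN[OF single_ga[OF a]]])
    then have "f a = (\<Sum>e\<in>V. eval_functional f (W e * Ps e (Ph e ?g)))"
      by (simp add: eval_functional_def lin_diff lin_sum)
    also have "\<dots> = (\<Sum>e\<in>V. e a * eval_at bs (lookup H e) a)"
    proof (rule sum.cong[OF refl])
      fix e assume e: "e \<in> V"
      have "eval_functional f (W e * Ps e (Ph e ?g)) = pairing (Ph e ?g) (h e)"
        by (rule h(2)[OF e Phi_polys, symmetric])
      also have "\<dots> = e a * pairing (trunc_exp N a) (h e)" by (simp add: Phi_single pairing_cscale)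
      also have "\<dots> = e a * eval_at bs (h e) a" using D_pairing_trunc_exp[OF e h(1)[OF e] D[OF e]] by simp
      finally show "eval_functional f (W e * Ps e (Ph e ?g)) = e a * eval_at bs (lookup H e) a"
        using e by (simp add: H)
    qed
    finally show "f a = (\<Sum>e\<in>V. e a * eval_at bs (lookup H e) a)" .
  qed
  then show ?thesis by blast
qed

lemma decomposes_DM_components:
  assumes "f \<in> DM_space \<Lambda> X"
  shows "decomposes f (DM_components \<Lambda> bs X f)"
proof -
  obtain h where h: "decomposes f h" using decomposes_exists[OF assms] by blast
  have "DM_components \<Lambda> bs X f = (THE h. decomposes f h)"
    unfolding DM_components_def decomposes_def ..
  also have "\<dots> = h" by (rule the_equality[of "decomposes f", OF h]) (rule decomposes_unique[OF _ h])
  finally show ?thesis using h by simp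
qed


subsection \<open>The isomorphism\<close>

definition component :: "('a character \<Rightarrow>\<^sub>0 mpoly) \<Rightarrow> 'a character \<Rightarrow> mpoly"
  where "component p e = per_component bs X p e"

abbreviation moved_form :: "'a character \<Rightarrow> mpoly"
  where "moved_form e \<equiv> form_prod bs (moved_part X e)"

text \<open>A moved vector cannot be 0, as \<open>e 0 = 1\<close>. Hence the factor of the moved
  vectors can be cancelled and components are well defined.\<close>

lemma moved_form_nonzero: "e \<in> V \<Longrightarrow> moved_form e \<noteq> 0"
proof -
  assume "e \<in> V"
  then have "e 0 = 1" by (intro torus_zero V_torus)
  then show ?thesis by (auto simp: form_prod_def prod_list_zero_iff moved_part_def lf_eq_0)
qed

lemma component_unique:
  assumes "e \<in> V" "q \<in> P_space bs (fixed_part X e)" "lookup p e = moved_form e * q"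
  shows "component p e = q"
  unfolding component_def per_component_def
  by (rule the_equality) (use assms moved_form_nonzero in auto)

lemma component_P:
  assumes "p \<in> P_per \<Lambda> bs X" "e \<in> V"
  shows "component p e \<in> P_space bs (fixed_part X e)" "lookup p e = moved_form e * component p e"
proof -
  obtain q where "q \<in> P_space bs (fixed_part X e)" "lookup p e = moved_form e * q"
    using assms by (auto simp: P_per_def)
  then show "component p e \<in> P_space bs (fixed_part X e)" "lookup p e = moved_form e * component p e"
    using component_unique[OF assms(2)] by auto
qed

lemma component_polys: "p \<in> P_per \<Lambda> bs X \<Longrightarrow> e \<in> V \<Longrightarrow> component p e \<in> polys d"
  using component_P(1) unfolding P_space_fixed by (rule P_fam_polys)

text \<open>The graph of the isomorphism before passing to cosets. It fixes \<open>g\<close> up to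
  \<open>JN\<close>, so the choice made in \<open>L\<close> does not matter.\<close>

definition represents :: "('a character \<Rightarrow>\<^sub>0 mpoly) \<Rightarrow> ('a \<Rightarrow>\<^sub>0 complex) \<Rightarrow> bool"
  where "represents p g \<longleftrightarrow> g \<in> group_alg \<Lambda> \<and> (\<forall>e\<in>V. Ph e g - component p e \<in> J e)"

lemma represents_ga: "represents p g \<Longrightarrow> g \<in> group_alg \<Lambda>"
  and represents_J: "represents p g \<Longrightarrow> e \<in> V \<Longrightarrow> Ph e g - component p e \<in> J e"
  by (simp_all add: represents_def)

lemma represents_exists:
  assumes "p \<in> P_per \<Lambda> bs X"
  shows "\<exists>g. represents p g"
  unfolding represents_def
  by (intro exI[of _ "\<Sum>e\<in>V. W e * Ps e (component p e)"] conjI ballI Phi_sum_lift ga.sum_in lift_ga component_polys assms)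

lemma represents_diff:
  assumes "represents p g" "represents p g'"
  shows "g - g' \<in> JN"
proof (rule JN_local)
  show "g - g' \<in> group_alg \<Lambda>" using assms by (auto simp: represents_def)
  fix e assume e: "e \<in> V"
  have "(Ph e g - component p e) - (Ph e g' - component p e) \<in> J e"
    by (rule J_fam_diff[OF represents_J[OF assms(1) e] represents_J[OF assms(2) e]])
  then show "Ph e (g - g') \<in> J e" by (simp add: Phi_diff)
qed

lemma represents_add_JN:
  assumes "represents p g" "j \<in> JN"
  shows "represents p (g + j)"
  unfolding represents_def
proof (intro conjI ballI)
  show "g + j \<in> group_alg \<Lambda>" by (rule ga.add_in[OF represents_ga[OF assms(1)] JN_ga[OF assms(2)]])
  fix e assume e: "e \<in> V"
  have "(Ph e g - component p e) + Ph e j \<in> J e"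
    by (rule J_fam_add[OF represents_J[OF assms(1) e] Phi_JN[OF assms(2) e]])
  then show "Ph e (g + j) - component p e \<in> J e" by (simp add: Phi_add algebra_simps)
qed

lemma component_add:
  assumes "p \<in> P_per \<Lambda> bs X" "p' \<in> P_per \<Lambda> bs X" "e \<in> V"
  shows "component (p + p') e = component p e + component p' e"
proof (rule component_unique[OF assms(3)])
  show "component p e + component p' e \<in> P_space bs (fixed_part X e)"
    unfolding P_space_def using component_P(1)[OF assms(1,3)] component_P(1)[OF assms(2,3)]
    by (intro cpm.span_add) (auto simp: P_space_def)
  show "lookup (p + p') e = moved_form e * (component p e + component p' e)"
    using component_P(2)[OF assms(1,3)] component_P(2)[OF assms(2,3)] by (simp add: lookup_add distrib_left)
qed

lemma lookup_per_scale: "lookup (per_scale c p) e = cscale c (lookup p e)"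
  by (simp add: per_scale_def Poly_Mapping.map.rep_eq when_def)

lemma component_scale:
  assumes "p \<in> P_per \<Lambda> bs X" "e \<in> V"
  shows "component (per_scale c p) e = cscale c (component p e)"
proof (rule component_unique[OF assms(2)])
  show "cscale c (component p e) \<in> P_space bs (fixed_part X e)"
    unfolding P_space_def using component_P(1)[OF assms] by (intro cpm.span_scale) (auto simp: P_space_def)
  show "lookup (per_scale c p) e = moved_form e * cscale c (component p e)"
    using component_P(2)[OF assms] by (simp add: lookup_per_scale)
qed

text \<open>Surjectivity uses that \<open>P_fam\<close> and the cocircuit ideal together span at
  each vertex.\<close>

lemma represents_surj:
  assumes g: "g \<in> group_alg \<Lambda>"
  shows "\<exists>p\<in>P_per \<Lambda> bs X. represents p g"
proof -
  have "\<exists>q. q \<in> P_space bs (fixed_part X e) \<and> Ph e g - q \<in> J e" if e: "e \<in> V" for e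
  proof -
    obtain q j where "Ph e g = q + j" "q \<in> P_fam ((!) X) (K e)" "j \<in> J e"
      by (rule P_fam_plus_J_fam[OF finite_fixed_idx V_span[OF e] Phi_polys])
    then show ?thesis by (intro exI[of _ q]) (simp add: P_space_fixed)
  qed
  then obtain q where q: "\<And>e. e \<in> V \<Longrightarrow> q e \<in> P_space bs (fixed_part X e)" "\<And>e. e \<in> V \<Longrightarrow> Ph e g - q e \<in> J e"
    by metis
  define p where "p = (\<Sum>e\<in>V. single e (moved_form e * q e))"
  have p: "lookup p e = (if e \<in> V then moved_form e * q e else 0)" for e
    unfolding p_def lookup_sum lookup_single when_def using finV by (simp add: sum.delta')
  have "p \<in> P_per \<Lambda> bs X"
    unfolding P_per_def using q(1) by (auto simp: p in_keys_iff split: if_splits)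
  moreover have "represents p g"
    unfolding represents_def using g q component_unique[OF _ q(1)] by (simp add: p)
  ultimately show ?thesis by blast
qed

text \<open>Two components representing the same expansion differ by an element of both
  \<open>P_fam\<close> and the ideal, which is 0.\<close>

lemma represents_inj:
  assumes p: "p \<in> P_per \<Lambda> bs X" "p' \<in> P_per \<Lambda> bs X" and g: "represents p g" "represents p' g"
  shows "p = p'"
proof (rule poly_mapping_eqI)
  fix e show "lookup p e = lookup p' e"
  proof (cases "e \<in> V")
    case True
    have "(Ph e g - component p' e) - (Ph e g - component p e) \<in> J e"
      by (rule J_fam_diff[OF represents_J[OF g(2) True] represents_J[OF g(1) True]])
    then have "component p e - component p' e \<in> J e" by simp
    moreover have "component p e - component p' e \<in> P_fam ((!) X) (K e)"
      using component_P(1)[OF p(1) True] component_P(1)[OF p(2) True] unfolding P_space_fixed P_fam_def by (rule cpm.span_diff)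
    ultimately have "component p e - component p' e = 0"
      by (intro P_fam_inter_J_fam[OF finite_fixed_idx V_span[OF True]])
    then show ?thesis using component_P(2)[OF p(1) True] component_P(2)[OF p(2) True] by simp
  next
    case False
    then have "e \<notin> keys p" "e \<notin> keys p'" using p by (auto simp: P_per_def)
    then show ?thesis by (simp add: in_keys_iff)
  qed
qed

abbreviation RA :: "('a \<Rightarrow>\<^sub>0 complex) ring" where "RA \<equiv> ring_on (group_alg \<Lambda>)"

definition L :: "('a character \<Rightarrow>\<^sub>0 mpoly) \<Rightarrow> ('a \<Rightarrow>\<^sub>0 complex) set"
  where "L p = JN +>\<^bsub>RA\<^esub> (SOME g. represents p g)"

lemma JN_ideal: "ideal JN RA"
  by (rule nabla_ideal_ideal[OF finite_lessThan X_image_sub])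

lemma coset_eq_iff: "g \<in> group_alg \<Lambda> \<Longrightarrow> g' \<in> group_alg \<Lambda> \<Longrightarrow> JN +>\<^bsub>RA\<^esub> g = JN +>\<^bsub>RA\<^esub> g' \<longleftrightarrow> g - g' \<in> JN"
proof -
  assume g: "g \<in> group_alg \<Lambda>" "g' \<in> group_alg \<Lambda>"
  have ring: "ring RA" by (rule ga.ring_ring_on)
  have "a_minus RA g g' = g - g'"
  proof -
    have "\<ominus>\<^bsub>RA\<^esub> g' = - g'"
      by (rule abelian_group.minus_equality[OF ring.is_abelian_group[OF ring]]) (use g in \<open>auto simp: ring_on_def\<close>)
    then show ?thesis by (simp add: a_minus_def ring_on_def)
  qed
  then show ?thesis
    using ring.quotient_eq_iff_same_a_r_cos[OF ring JN_ideal, of g g'] g by (simp add: ring_on_def)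
qed

lemma L_rep:
  assumes "represents p g"
  shows "L p = JN +>\<^bsub>RA\<^esub> g"
proof -
  have s: "represents p (SOME g. represents p g)" using assms by (rule someI)
  then show ?thesis
    unfolding L_def using coset_eq_iff[OF represents_ga[OF s] represents_ga[OF assms]] represents_diff[OF s assms] by blast
qed

lemma coset_hom: "(\<lambda>g. JN +>\<^bsub>RA\<^esub> g) \<in> ring_hom RA (RA Quot JN)"
  using ideal.rcos_ring_hom[OF JN_ideal] .

lemma L_add:
  assumes p: "p \<in> P_per \<Lambda> bs X" "p' \<in> P_per \<Lambda> bs X"
  shows "L (p + p') = L p \<oplus>\<^bsub>RA Quot JN\<^esub> L p'"
proof -
  obtain g g' where g: "represents p g" "represents p' g'" using represents_exists p by blast
  have "represents (p + p') (g + g')"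
    unfolding represents_def
  proof (intro conjI ballI)
    show "g + g' \<in> group_alg \<Lambda>" using g by (auto simp: represents_def)
    fix e assume e: "e \<in> V"
    have "(Ph e g - component p e) + (Ph e g' - component p' e) \<in> J e"
      by (rule J_fam_add[OF represents_J[OF g(1) e] represents_J[OF g(2) e]])
    then show "Ph e (g + g') - component (p + p') e \<in> J e"
      by (simp add: Phi_add component_add[OF p e] algebra_simps)
  qed
  from L_rep[OF this] show ?thesis
    using ring_hom_add[OF coset_hom, of g g'] g L_rep[OF g(1)] L_rep[OF g(2)] by (simp add: represents_def ring_on_def)
qed

lemma L_scale:
  assumes p: "p \<in> P_per \<Lambda> bs X"
  shows "L (per_scale c p) = (JN +>\<^bsub>RA\<^esub> single 0 c) \<otimes>\<^bsub>RA Quot JN\<^esub> L p"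
proof -
  obtain g where g: "represents p g" using represents_exists p by blast
  have "represents (per_scale c p) (single 0 c * g)"
    unfolding represents_def
  proof (intro conjI ballI)
    show "single 0 c * g \<in> group_alg \<Lambda>" using g by (auto simp: represents_def)
    fix e assume e: "e \<in> V"
    have "cscale c (Ph e g - component p e) \<in> J e"
      by (rule J_fam_cscale[OF represents_J[OF g e]])
    then show "Ph e (single 0 c * g) - component (per_scale c p) e \<in> J e"
      by (simp add: Phi_cscale component_scale[OF p e] cpm.scale_right_diff_distrib flip: cscale_def)
  qed
  from L_rep[OF this] show ?thesis
    using ring_hom_mult[OF coset_hom, of "single 0 c" g] g L_rep[OF g] by (simp add: represents_def ring_on_def)
qed

lemma L_bij: "bij_betw L (P_per \<Lambda> bs X) (carrier (RA Quot JN))"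
proof (rule bij_betwI')
  fix p p' assume p: "p \<in> P_per \<Lambda> bs X" "p' \<in> P_per \<Lambda> bs X"
  show "L p = L p' \<longleftrightarrow> p = p'"
  proof
    assume eq: "L p = L p'"
    obtain g g' where g: "represents p g" "represents p' g'" using represents_exists p by blast
    then have "g - g' \<in> JN"
      using eq coset_eq_iff L_rep[OF g(1)] L_rep[OF g(2)] by (simp add: represents_def)
    then have "represents p' (g' + (g - g'))" by (rule represents_add_JN[OF g(2)])
    then show "p = p'" using represents_inj[OF p g(1)] by simp
  qed simp
next
  fix p assume "p \<in> P_per \<Lambda> bs X"
  then obtain g where g: "represents p g" using represents_exists by blast
  then show "L p \<in> carrier (RA Quot JN)"
    unfolding L_rep[OF g] by (auto simp: FactRing_def A_RCOSETS_def' represents_def ring_on_def)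
next
  fix A assume "A \<in> carrier (RA Quot JN)"
  then obtain g where "g \<in> group_alg \<Lambda>" "A = JN +>\<^bsub>RA\<^esub> g"
    by (auto simp: FactRing_def A_RCOSETS_def' ring_on_def)
  then show "\<exists>p\<in>P_per \<Lambda> bs X. A = L p" using represents_surj L_rep by metis
qed

lemma L_mem:
  assumes "represents p g"
  shows "g' \<in> L p \<Longrightarrow> represents p g'" "g \<in> L p"
proof -
  have L: "L p = {j + g | j. j \<in> JN}"
    unfolding L_rep[OF assms] by (auto simp: a_r_coset_def' ring_on_def)
  show "represents p g'" if "g' \<in> L p"
    using that represents_add_JN[OF assms] unfolding L by (auto simp: add.commute)
  show "g \<in> L p" unfolding L using JN_zero by force
qed

lemma pairing_L:
  assumes p: "p \<in> P_per \<Lambda> bs X" and f: "f \<in> DM_space \<Lambda> X"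
  shows "nabla_pairing \<Lambda> bs X p f = quot_pairing (L p) f"
proof -
  let ?h = "DM_components \<Lambda> bs X f"
  have h: "decomposes f ?h" by (rule decomposes_DM_components[OF f])
  have D: "pairing q (lookup ?h e) = 0" if "e \<in> V" "q \<in> J e" for e q
    using h that by (auto simp: decomposes_def D_space_fixed)
  obtain g where g: "represents p g" using represents_exists p by blast
  \<comment> \<open>All members of the coset must give one value for \<open>the_elem\<close> to
    return it. Each represents \<open>p\<close>, so its expansions may be replaced by the components
    of \<open>p\<close>, the differences being annihilated by the components of
    \<open>f\<close>.\<close>
  have "(\<Sum>a\<in>keys g'. lookup g' a * f a) = nabla_pairing \<Lambda> bs X p f" if "g' \<in> L p" for g'
  proof -
    have g': "represents p g'" by (rule L_mem(1)[OF g that])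
    have "(\<Sum>a\<in>keys g'. lookup g' a * f a) = eval_functional f g'"
      by (simp add: eval_functional_def lin_def)
    also have "\<dots> = (\<Sum>e\<in>V. pairing (Ph e g') (lookup ?h e))"
      by (rule decomposes_functional[OF h]) (use g' in \<open>simp add: represents_def\<close>)
    also have "\<dots> = (\<Sum>e\<in>V. pairing (component p e) (lookup ?h e))"
    proof (rule sum.cong[OF refl])
      fix e assume e: "e \<in> V"
      have "pairing (Ph e g' - component p e) (lookup ?h e) = 0"
        by (rule D[OF e]) (use g' e in \<open>simp add: represents_def\<close>)
      then show "pairing (Ph e g') (lookup ?h e) = pairing (component p e) (lookup ?h e)"
        by (simp add: pairing_diff)
    qed
    finally show ?thesis by (simp add: nabla_pairing_def component_def)
  qed
  then have "(\<lambda>g. \<Sum>a\<in>keys g. lookup g a * f a) ` L p = {nabla_pairing \<Lambda> bs X p f}"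
    using L_mem(2)[OF g] by auto
  then show ?thesis by (simp add: quot_pairing_def)
qed

end

theorem theorem7p4:
  fixes \<Lambda> :: "'u::real_vector set" and bs X :: "'u list"
  assumes "lattice_basis \<Lambda> bs"
    and "set X \<subseteq> \<Lambda>"
    and "span (set X) = UNIV"
  shows "\<exists>L. linear_iso_DM_quot \<Lambda> bs X L \<and>
    (\<forall>p\<in>P_per \<Lambda> bs X. \<forall>f\<in>DM_space \<Lambda> X.
       nabla_pairing \<Lambda> bs X p f = quot_pairing (L p) f)"
proof -
  interpret spanning_list \<Lambda> bs X by unfold_locales (use assms in auto)
  show ?thesis
  proof (rule local_global)
    fix N :: nat and W :: "'u character \<Rightarrow> 'u \<Rightarrow>\<^sub>0 complex"
    assume units: "N \<ge> 2" "length X < N" "finite V" "\<And>e. e \<in> V \<Longrightarrow> W e \<in> group_alg \<Lambda>"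
      "\<And>e e'. e \<in> V \<Longrightarrow> e' \<in> V \<Longrightarrow> e \<noteq> e' \<Longrightarrow> Phi N e (W e') \<in> mN (Suc (length X))"
      "\<And>e. e \<in> V \<Longrightarrow> cong_mN (Suc (length X)) (Phi N e (W e)) 1"
      "\<And>g. g \<in> group_alg \<Lambda> \<Longrightarrow> (\<And>e. e \<in> V \<Longrightarrow> Phi N e g \<in> J e) \<Longrightarrow> g \<in> JN"
    interpret local_units \<Lambda> bs X N W
      by (rule local_units.intro[OF spanning_list_axioms local_units_axioms.intro[OF units]])
    show ?thesis
      unfolding linear_iso_DM_quot_def quot_scale_def J_nabla_eq
      using L_bij L_add L_scale pairing_L by (intro exI[of _ L] conjI ballI allI)
  qed
qed

end
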